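(* Let $n\in\mathbb{N}_0$ with $n\ge2$. If $S$ is an extension of $L(n)$ by $L(n-2)$, then $S$ is isomorphic, as a $\mathcal{D}$-module, either to $L(n)\oplus L(n-2)$ or to $T(n-2,1)^*$. Also, $$\dim\operatorname{Ext}^1_{\mathcal{D}}(L(n),L(n-2))=1.$$
   Context: $\Bbbk$ is an algebraically closed field of characteristic $0$; $\mathbb{N}_0=\{0,1,2,\dots\}$. $\mathcal{D}$ (the double of the Jordan plane) is the $\Bbbk$-algebra presented by generators $u, v, \xi, g, g^{-1}, x, y$ and relations $g g^{-1}=g^{-1}g=1$, $\xi g=g\xi$, $gx=xg$, $gy=yg+xg$, $\xi y=y\xi-2y$, $\xi x=x\xi-2x$, $ug=gu$, $vg=gv+gu$, $v\xi=\xi v-2v$, $u\xi=\xi u-2u$, $yx=xy-\tfrac12x^2$, $vu=uv-\tfrac12u^2$, $ux=xu$, $vx=xv+(1-g)+xu$, $uy=yu+(1-g)$, $vy=yv+\tfrac12 g\xi+yu$. It is a Hopf algebra with $g$ group-like, $\Delta(u)=u\otimes1+1\otimes u$, $\Delta(\xi)=\xi\otimes1+1\otimes\xi$, $\Delta(x)=x\otimes1+g\otimes x$, $\Delta(y)=y\otimes1+g\otimes y$, $\Delta(v)=v\otimes1+1\otimes v-\tfrac12\xi\otimes u$; its antipode $\mathcal{S}$ satisfies $\mathcal{S}(g)=g^{-1}$, $\mathcal{S}(x)=-g^{-1}x$, $\mathcal{S}(y)=-g^{-1}y$, $\mathcal{S}(\xi)=-\xi$, $\mathcal{S}(u)=-u$,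 $\mathcal{S}(v)=-v-\tfrac12\xi u$. Modules are left modules; the dual $M^*$ of a finite-dimensional $\mathcal{D}$-module $M$ has action $\langle d\cdot f,m\rangle=\langle f,\mathcal{S}(d)\cdot m\rangle$. For $n\in\mathbb{N}_0$, $L(n)$ is the simple $\mathcal{D}$-module with basis $z_{n,0},\dots,z_{n,n}$ and action $\xi\cdot z_{n,i}=(n-2i)z_{n,i}$, $v\cdot z_{n,i}=\tfrac{i(n-i+1)}2z_{n,i-1}$, $y\cdot z_{n,i}=z_{n,i+1}$, $x\cdot z_{n,i}=0$, $u\cdot z_{n,i}=0$, $g\cdot z_{n,i}=z_{n,i}$, where $z_{n,-1}=z_{n,n+1}=0$. For $k\in\mathbb{N}_0$, $T(k,1)$ is the (finite-dimensional) $\mathcal{D}$-module presented by one generator $z$ with defining relations $g\cdot z=z$, $\xi\cdot z=(k+2)z$, $u\cdot z=0$, $v\cdot z=0$, $x^2\cdot z=0$, $y^{k+3}\cdot z=0$, $y^{k+1}x\cdot z=0$. An extension of $L(n)$ by $L(m)$ is a short exact sequence $0\to L(n)\to S\to L(m)\to0$ of $\mathcal{D}$-modules (by abuse of language, also $S$ is called an extension); $\operatorname{Ext}^1_{\mathcal{D}}(L(n),L(m))$ denotes the vector space of equivalence classes of such extensions. *)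

theory Defs
  imports
    "Jordan_Normal_Form.VS_Connect"
    "HOL-Library.Poly_Mapping"
    "HOL-Algebra.QuotRing"
begin

hide_const (open) Modules.module_hom

section \<open>Left modules over a ring that need not be commutative\<close>

text \<open>
  The library locale \<open>module\<close> requires a commutative ring of scalars.  We keep its records (and
  \<^const>\<open>module_hom\<close>, \<^const>\<open>direct_sum\<close>, which make no use of commutativity) and drop that
  requirement.  The fields \<open>mult\<close> and \<open>one\<close> of a module record carry no meaning.
\<close>

locale left_module = R?: ring R + M?: abelian_group M
  for R :: "'r ring" (structure) and M :: "('r, 'm) module" (structure) +
  assumes smult_closed:
      "\<lbrakk>a \<in> carrier R; x \<in> carrier M\<rbrakk> \<Longrightarrow> a \<odot>\<^bsub>M\<^esub> x \<in> carrier M"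
    and smult_l_distr:
      "\<lbrakk>a \<in> carrier R; b \<in> carrier R; x \<in> carrier M\<rbrakk> \<Longrightarrow>
        (a \<oplus>\<^bsub>R\<^esub> b) \<odot>\<^bsub>M\<^esub> x = a \<odot>\<^bsub>M\<^esub> x \<oplus>\<^bsub>M\<^esub> b \<odot>\<^bsub>M\<^esub> x"
    and smult_r_distr:
      "\<lbrakk>a \<in> carrier R; x \<in> carrier M; y \<in> carrier M\<rbrakk> \<Longrightarrow>
        a \<odot>\<^bsub>M\<^esub> (x \<oplus>\<^bsub>M\<^esub> y) = a \<odot>\<^bsub>M\<^esub> x \<oplus>\<^bsub>M\<^esub> a \<odot>\<^bsub>M\<^esub> y"
    and smult_assoc1:
      "\<lbrakk>a \<in> carrier R; b \<in> carrier R; x \<in> carrier M\<rbrakk> \<Longrightarrow>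
        (a \<otimes>\<^bsub>R\<^esub> b) \<odot>\<^bsub>M\<^esub> x = a \<odot>\<^bsub>M\<^esub> (b \<odot>\<^bsub>M\<^esub> x)"
    and smult_one:
      "x \<in> carrier M \<Longrightarrow> \<one>\<^bsub>R\<^esub> \<odot>\<^bsub>M\<^esub> x = x"

definition module_iso ::
    "'r ring \<Rightarrow> ('r, 'm) module \<Rightarrow> ('r, 'n) module \<Rightarrow> ('m \<Rightarrow> 'n) set" where
  "module_iso R M N = {f \<in> module_hom R M N. bij_betw f (carrier M) (carrier N)}"

definition isomorphic_modules ::
    "'r ring \<Rightarrow> ('r, 'm) module \<Rightarrow> ('r, 'n) module \<Rightarrow> bool" where
  "isomorphic_modules R M N \<longleftrightarrow> module_iso R M N \<noteq> {}"

definition left_submodule :: "'r ring \<Rightarrow> ('r, 'm) module \<Rightarrow> 'm set \<Rightarrow> bool" where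
  "left_submodule R M N \<longleftrightarrow>
     additive_subgroup N M \<and> (\<forall>r\<in>carrier R. \<forall>x\<in>N. r \<odot>\<^bsub>M\<^esub> x \<in> N)"

definition generated_submodule :: "'r ring \<Rightarrow> ('r, 'm) module \<Rightarrow> 'm set \<Rightarrow> 'm set" where
  "generated_submodule R M X = \<Inter>{N. left_submodule R M N \<and> X \<subseteq> N}"

definition quotient_module :: "('r, 'm) module \<Rightarrow> 'm set \<Rightarrow> ('r, 'm set) module" where
  "quotient_module M N =
     \<lparr>carrier = a_rcosets\<^bsub>M\<^esub> N, mult = undefined, one = undefined,
      zero = N, add = set_add M,
      smult = (\<lambda>r C. \<Union>x\<in>C. N +>\<^bsub>M\<^esub> (r \<odot>\<^bsub>M\<^esub> x))\<rparr>"

definition regular_module :: "'r ring \<Rightarrow> ('r, 'r) module" where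
  "regular_module R =
     \<lparr>carrier = carrier R, mult = undefined, one = undefined,
      zero = \<zero>\<^bsub>R\<^esub>, add = add R, smult = mult R\<rparr>"


section \<open>Extensions of modules\<close>

text \<open>
  The direction is the one of the source: an extension of \<open>A\<close> by \<open>B\<close> is a short exact sequence
  \<open>0 \<rightarrow> A \<rightarrow> S \<rightarrow> B \<rightarrow> 0\<close>, and \<open>Ext\<^sup>1(A, B)\<close> consists of the classes of these.
  (Many texts denote that space by \<open>Ext\<^sup>1(B, A)\<close>.)
\<close>

record ('r, 'a, 'b, 's) extension =
  middle :: "('r, 's) module"
  incl :: "'a \<Rightarrow> 's"
  proj :: "'s \<Rightarrow> 'b"

definition is_extension ::
    "'r ring \<Rightarrow> ('r, 'a) module \<Rightarrow> ('r, 'b) module \<Rightarrow> ('r, 'a, 'b, 's) extension \<Rightarrow> bool" where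
  "is_extension R A B E \<longleftrightarrow>
     left_module R A \<and> left_module R (middle E) \<and> left_module R B \<and>
     incl E \<in> module_hom R A (middle E) \<and> inj_on (incl E) (carrier A) \<and>
     proj E \<in> module_hom R (middle E) B \<and> proj E ` carrier (middle E) = carrier B \<and>
     incl E ` carrier A = {s \<in> carrier (middle E). proj E s = \<zero>\<^bsub>B\<^esub>}"

definition extension_module ::
    "'r ring \<Rightarrow> ('r, 'a) module \<Rightarrow> ('r, 'b) module \<Rightarrow> ('r, 's) module \<Rightarrow> bool" where
  "extension_module R A B S \<longleftrightarrow>
     (\<exists>E :: ('r, 'a, 'b, 's) extension. is_extension R A B E \<and> middle E = S)"

definition equivalent_extensions ::
    "'r ring \<Rightarrow> ('r, 'a) module \<Rightarrow> ('r, 'a, 'b, 's) extension \<Rightarrow> ('r, 'a, 'b, 't) extension \<Rightarrow> bool"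
  where
  "equivalent_extensions R A E E' \<longleftrightarrow>
     (\<exists>\<phi>\<in>module_iso R (middle E) (middle E').
        (\<forall>a\<in>carrier A. \<phi> (incl E a) = incl E' a) \<and>
        (\<forall>s\<in>carrier (middle E). proj E' (\<phi> s) = proj E s))"

text \<open>
  Equivalence classes need a fixed type for the middle modules.  The type \<open>'a \<times> 'b\<close> is large
  enough: see lemma \<open>extension_on_product\<close> below.  The class of an extension whose middle module
  lives on any type is the set of equivalent extensions on that type.
\<close>

definition extension_class ::
    "'r ring \<Rightarrow> ('r, 'a) module \<Rightarrow> ('r, 'b) module \<Rightarrow> ('r, 'a, 'b, 's) extension \<Rightarrow>
      ('r, 'a, 'b, 'a \<times> 'b) extension set" where
  "extension_class R A B E = {E'. is_extension R A B E' \<and> equivalent_extensions R A E E'}"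

definition split_extension ::
    "('r, 'a) module \<Rightarrow> ('r, 'b) module \<Rightarrow> ('r, 'a, 'b, 'a \<times> 'b) extension" where
  "split_extension A B = \<lparr>middle = direct_sum A B, incl = inj1 A B, proj = snd\<rparr>"

text \<open>The Baer sum: the fibre product of the two middle modules over \<open>B\<close>, modulo the
  antidiagonal copy of \<open>A\<close>.\<close>

definition fibre_product ::
    "('r, 'a, 'b, 's) extension \<Rightarrow> ('r, 'a, 'b, 't) extension \<Rightarrow> ('r, 's \<times> 't) module" where
  "fibre_product E F = (direct_sum (middle E) (middle F))
     \<lparr>carrier := {(s, t). s \<in> carrier (middle E) \<and> t \<in> carrier (middle F) \<and> proj E s = proj F t}\<rparr>"

definition antidiagonal ::
    "('r, 'a) module \<Rightarrow> ('r, 'a, 'b, 's) extension \<Rightarrow> ('r, 'a, 'b, 't) extension \<Rightarrow> ('s \<times> 't) set"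
  where
  "antidiagonal A E F = (\<lambda>a. (incl E a, \<ominus>\<^bsub>middle F\<^esub> incl F a)) ` carrier A"

definition baer_sum ::
    "('r, 'a) module \<Rightarrow> ('r, 'a, 'b, 's) extension \<Rightarrow> ('r, 'a, 'b, 't) extension \<Rightarrow>
      ('r, 'a, 'b, ('s \<times> 't) set) extension" where
  "baer_sum A E F =
     \<lparr>middle = quotient_module (fibre_product E F) (antidiagonal A E F),
      incl = (\<lambda>a. antidiagonal A E F +>\<^bsub>fibre_product E F\<^esub> (incl E a, \<zero>\<^bsub>middle F\<^esub>)),
      proj = (\<lambda>C. the_elem ((\<lambda>(s, t). proj E s) ` C))\<rparr>"

text \<open>The pushout \<open>h\<^sub>*E\<close> of an extension of \<open>A\<close> along an endomorphism \<open>h\<close> of \<open>A\<close>.\<close>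

definition pushout_relations ::
    "('r, 'a) module \<Rightarrow> ('a \<Rightarrow> 'a) \<Rightarrow> ('r, 'a, 'b, 's) extension \<Rightarrow> ('a \<times> 's) set" where
  "pushout_relations A h E = (\<lambda>a. (h a, \<ominus>\<^bsub>middle E\<^esub> incl E a)) ` carrier A"

definition pushout_extension ::
    "('r, 'a) module \<Rightarrow> ('a \<Rightarrow> 'a) \<Rightarrow> ('r, 'a, 'b, 's) extension \<Rightarrow>
      ('r, 'a, 'b, ('a \<times> 's) set) extension" where
  "pushout_extension A h E =
     \<lparr>middle = quotient_module (direct_sum A (middle E)) (pushout_relations A h E),
      incl = (\<lambda>a. pushout_relations A h E +>\<^bsub>direct_sum A (middle E)\<^esub> (a, \<zero>\<^bsub>middle E\<^esub>)),
      proj = (\<lambda>C. the_elem ((\<lambda>(a, s). proj E s) ` C))\<rparr>"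

lemma extension_transport:
  fixes E :: "('r, 'a, 'b, 's) extension" and \<phi> :: "'s \<Rightarrow> 't"
  assumes E: "is_extension R A B E" and inj: "inj_on \<phi> (carrier (middle E))"
  shows "\<exists>E' :: ('r, 'a, 'b, 't) extension.
           is_extension R A B E' \<and> equivalent_extensions R A E E'"
proof -
  let ?S = "middle E" and ?i = "incl E" and ?p = "proj E"
  interpret S: left_module R ?S using E by (simp add: is_extension_def)
  define \<psi> where "\<psi> = inv_into (carrier ?S) \<phi>"
  have \<psi>: "\<psi> (\<phi> x) = x" if "x \<in> carrier ?S" for x
    using that inj by (simp add: \<psi>_def)
  define S' :: "('r, 't) module" where "S' =
     \<lparr>carrier = \<phi> ` carrier ?S, mult = undefined, one = undefined,
      zero = \<phi> \<zero>\<^bsub>?S\<^esub>, add = (\<lambda>u v. \<phi> (\<psi> u \<oplus>\<^bsub>?S\<^esub> \<psi> v)),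
      smult = (\<lambda>r u. \<phi> (r \<odot>\<^bsub>?S\<^esub> \<psi> u))\<rparr>"
  have "abelian_group S'"
  proof (rule abelian_groupI)
    fix u assume "u \<in> carrier S'"
    then obtain x where "x \<in> carrier ?S" "u = \<phi> x" by (auto simp: S'_def)
    then show "\<exists>v\<in>carrier S'. v \<oplus>\<^bsub>S'\<^esub> u = \<zero>\<^bsub>S'\<^esub>"
      by (intro bexI[of _ "\<phi> (\<ominus>\<^bsub>?S\<^esub> x)"]) (auto simp: S'_def \<psi> S.M.l_neg)
  qed (auto simp: S'_def \<psi> S.M.a_ac)
  then have lm: "left_module R S'"
    by (intro left_module.intro left_module_axioms.intro S.R.ring_axioms)
       (auto simp: S'_def \<psi> S.smult_closed S.smult_l_distr S.smult_r_distr S.smult_assoc1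
         S.smult_one)
  have i: "?i a \<in> carrier ?S" if "a \<in> carrier A" for a
    using E that by (auto simp: is_extension_def LinearCombinations.module_hom_def)
  define E' :: "('r, 'a, 'b, 't) extension" where
    "E' = \<lparr>middle = S', incl = \<phi> \<circ> ?i, proj = ?p \<circ> \<psi>\<rparr>"
  have "incl E' \<in> module_hom R A S'"
    using E i by (auto simp: is_extension_def LinearCombinations.module_hom_def E'_def S'_def \<psi>)
  moreover have "inj_on (incl E') (carrier A)"
    using E i inj by (auto simp: is_extension_def E'_def intro!: comp_inj_on inj_on_subset[OF inj])
  moreover have "proj E' \<in> module_hom R S' B"
    using E by (auto simp: is_extension_def LinearCombinations.module_hom_def E'_def S'_def \<psi> S.smult_closed)
  moreover have "proj E' ` carrier S' = carrier B"
    using E by (auto simp: is_extension_def E'_def S'_def \<psi> image_image cong: image_cong_simp)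
  moreover have "incl E' ` carrier A = {s \<in> carrier S'. proj E' s = \<zero>\<^bsub>B\<^esub>}"
  proof -
    have "incl E' ` carrier A = \<phi> ` (?i ` carrier A)"
      by (auto simp: E'_def)
    also have "\<dots> = \<phi> ` {s \<in> carrier ?S. ?p s = \<zero>\<^bsub>B\<^esub>}"
      using E by (simp add: is_extension_def)
    also have "\<dots> = {s \<in> carrier S'. proj E' s = \<zero>\<^bsub>B\<^esub>}"
      by (auto simp: E'_def S'_def \<psi>)
    finally show ?thesis .
  qed
  ultimately have "is_extension R A B E'"
    using E lm by (simp add: is_extension_def E'_def)
  moreover have "\<phi> \<in> module_iso R ?S S'"
    using inj by (auto simp: module_iso_def LinearCombinations.module_hom_def S'_def \<psi> bij_betw_def)
  then have "equivalent_extensions R A E E'"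
    unfolding equivalent_extensions_def
    by (intro bexI[of _ \<phi>]) (auto simp: E'_def \<psi>)
  ultimately show ?thesis by blast
qed

lemma extension_on_product:
  fixes E :: "('r, 'a, 'b, 's) extension"
  assumes E: "is_extension R A B E"
  shows "\<exists>E' :: ('r, 'a, 'b, 'a \<times> 'b) extension.
           is_extension R A B E' \<and> equivalent_extensions R A E E'"
proof -
  let ?S = "middle E" and ?i = "incl E" and ?p = "proj E"
  interpret S: left_module R ?S using E by (simp add: is_extension_def)
  interpret B: left_module R B using E by (simp add: is_extension_def)
  define \<sigma> where "\<sigma> = inv_into (carrier ?S) ?p"
  have p: "?p x \<in> carrier B" if "x \<in> carrier ?S" for x
    using E that by (auto simp: is_extension_def)
  have \<sigma>: "\<sigma> b \<in> carrier ?S" "?p (\<sigma> b) = b" if "b \<in> carrier B" for b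
    using E that by (auto simp: is_extension_def \<sigma>_def intro: inv_into_into f_inv_into_f)
  have add: "?p (x \<oplus>\<^bsub>?S\<^esub> y) = ?p x \<oplus>\<^bsub>B\<^esub> ?p y" if "x \<in> carrier ?S" "y \<in> carrier ?S" for x y
    using E that by (intro LinearCombinations.module_hom_add[of _ R]) (auto simp: is_extension_def)
  have ker: "x \<ominus>\<^bsub>?S\<^esub> \<sigma> (?p x) \<in> ?i ` carrier A" if x: "x \<in> carrier ?S" for x
  proof -
    let ?d = "x \<ominus>\<^bsub>?S\<^esub> \<sigma> (?p x)"
    have d: "?d \<in> carrier ?S" using x \<sigma> p by simp
    have "?d \<oplus>\<^bsub>?S\<^esub> \<sigma> (?p x) = x"
      using x \<sigma> p by (simp add: S.M.minus_eq S.M.a_assoc S.M.l_neg)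
    then have "?p ?d \<oplus>\<^bsub>B\<^esub> ?p x = \<zero>\<^bsub>B\<^esub> \<oplus>\<^bsub>B\<^esub> ?p x"
      using add[OF d \<sigma>(1)[OF p[OF x]]] x \<sigma> p by simp
    then have "?p ?d = \<zero>\<^bsub>B\<^esub>"
      using p[OF d] p[OF x] by (metis B.M.add.right_cancel B.M.zero_closed)
    then show ?thesis using E d by (simp add: is_extension_def)
  qed
  have "inj_on (\<lambda>x. (inv_into (carrier A) ?i (x \<ominus>\<^bsub>?S\<^esub> \<sigma> (?p x)), ?p x)) (carrier ?S)"
  proof (rule inj_onI, clarsimp)
    fix x y assume x: "x \<in> carrier ?S" and y: "y \<in> carrier ?S" and pxy: "?p x = ?p y"
      and "inv_into (carrier A) ?i (x \<ominus>\<^bsub>?S\<^esub> \<sigma> (?p y)) = inv_into (carrier A) ?i (y \<ominus>\<^bsub>?S\<^esub> \<sigma> (?p y))"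
    then have "x \<ominus>\<^bsub>?S\<^esub> \<sigma> (?p y) = y \<ominus>\<^bsub>?S\<^esub> \<sigma> (?p y)"
      using ker[OF x] ker[OF y] by (metis inv_into_injective)
    then show "x = y"
      using x y \<sigma>(1)[OF p[OF y]] by (simp add: S.M.minus_eq)
  qed
  then show ?thesis by (rule extension_transport[OF E])
qed


section \<open>The double of the Jordan plane\<close>

datatype generator = U | V | Xi | G | Ginv | X | Y

datatype 'a free_monoid = Word (letters: "'a list")

instantiation free_monoid :: (type) monoid_add
begin
definition "0 = Word []"
definition "a + b = Word (letters a @ letters b)"
instance
  by standard (auto simp: zero_free_monoid_def plus_free_monoid_def)
end

text \<open>The free associative algebra, as the monoid algebra of the free monoid; products of
  \<^type>\<open>poly_mapping\<close>s are convolution products.\<close>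

type_synonym 'k free_alg = "generator free_monoid \<Rightarrow>\<^sub>0 'k"

definition gen :: "generator \<Rightarrow> 'k::field free_alg" where
  "gen a = Poly_Mapping.single (Word [a]) 1"

definition scalar :: "'k \<Rightarrow> 'k::field free_alg" where
  "scalar c = Poly_Mapping.single 0 c"

definition jordan_relations :: "('k::field free_alg \<times> 'k free_alg) set" where
  "jordan_relations =
    (let u = gen U; v = gen V; \<xi> = gen Xi; g = gen G; g' = gen Ginv; x = gen X; y = gen Y;
         half = scalar (1 / 2)
     in {(g * g', 1), (g' * g, 1),
         (\<xi> * g, g * \<xi>),
         (g * x, x * g),
         (g * y, y * g + x * g),
         (\<xi> * y, y * \<xi> - 2 * y),
         (\<xi> * x, x * \<xi> - 2 * x),
         (u * g, g * u),
         (v * g, g * v + g * u),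
         (v * \<xi>, \<xi> * v - 2 * v),
         (u * \<xi>, \<xi> * u - 2 * u),
         (y * x, x * y - half * x ^ 2),
         (v * u, u * v - half * u ^ 2),
         (u * x, x * u),
         (v * x, x * v + (1 - g) + x * u),
         (u * y, y * u + (1 - g)),
         (v * y, y * v + half * g * \<xi> + y * u)})"

definition jordan_ideal :: "'k::field free_alg set" where
  "jordan_ideal = Idl\<^bsub>class_ring\<^esub> {l - r | l r. (l, r) \<in> jordan_relations}"

type_synonym 'k jordan_double = "'k free_alg set"

definition jordan_double :: "'k::field jordan_double ring" where
  "jordan_double = class_ring Quot jordan_ideal"

definition residue_class :: "'k::field free_alg \<Rightarrow> 'k jordan_double" where
  "residue_class p = jordan_ideal +>\<^bsub>class_ring\<^esub> p"

definition kscale :: "('k::field jordan_double, 'm) module \<Rightarrow> 'k \<Rightarrow> 'm \<Rightarrow> 'm" where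
  "kscale M c m = residue_class (scalar c) \<odot>\<^bsub>M\<^esub> m"

lemma ring_jordan_double: "ring (jordan_double :: 'k::field jordan_double ring)"
  unfolding jordan_double_def jordan_ideal_def
  by (intro ideal.quotient_is_ring ring.genideal_ideal class_ring.ring_axioms) auto

text \<open>
  The antipode is the algebra antihomomorphism with the given values on generators.  It is defined on
  words, reversing them, and descends to residue classes; the union in \<open>antipode\<close> then is over equal
  sets, as for \<^const>\<open>rcoset_mult\<close>.  Nothing else of the Hopf structure enters the action on a
  dual module.
\<close>

fun antipode_gen :: "generator \<Rightarrow> 'k::field free_alg" where
  "antipode_gen U = - gen U"
| "antipode_gen V = - gen V - scalar (1 / 2) * gen Xi * gen U"
| "antipode_gen Xi = - gen Xi"
| "antipode_gen G = gen Ginv"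
| "antipode_gen Ginv = gen G"
| "antipode_gen X = - gen Ginv * gen X"
| "antipode_gen Y = - gen Ginv * gen Y"

definition antipode_free :: "'k::field free_alg \<Rightarrow> 'k free_alg" where
  "antipode_free p =
     (\<Sum>w\<in>Poly_Mapping.keys p. scalar (Poly_Mapping.lookup p w) * prod_list (map antipode_gen (rev (letters w))))"

definition antipode :: "'k::field jordan_double \<Rightarrow> 'k jordan_double" where
  "antipode d = (\<Union>p\<in>d. residue_class (antipode_free p))"

text \<open>The dual module: linear functionals on the carrier (\<^const>\<open>undefined\<close> off the carrier).\<close>

definition dual_module ::
    "('k::field jordan_double, 'm) module \<Rightarrow> ('k jordan_double, 'm \<Rightarrow> 'k) module" where
  "dual_module M =
     \<lparr>carrier = {f \<in> extensional (carrier M).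
         (\<forall>a\<in>carrier M. \<forall>b\<in>carrier M. f (a \<oplus>\<^bsub>M\<^esub> b) = f a + f b) \<and>
         (\<forall>c. \<forall>a\<in>carrier M. f (kscale M c a) = c * f a)},
      mult = undefined, one = undefined,
      zero = (\<lambda>m\<in>carrier M. 0),
      add = (\<lambda>f h. \<lambda>m\<in>carrier M. f m + h m),
      smult = (\<lambda>d f. \<lambda>m\<in>carrier M. f (antipode d \<odot>\<^bsub>M\<^esub> m))\<rparr>"


section \<open>The modules \<open>L(n)\<close> and \<open>T(k, 1)\<close>\<close>

text \<open>The vector \<open>\<Sum>i\<le>n. c\<^sub>i z\<^sub>n\<^sub>,\<^sub>i\<close> of \<open>L(n)\<close> is represented by its coordinate function \<open>i \<mapsto> c\<^sub>i\<close>,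
  which vanishes beyond \<open>n\<close>.\<close>

definition basis_vec :: "nat \<Rightarrow> nat \<Rightarrow> nat \<Rightarrow> 'k::field" where
  "basis_vec n i = (\<lambda>j. if i \<le> n \<and> j = i then 1 else 0)"

fun L_gen_basis :: "nat \<Rightarrow> generator \<Rightarrow> nat \<Rightarrow> nat \<Rightarrow> 'k::field" where
  "L_gen_basis n Xi i = (\<lambda>j. (of_nat n - 2 * of_nat i) * basis_vec n i j)"
| "L_gen_basis n V i = (\<lambda>j. of_nat (i * (n - i + 1)) / 2 * basis_vec n (i - 1) j)"
| "L_gen_basis n Y i = basis_vec n (i + 1)"
| "L_gen_basis n X i = (\<lambda>j. 0)"
| "L_gen_basis n U i = (\<lambda>j. 0)"
| "L_gen_basis n G i = basis_vec n i"
| "L_gen_basis n Ginv i = basis_vec n i"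

definition L_gen :: "nat \<Rightarrow> generator \<Rightarrow> (nat \<Rightarrow> 'k::field) \<Rightarrow> nat \<Rightarrow> 'k" where
  "L_gen n a f = (\<lambda>j. \<Sum>i\<le>n. f i * L_gen_basis n a i j)"

definition L_free :: "nat \<Rightarrow> 'k::field free_alg \<Rightarrow> (nat \<Rightarrow> 'k) \<Rightarrow> nat \<Rightarrow> 'k" where
  "L_free n p f = (\<lambda>j. \<Sum>w\<in>Poly_Mapping.keys p. Poly_Mapping.lookup p w * foldr (L_gen n) (letters w) f j)"

text \<open>A residue class acts through any of its representatives: see lemma
  \<open>L_smult_residue_class\<close> below.\<close>

definition L :: "nat \<Rightarrow> ('k::field jordan_double, nat \<Rightarrow> 'k) module" where
  "L n =
     \<lparr>carrier = {f. \<forall>i>n. f i = 0}, mult = undefined, one = undefined,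
      zero = (\<lambda>i. 0), add = (\<lambda>f h i. f i + h i),
      smult = (\<lambda>d. L_free n (SOME p. p \<in> d))\<rparr>"

lemma free_alg_induct [case_names single sum]:
  fixes p :: "'k::field free_alg"
  assumes single: "\<And>w c. P (Poly_Mapping.single w c)"
    and sum: "\<And>p q. P p \<Longrightarrow> P q \<Longrightarrow> P (p + q)"
  shows "P p"
proof (induction p rule: update_induct)
  case const
  show ?case using single[of 0 0] by simp
next
  case (update p w c)
  have "Poly_Mapping.update w c p = p + Poly_Mapping.single w c"
    using update by (intro poly_mapping_eqI)
      (auto simp: lookup_update lookup_add lookup_single in_keys_iff when_def)
  then show ?case using update single sum by simp
qed

lemma L_free_add: "L_free n (p + q) f = (\<lambda>j. L_free n p f j + L_free n q f j)"
proof
  fix j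
  let ?K = "Poly_Mapping.keys p \<union> Poly_Mapping.keys q"
  let ?w = "\<lambda>r w. Poly_Mapping.lookup r w * foldr (L_gen n) (letters w) f j"
  have *: "L_free n r f j = (\<Sum>w\<in>?K. ?w r w)" if "Poly_Mapping.keys r \<subseteq> ?K" for r
    unfolding L_free_def using that
    by (intro sum.mono_neutral_left) (auto simp: in_keys_iff)
  show "L_free n (p + q) f j = L_free n p f j + L_free n q f j"
    by (subst (1 2 3) *)
       (use Poly_Mapping.keys_add[of p q] in \<open>auto simp: lookup_add distrib_right sum.distrib\<close>)
qed

lemma L_free_single:
  "L_free n (Poly_Mapping.single w c) f = (\<lambda>j. c * foldr (L_gen n) (letters w) f j)"
  by (cases "c = 0") (auto simp: L_free_def)

lemma L_gen_linear:
  "L_gen n a (\<lambda>j. f j + h j) = (\<lambda>j. L_gen n a f j + L_gen n a h j)"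
  "L_gen n a (\<lambda>j. c * f j) = (\<lambda>j. c * L_gen n a f j)"
  by (auto simp: L_gen_def distrib_right sum.distrib sum_distrib_left mult.assoc)

lemma L_word_linear:
  "foldr (L_gen n) w (\<lambda>j. f j + h j) = (\<lambda>j. foldr (L_gen n) w f j + foldr (L_gen n) w h j)"
  "foldr (L_gen n) w (\<lambda>j. c * f j) = (\<lambda>j. c * foldr (L_gen n) w f j)"
  by (induction w) (simp_all add: L_gen_linear)

lemma L_free_linear:
  "L_free n p (\<lambda>j. f j + h j) = (\<lambda>j. L_free n p f j + L_free n p h j)"
  "L_free n p (\<lambda>j. c * f j) = (\<lambda>j. c * L_free n p f j)"
  by (auto simp: L_free_def L_word_linear distrib_left sum.distrib sum_distrib_left ac_simps)

lemma L_free_zero: "L_free n 0 f = (\<lambda>j. 0)" "L_free n p (\<lambda>j. 0) = (\<lambda>j. 0)"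
  using L_free_linear(2)[of n p 0 "\<lambda>j. 0"] by (auto simp: L_free_def)

lemma L_free_mult: "L_free n (p * q) f = L_free n p (L_free n q f)"
proof (induction p rule: free_alg_induct)
  case (single v c)
  show ?case
  proof (induction q rule: free_alg_induct)
    case (single w d)
    then show ?case
      by (simp add: mult_single L_free_single plus_free_monoid_def L_word_linear mult.assoc)
  next
    case (sum q1 q2)
    then show ?case by (simp add: distrib_left L_free_add L_free_linear)
  qed
next
  case (sum p1 p2)
  then show ?case by (simp add: distrib_right L_free_add)
qed

lemma L_free_uminus: "L_free n (- p) f = (\<lambda>j. - L_free n p f j)"
  using L_free_add[of n p "- p" f] by (simp add: L_free_zero fun_eq_iff eq_neg_iff_add_eq_0 add.commute)

lemma L_free_diff: "L_free n (p - q) f = (\<lambda>j. L_free n p f j - L_free n q f j)"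
  using L_free_add[of n p "- q" f] by (simp add: L_free_uminus)

lemma L_free_gen: "L_free n (gen a) f = L_gen n a f"
  by (simp add: gen_def L_free_single)

lemma L_free_scalar: "L_free n (scalar c) f = (\<lambda>j. c * f j)"
  by (simp add: scalar_def L_free_single zero_free_monoid_def)

lemma L_free_one: "L_free n 1 f = f"
  using L_free_scalar[of n 1 f] by (simp add: scalar_def)

lemma L_free_two: "L_free n 2 f = (\<lambda>j. 2 * f j)"
  using L_free_add[of n 1 1 f] by (simp add: L_free_one)

lemma L_gen_eq:
  assumes f: "\<forall>i>n. f i = (0::'k::field)"
  shows "L_gen n Xi f = (\<lambda>j. (of_nat n - 2 * of_nat j) * f j)"
    "L_gen n V f = (\<lambda>j. if j < n then of_nat ((j + 1) * (n - j)) / 2 * f (j + 1) else 0)"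
    "L_gen n Y f = (\<lambda>j. if 1 \<le> j \<and> j \<le> n then f (j - 1) else 0)"
    "L_gen n X f = (\<lambda>j. 0)" "L_gen n U f = (\<lambda>j. 0)" "L_gen n G f = f" "L_gen n Ginv f = f"
proof -
  show "L_gen n Xi f = (\<lambda>j. (of_nat n - 2 * of_nat j) * f j)"
  proof
    fix j
    show "L_gen n Xi f j = (of_nat n - 2 * of_nat j) * f j"
    proof (cases "j \<le> n")
      case True
      have "L_gen n Xi f j = (\<Sum>i\<le>n. if i = j then (of_nat n - 2 * of_nat j) * f j else 0)"
        unfolding L_gen_def by (intro sum.cong) (auto simp: basis_vec_def)
      then show ?thesis using True by simp
    qed (use f in \<open>auto simp: L_gen_def basis_vec_def intro!: sum.neutral\<close>)
  qed
  show "L_gen n V f = (\<lambda>j. if j < n then of_nat ((j + 1) * (n - j)) / 2 * f (j + 1) else 0)"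
  proof
    fix j
    have "L_gen n V f j = (\<Sum>i\<le>n. if i = j + 1 then of_nat ((j + 1) * (n - j)) / 2 * f (j + 1) else 0)"
      unfolding L_gen_def
    proof (intro sum.cong refl)
      fix i assume "i \<in> {..n}"
      then show "f i * L_gen_basis n V i j =
          (if i = j + 1 then of_nat ((j + 1) * (n - j)) / 2 * f (j + 1) else 0)"
        by (cases i) (auto simp: basis_vec_def Suc_diff_Suc simp del: of_nat_mult of_nat_add of_nat_Suc)
    qed
    then show "L_gen n V f j = (if j < n then of_nat ((j + 1) * (n - j)) / 2 * f (j + 1) else 0)"
      by auto
  qed
  show "L_gen n Y f = (\<lambda>j. if 1 \<le> j \<and> j \<le> n then f (j - 1) else 0)"
  proof
    fix j
    have "L_gen n Y f j = (\<Sum>i\<le>n. if i = j - 1 then (if 1 \<le> j \<and> j \<le> n then f (j - 1) else 0) else 0)"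
      unfolding L_gen_def by (intro sum.cong) (auto simp: basis_vec_def)
    then show "L_gen n Y f j = (if 1 \<le> j \<and> j \<le> n then f (j - 1) else 0)"
      by auto
  qed
  have *: "(\<lambda>j. \<Sum>i\<le>n. f i * basis_vec n i j) = f"
  proof
    fix j
    have "(\<Sum>i\<le>n. f i * basis_vec n i j) = (\<Sum>i\<le>n. if i = j then f j else 0)"
      by (intro sum.cong) (auto simp: basis_vec_def)
    then show "(\<Sum>i\<le>n. f i * basis_vec n i j) = f j" using f by auto
  qed
  show "L_gen n G f = f" "L_gen n Ginv f = f" using * by (simp_all add: L_gen_def)
qed (simp_all add: L_gen_def)

lemma L_gen_closed: "j > n \<Longrightarrow> L_gen n a f j = 0"
  by (cases a) (auto simp: L_gen_def basis_vec_def intro!: sum.neutral)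

lemma L_free_closed:
  assumes "\<forall>i>n. f i = 0" "j > n"
  shows "L_free n p f j = 0"
proof -
  have "foldr (L_gen n) w f j = 0" for w
    using assms by (cases w) (auto simp: L_gen_closed)
  then show ?thesis by (simp add: L_free_def)
qed

lemma L_free_relation:
  fixes f :: "nat \<Rightarrow> 'k::field_char_0"
  assumes lr: "(l, r) \<in> jordan_relations" and f: "\<forall>i>n. f i = 0"
  shows "L_free n l f = L_free n r f"
proof -
  note simps = L_free_add L_free_diff L_free_mult L_free_gen L_free_scalar L_free_one L_free_two
    power2_eq_square
  have f': "f i = 0" if "i > n" for i using f that by simp
  show ?thesis
    using lr
    by (auto simp: jordan_relations_def Let_def simps L_gen_eq f' fun_eq_iff)
     (simp_all add: algebra_simps not_less_eq_eq)
qed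

lemma L_free_jordan_ideal:
  fixes f :: "nat \<Rightarrow> 'k::field_char_0"
  assumes p: "p \<in> jordan_ideal" and f: "\<forall>i>n. f i = 0"
  shows "L_free n p f = (\<lambda>j. 0)"
proof -
  define K :: "'k free_alg set" where
    "K = {p. \<forall>f. (\<forall>i>n. f i = 0) \<longrightarrow> L_free n p f = (\<lambda>j. 0)}"
  have "ideal K class_ring"
  proof (rule idealI)
    show "subgroup K (add_monoid class_ring)"
    proof (rule group.subgroupI)
      show grp: "Group.group (add_monoid (class_ring :: 'k free_alg ring))"
        by (rule abelian_group.a_group) (rule class_ring.abelian_group_axioms)
      have "0 \<in> K" by (simp add: K_def L_free_zero)
      then show "K \<noteq> {}" by auto
      fix q assume "q \<in> K"
      moreover have "inv\<^bsub>add_monoid class_ring\<^esub> q = - q"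
        by (rule group.inv_equality[OF grp]) auto
      ultimately show "inv\<^bsub>add_monoid class_ring\<^esub> q \<in> K"
        by (simp only:) (simp add: K_def L_free_uminus)
    qed (auto simp: K_def L_free_add)
  qed (auto simp: K_def L_free_mult L_free_zero L_free_closed intro: class_ring.ring_axioms)
  moreover have "{l - r | l r. (l, r) \<in> jordan_relations} \<subseteq> K"
  proof
    fix q :: "'k free_alg" assume "q \<in> {l - r | l r. (l, r) \<in> jordan_relations}"
    then obtain l r where "q = l - r" "(l, r) \<in> jordan_relations" by blast
    then show "q \<in> K" by (simp add: K_def L_free_diff L_free_relation)
  qed
  ultimately have "jordan_ideal \<subseteq> K"
    unfolding jordan_ideal_def by (intro ring.genideal_minimal class_ring.ring_axioms)
  then show ?thesis using p f by (auto simp: K_def)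
qed

lemma ideal_jordan_ideal: "ideal (jordan_ideal :: 'k::field free_alg set) class_ring"
  unfolding jordan_ideal_def by (intro ring.genideal_ideal class_ring.ring_axioms) auto

lemma L_smult_residue_class:
  fixes p :: "'k::field_char_0 free_alg"
  assumes f: "f \<in> carrier (L n)"
  shows "residue_class p \<odot>\<^bsub>L n\<^esub> f = L_free n p f"
proof -
  interpret ideal "jordan_ideal :: 'k free_alg set" class_ring by (rule ideal_jordan_ideal)
  let ?q = "SOME q. q \<in> residue_class p"
  have "p \<in> residue_class p"
    unfolding residue_class_def by (intro a_rcos_self) auto
  then have "?q \<in> residue_class p" by (rule someI)
  then obtain h where "h \<in> jordan_ideal" "?q = h + p"
    unfolding residue_class_def a_r_coset_def r_coset_def by auto
  then show ?thesis
    using f by (simp add: L_def L_free_add L_free_jordan_ideal)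
qed

lemma left_module_L: "left_module jordan_double (L n :: ('k::field_char_0 jordan_double, _) module)"
proof -
  interpret ideal "jordan_ideal :: 'k free_alg set" class_ring by (rule ideal_jordan_ideal)
  have rc: "\<exists>p. d = residue_class p" if "d \<in> carrier jordan_double" for d :: "'k jordan_double"
    using that
    by (auto simp: jordan_double_def FactRing_def A_RCOSETS_def RCOSETS_def residue_class_def
        a_r_coset_def)
  have add: "residue_class p \<oplus>\<^bsub>jordan_double\<^esub> residue_class q = residue_class (p + q)"
    for p q :: "'k free_alg"
    using a_rcos_sum[of p q] by (simp add: jordan_double_def FactRing_def residue_class_def)
  have mult: "residue_class p \<otimes>\<^bsub>jordan_double\<^esub> residue_class q = residue_class (p * q)"
    for p q :: "'k free_alg"
    using rcoset_mult_add[of p q] by (simp add: jordan_double_def FactRing_def residue_class_def)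
  have one: "\<one>\<^bsub>jordan_double\<^esub> = residue_class (1 :: 'k free_alg)"
    by (simp add: jordan_double_def FactRing_def residue_class_def)
  have cl: "L_free n p f \<in> carrier (L n)" "(\<lambda>i. f i + h i) \<in> carrier (L n)"
    if "f \<in> carrier (L n)" "h \<in> carrier (L n)" for p :: "'k free_alg" and f h
    using that by (auto simp: L_def L_free_closed)
  have ad: "f \<oplus>\<^bsub>L n\<^esub> h = (\<lambda>i. f i + h i)" for f h :: "nat \<Rightarrow> 'k"
    by (simp add: L_def)
  have "abelian_group (L n :: ('k jordan_double, _) module)"
  proof (rule abelian_groupI)
    fix f :: "nat \<Rightarrow> 'k" assume "f \<in> carrier (L n)"
    then show "\<exists>h\<in>carrier (L n). h \<oplus>\<^bsub>L n\<^esub> f = \<zero>\<^bsub>L n\<^esub>"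
      by (intro bexI[of _ "\<lambda>i. - f i"]) (auto simp: L_def)
  qed (auto simp: L_def add_ac)
  then show ?thesis
    by (intro left_module.intro left_module_axioms.intro ring_jordan_double)
       (auto dest!: rc simp: add mult one L_smult_residue_class cl L_free_add L_free_mult
          L_free_linear L_free_one ad)
qed

text \<open>A module presented by one generator is the regular module modulo the left ideal generated
  by the coefficients of the defining relations.\<close>

definition T_relations :: "nat \<Rightarrow> 'k::field free_alg set" where
  "T_relations k =
     {gen G - 1, gen Xi - of_nat (k + 2), gen U, gen V,
      gen X ^ 2, gen Y ^ (k + 3), gen Y ^ (k + 1) * gen X}"

definition T1 :: "nat \<Rightarrow> ('k::field jordan_double, 'k jordan_double set) module" where
  "T1 k = quotient_module (regular_module jordan_double)
     (generated_submodule jordan_double (regular_module jordan_double)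
       (residue_class ` T_relations k))"


section \<open>The space of extension classes\<close>

text \<open>Addition is induced by the Baer sum, and \<open>c\<close> acts by pushout along \<open>c \<cdot> id\<^sub>A\<close>.\<close>

definition Ext1 ::
    "('k::field jordan_double, 'a) module \<Rightarrow> ('k jordan_double, 'b) module \<Rightarrow>
      ('k, ('k jordan_double, 'a, 'b, 'a \<times> 'b) extension set) module" where
  "Ext1 A B =
     \<lparr>carrier = {extension_class jordan_double A B E |
          E :: ('k jordan_double, 'a, 'b, 'a \<times> 'b) extension. is_extension jordan_double A B E},
      mult = undefined, one = undefined,
      zero = extension_class jordan_double A B (split_extension A B),
      add = (\<lambda>P Q. \<Union>E\<in>P. \<Union>F\<in>Q. extension_class jordan_double A B (baer_sum A E F)),
      smult = (\<lambda>c P. \<Union>E\<in>P. extension_class jordan_double A B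
                       (pushout_extension A (kscale A c) E))\<rparr>"

end

theory Submission
  imports Defs
begin

text \<open>
  Let \<open>n = m + 2\<close>.  On \<open>L(n)\<close> and \<open>L(m)\<close> the elements \<open>x\<close> and \<open>u\<close> act as zero and \<open>g\<close> as the identity.  Hence in an
  extension \<open>S\<close> of \<open>L(n)\<close> by \<open>L(m)\<close> the element \<open>x\<close> annihilates the submodule \<open>L(n)\<close> and maps \<open>S\<close> into it.  For weight
  reasons it sends every lift of \<open>z\<^sub>m\<^sub>,\<^sub>0\<close> to the same multiple \<open>\<kappa> z\<^sub>n\<^sub>,\<^sub>2\<close>.  The scalar \<open>\<kappa>\<close> (\<open>x_coefficient\<close>) is a complete
  invariant of the extension.

  The reason is that the double contains a copy of \<open>sl\<^sub>2\<close>, spanned by \<open>e = v + \<xi> u / 2\<close>, \<open>\<xi>\<close> and \<open>y\<close>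
  (\<open>sl2_relations\<close>).  As a representation of it, \<open>S\<close> splits: there is a lift \<open>w\<close> of \<open>z\<^sub>m\<^sub>,\<^sub>0\<close> of weight \<open>m\<close> that
  \<open>e\<close> kills (\<open>weight_lift\<close>), and then \<open>y\<^sup>m\<^sup>+\<^sup>1 w = 0\<close> (\<open>b_top\<close>).  The remaining relations express the action of \<open>x\<close>, \<open>g\<close>, \<open>u\<close> and
  \<open>v\<close> on the vectors \<open>y\<^sup>j w\<close> through \<open>\<kappa>\<close> (\<open>X_b\<close>, \<open>G_b\<close>, \<open>U_b\<close>, \<open>V_b\<close>).  So \<open>S\<close> is equivalent to one explicit extension
  \<open>model_extension m \<kappa>\<close> (\<open>extension_equivalent_model\<close>).

  The invariant is 0 for the split extension, adds up under Baer sums, is multiplied by \<open>c\<close> under the pushout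
  along \<open>c\<close>, and takes every value.  It thus identifies the space of extension classes with the field, and
  an extension with \<open>\<kappa> = 0\<close> splits.

  It remains to recognise the model with \<open>\<kappa> \<noteq> 0\<close> as the dual of \<open>T(m, 1)\<close>.  Let \<open>z\<close> be the generator of \<open>T(m, 1)\<close>, \<open>\<sigma>\<close> the antipode and \<open>\<phi>\<close>
  the functional that reads off the coefficient of \<open>z\<^sub>n\<^sub>,\<^sub>n\<close> in the model.  As \<open>\<phi>\<close> annihilates the antipodes of the relations of
  \<open>T(m, 1)\<close>, a vector \<open>s\<close> defines the functional \<open>d z \<mapsto> \<phi> (\<sigma>(d) g\<^sup>-\<^sup>1 s)\<close>, and this assignment is linear over the double because
  \<open>\<sigma>\<^sup>2\<close> is conjugation by \<open>g\<^sup>-\<^sup>1\<close> (\<open>antipode_square\<close>).  The vectors \<open>\<sigma>(y\<^sup>i) z\<close> and \<open>\<sigma>(x y\<^sup>i) z\<close> span \<open>T(m, 1)\<close>; the values of the functional on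
  them are the coordinates of \<open>s\<close>, up to the factor \<open>\<kappa>\<close> in the second case.  Therefore the map is bijective.
\<close>

section \<open>The double as a ring type\<close>

lemma jordan_ideal_closed:
  fixes p q r :: "'k::field free_alg"
  shows "0 \<in> (jordan_ideal :: 'k free_alg set)"
    "p \<in> jordan_ideal \<Longrightarrow> q \<in> jordan_ideal \<Longrightarrow> p + q \<in> jordan_ideal"
    "p \<in> jordan_ideal \<Longrightarrow> - p \<in> jordan_ideal"
    "p \<in> jordan_ideal \<Longrightarrow> r * p \<in> jordan_ideal"
    "p \<in> jordan_ideal \<Longrightarrow> p * r \<in> jordan_ideal"
proof -
  interpret ideal "jordan_ideal :: 'k free_alg set" class_ring by (rule ideal_jordan_ideal)
  show "0 \<in> (jordan_ideal :: 'k free_alg set)" using additive_subgroup.zero_closed[OF is_additive_subgroup] by simp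
  show "p \<in> jordan_ideal \<Longrightarrow> q \<in> jordan_ideal \<Longrightarrow> p + q \<in> jordan_ideal" using a_closed by simp
  show 4: "p \<in> jordan_ideal \<Longrightarrow> r * p \<in> jordan_ideal" for r using I_l_closed by simp
  show "p \<in> jordan_ideal \<Longrightarrow> p * r \<in> jordan_ideal" using I_r_closed by simp
  show "p \<in> jordan_ideal \<Longrightarrow> - p \<in> jordan_ideal" using 4[of "- 1"] by simp
qed

lemma jordan_ideal_diff:
  fixes p q :: "'k::field free_alg"
  shows "p \<in> jordan_ideal \<Longrightarrow> q \<in> jordan_ideal \<Longrightarrow> p - q \<in> jordan_ideal"
  using jordan_ideal_closed(2)[of p "- q"] jordan_ideal_closed(3)[of q] by simp

lemma jordan_relation_in_ideal:
  "(l, r) \<in> jordan_relations \<Longrightarrow> l - r \<in> (jordan_ideal :: 'k::field free_alg set)"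
  unfolding jordan_ideal_def
  by (rule subsetD[OF ring.genideal_self[OF class_ring.ring_axioms]]) auto

lemma residue_class_eq_iff:
  fixes p q :: "'k::field free_alg"
  shows "residue_class p = residue_class q \<longleftrightarrow> p - q \<in> jordan_ideal"
proof -
  interpret ideal "jordan_ideal :: 'k free_alg set" class_ring by (rule ideal_jordan_ideal)
  have mem: "r \<in> residue_class q \<longleftrightarrow> r - q \<in> jordan_ideal" for r q :: "'k free_alg"
    by (auto simp: residue_class_def a_r_coset_def r_coset_def intro: bexI[of _ "r - q"])
  show ?thesis
  proof
    assume "residue_class p = residue_class q"
    then show "p - q \<in> jordan_ideal" using mem[of p p] mem[of p q] jordan_ideal_closed(1) by simp
  next
    assume *: "p - q \<in> jordan_ideal"
    have "r - p \<in> jordan_ideal \<longleftrightarrow> r - q \<in> jordan_ideal" for r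
      using jordan_ideal_closed(2)[OF _ *, of "r - p"] jordan_ideal_diff[OF _ *, of "r - q"] by auto
    then show "residue_class p = residue_class q" using mem by blast
  qed
qed

text \<open>
  The double once more, now as a type. Identities between noncommutative polynomials modulo the
  relations become ring identities, which rewriting decides; \<open>cls_eq_iff\<close> carries
  them over to residue classes.
\<close>

quotient_type (overloaded) 'k double_alg = "'k::field_char_0 free_alg" / "\<lambda>p q. p - q \<in> jordan_ideal"
  morphisms rep_double cls
proof (rule equivpI)
  show "reflp (\<lambda>p q::'k free_alg. p - q \<in> jordan_ideal)"
    by (simp add: reflp_def jordan_ideal_closed)
  show "symp (\<lambda>p q::'k free_alg. p - q \<in> jordan_ideal)"
    using jordan_ideal_closed(3) by (fastforce simp: symp_def)
  show "transp (\<lambda>p q::'k free_alg. p - q \<in> jordan_ideal)"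
  proof (rule transpI)
    fix p q r :: "'k free_alg"
    assume "p - q \<in> jordan_ideal" "q - r \<in> jordan_ideal"
    from jordan_ideal_closed(2)[OF this] show "p - r \<in> jordan_ideal" by simp
  qed
qed

lemma diff_diff_diff: "(a - b) - (c - d) = (a - c) - (b - d)" for a :: "'a::ab_group_add"
  by simp

lemma cls_surj: obtains p where "d = cls p"
  by (induct d rule: double_alg.abs_induct) blast

instantiation double_alg :: (field_char_0) ring_1
begin
lift_definition zero_double_alg :: "'a double_alg" is 0 .
lift_definition one_double_alg :: "'a double_alg" is 1 .
lift_definition plus_double_alg :: "'a double_alg \<Rightarrow> 'a double_alg \<Rightarrow> 'a double_alg" is "(+)"
  by (simp only: add_diff_add jordan_ideal_closed)
lift_definition minus_double_alg :: "'a double_alg \<Rightarrow> 'a double_alg \<Rightarrow> 'a double_alg" is "(-)"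
  by (simp only: diff_diff_diff jordan_ideal_diff)
lift_definition uminus_double_alg :: "'a double_alg \<Rightarrow> 'a double_alg" is uminus
  by (drule jordan_ideal_closed(3)) (simp only: minus_diff_eq minus_diff_minus)
lift_definition times_double_alg :: "'a double_alg \<Rightarrow> 'a double_alg \<Rightarrow> 'a double_alg" is "(*)"
proof -
  fix p p' q q' :: "'a free_alg"
  assume "p - p' \<in> jordan_ideal" "q - q' \<in> jordan_ideal"
  then have "(p - p') * q + p' * (q - q') \<in> jordan_ideal"
    by (intro jordan_ideal_closed)
  then show "p * q - p' * q' \<in> jordan_ideal" by (simp add: algebra_simps)
qed
instance
proof
  have "1 \<notin> (jordan_ideal :: 'a free_alg set)"
  proof
    assume "1 \<in> (jordan_ideal :: 'a free_alg set)"
    then have "L_free 0 1 (\<lambda>j. if j = 0 then 1 else 0 :: 'a) = (\<lambda>j. 0)"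
      by (rule L_free_jordan_ideal) simp
    from fun_cong[OF this, of 0] show False by (simp add: L_free_one)
  qed
  then show "(0 :: 'a double_alg) \<noteq> 1"
    using jordan_ideal_closed(3)[of "- 1 :: 'a free_alg"]
    by (auto simp: zero_double_alg_def one_double_alg_def double_alg.abs_eq_iff)
next
  fix a b c :: "'a double_alg"
  obtain p where a: "a = cls p" by (rule cls_surj)
  obtain q where b: "b = cls q" by (rule cls_surj)
  obtain r where c: "c = cls r" by (rule cls_surj)
  from a b c show "a * b * c = a * (b * c)" "1 * a = a" "a * 1 = a" "a + b + c = a + (b + c)"
    "a + b = b + a" "0 + a = a" "- a + a = 0" "a - b = a + - b" "(a + b) * c = a * c + b * c"
    "a * (b + c) = a * b + a * c"
    by (simp_all only: zero_double_alg_def one_double_alg_def plus_double_alg.abs_eq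
        minus_double_alg.abs_eq uminus_double_alg.abs_eq times_double_alg.abs_eq
        mult.assoc mult_1_left mult_1_right add.assoc add.commute[of q p] add_0 left_minus
        add_uminus_conv_diff distrib_left distrib_right)
qed
end

lemma cls_hom:
  "cls (p + q) = cls p + cls q" "cls (p - q) = cls p - cls q" "cls (- p) = - cls p"
  "cls (p * q) = cls p * cls q" "cls 0 = 0" "cls 1 = 1"
  by (simp_all only: plus_double_alg.abs_eq minus_double_alg.abs_eq uminus_double_alg.abs_eq
      times_double_alg.abs_eq zero_double_alg_def one_double_alg_def)

lemma cls_two: "cls 2 = 2"
  using cls_hom(1)[of 1 1] by (simp add: cls_hom(6))

lemma cls_eq_iff: "cls p = cls q \<longleftrightarrow> residue_class p = residue_class q"
  by (simp add: residue_class_eq_iff double_alg.abs_eq_iff)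

lemma cls_relation: "(l, r) \<in> jordan_relations \<Longrightarrow> cls l = cls r"
  by (simp add: cls_eq_iff residue_class_eq_iff jordan_relation_in_ideal)

lemma scalar_hom:
  "scalar (c + d) = scalar c + scalar d" "scalar (c * d) = scalar c * scalar d"
  "scalar (- c) = - scalar c"  "scalar (c - d) = scalar c - scalar d" "scalar 0 = 0" "scalar 1 = 1"
  by (simp_all add: scalar_def single_add mult_single single_uminus single_diff)

lemma scalar_central: "scalar c * p = p * (scalar c :: 'k::field free_alg)"
proof (induction p rule: free_alg_induct)
  case (single w d)
  show ?case by (simp add: scalar_def mult_single mult.commute)
qed (simp add: algebra_simps)

lemma single_word:
  "Poly_Mapping.single w (c::'k::field) = scalar c * prod_list (map gen (letters w))"
proof -
  have "prod_list (map gen ws) = Poly_Mapping.single (Word ws) (1::'k)" for ws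
    by (induction ws)
      (simp_all add: gen_def mult_single plus_free_monoid_def flip: zero_free_monoid_def)
  then show ?thesis by (simp add: scalar_def mult_single)
qed

section \<open>Commutation rules and the antipode\<close>

lemma antipode_free_add: "antipode_free (p + q) = antipode_free p + antipode_free q"
proof -
  let ?K = "Poly_Mapping.keys p \<union> Poly_Mapping.keys q"
  let ?w = "\<lambda>r w. scalar (Poly_Mapping.lookup r w) * prod_list (map antipode_gen (rev (letters w)))"
  have *: "antipode_free r = (\<Sum>w\<in>?K. ?w r w)" if "Poly_Mapping.keys r \<subseteq> ?K" for r
    unfolding antipode_free_def using that
    by (intro sum.mono_neutral_left) (auto simp: in_keys_iff scalar_hom)
  show ?thesis
    by (subst (1 2 3) *)
       (use Poly_Mapping.keys_add[of p q] in \<open>auto simp: lookup_add scalar_hom distrib_right sum.distrib\<close>)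
qed

lemma antipode_free_single:
  "antipode_free (Poly_Mapping.single w c) =
    scalar c * prod_list (map antipode_gen (rev (letters w)))"
  by (cases "c = 0") (auto simp: antipode_free_def scalar_hom)

lemma antipode_free_mult:
  fixes p q :: "'k::field free_alg"
  shows "antipode_free (p * q) = antipode_free q * antipode_free p"
proof (induction p rule: free_alg_induct)
  case (single v c)
  show ?case
  proof (induction q rule: free_alg_induct)
    case (single w d)
    show ?case
      by (simp add: mult_single antipode_free_single plus_free_monoid_def scalar_hom mult.assoc
          scalar_central[of c])
  next
    case (sum q1 q2)
    then show ?case by (simp add: distrib_left distrib_right antipode_free_add)
  qed
next
  case (sum p1 p2)
  then show ?case by (simp add: distrib_left distrib_right antipode_free_add)
qed

lemma antipode_free_gen: "antipode_free (gen a) = antipode_gen a"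
  by (simp add: gen_def antipode_free_single scalar_hom)

lemma antipode_free_scalar: "antipode_free (scalar c) = scalar c"
  by (simp add: scalar_def antipode_free_single zero_free_monoid_def)

lemma antipode_free_one: "antipode_free 1 = 1"
  using antipode_free_scalar[of 1] by (simp add: scalar_hom)

lemma antipode_free_uminus: "antipode_free (- p) = - antipode_free p"
proof -
  have "antipode_free (scalar (- 1) * p) = - antipode_free p"
    by (simp only: antipode_free_mult antipode_free_scalar) (simp add: scalar_hom)
  then show ?thesis by (simp add: scalar_hom)
qed

lemma antipode_free_diff: "antipode_free (p - q) = antipode_free p - antipode_free q"
  using antipode_free_add[of p "- q"] by (simp add: antipode_free_uminus)

lemma antipode_free_two: "antipode_free 2 = 2"
  using antipode_free_add[of 1 1] by (simp add: antipode_free_one)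

context
  fixes u v \<xi> g g' x y half :: "'k::field_char_0 double_alg"
  defines "u \<equiv> cls (gen U)" and "v \<equiv> cls (gen V)" and "\<xi> \<equiv> cls (gen Xi)" and "g \<equiv> cls (gen G)"
    and "g' \<equiv> cls (gen Ginv)" and "x \<equiv> cls (gen X)" and "y \<equiv> cls (gen Y)"
    and "half \<equiv> cls (scalar (1 / 2))"
begin

lemma defining_relations:
  "g * g' = 1" (is ?r1) "g' * g = 1" (is ?r2) "\<xi> * g = g * \<xi>" (is ?r3) "g * x = x * g" (is ?r4) "g * y = y * g + x * g" (is ?r5)
  "\<xi> * y = y * \<xi> - 2 * y" (is ?r6) "\<xi> * x = x * \<xi> - 2 * x" (is ?r7) "u * g = g * u" (is ?r8) "v * g = g * v + g * u" (is ?r9)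
  "v * \<xi> = \<xi> * v - 2 * v" (is ?r10) "u * \<xi> = \<xi> * u - 2 * u" (is ?r11) "y * x = x * y - half * x ^ 2" (is ?r12)
  "v * u = u * v - half * u ^ 2" (is ?r13) "u * x = x * u" (is ?r14) "v * x = x * v + (1 - g) + x * u" (is ?r15)
  "u * y = y * u + (1 - g)" (is ?r16) "v * y = y * v + half * g * \<xi> + y * u" (is ?r17)
proof -
  have "\<forall>p\<in>jordan_relations. cls (fst p) = cls (snd p :: 'k free_alg)"
    by (auto intro: cls_relation)
  then show ?r1 ?r2 ?r3 ?r4 ?r5 ?r6 ?r7 ?r8 ?r9 ?r10 ?r11 ?r12 ?r13 ?r14 ?r15 ?r16 ?r17
    unfolding jordan_relations_def Let_def ball_simps fst_conv snd_conv cls_hom cls_two power2_eq_square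
      u_def[symmetric] v_def[symmetric] \<xi>_def[symmetric] g_def[symmetric] g'_def[symmetric]
      x_def[symmetric] y_def[symmetric] half_def[symmetric]
    by blast+
qed

lemma half_central: "half * d = d * half"
  by (rule cls_surj[of d]) (simp add: half_def scalar_central flip: cls_hom)

lemma half_plus_half: "half * d + half * d = d"
  by (simp add: half_def flip: distrib_right cls_hom scalar_hom) (simp add: scalar_hom cls_hom)

lemma minus_half_minus_half: "- (half * d) - half * d = - d"
proof -
  have "- (half * d) - half * d = - (half * d + half * d)" by simp
  then show ?thesis by (simp only: half_plus_half)
qed

text \<open>
  Each rule follows from the one for \<open>g\<close> by multiplying with
  \<open>g\<^sup>-\<^sup>1\<close> on both sides.
\<close>

lemma inverse_relations:
  "\<xi> * g' = g' * \<xi>" (is ?r1) "g' * x = x * g'" (is ?r2) "g' * y = y * g' - x * g'" (is ?r3) "u * g' = g' * u" (is ?r4)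
  "v * g' = g' * v - g' * u" (is ?r5)
proof -
  have cancel: "p = q" if "g * p * g = g * q * g" for p q
  proof -
    have "g' * (g * p * g) * g' = g' * (g * q * g) * g'" using that by simp
    then show ?thesis
      by (metis (no_types) defining_relations(1,2) mult.assoc mult_1_left mult_1_right)
  qed
  have [simp]: "g' * (g * p) = p" "g * (g' * p) = p" for p
    by (simp_all add: defining_relations(1,2) flip: mult.assoc)
  note s = mult.assoc distrib_left distrib_right right_diff_distrib left_diff_distrib
    defining_relations(1,2)
  show ?r1
    by (rule cancel) (simp add: s, simp add: defining_relations(3) flip: mult.assoc)
  show gx: ?r2
    by (rule cancel) (simp add: s, simp add: defining_relations(4) flip: mult.assoc)
  show ?r3
    by (rule cancel) (simp add: s, simp add: defining_relations(4,5) s flip: mult.assoc)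
  show ?r4
    by (rule cancel) (simp add: s, simp add: defining_relations(8) flip: mult.assoc)
  show ?r5
    by (rule cancel) (simp add: s, simp add: defining_relations(8,9) flip: mult.assoc)
qed

lemma assoc_rule: "p * q = r \<Longrightarrow> p * (q * t) = r * t" for p q r t :: "'k double_alg"
  by (simp flip: mult.assoc)

lemmas pbw_rules = defining_relations inverse_relations
   half_central[of x, symmetric] half_central[of y, symmetric]
   half_central[of u, symmetric] half_central[of v, symmetric] half_central[of \<xi>, symmetric]
   half_central[of g, symmetric] half_central[of g', symmetric]

text \<open>
  Read from left to right, the relations move every product towards an ordered monomial in
  \<open>x, y, g, \<xi>, u, v\<close>. Products are nested to the right, so each rule is needed a
  second time with a factor behind it.
\<close>

lemmas pbw_simps = pbw_rules pbw_rules[THEN assoc_rule]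
  mult.assoc distrib_left distrib_right right_diff_distrib left_diff_distrib mult_2
  power2_eq_square

text \<open>
  Both sides reduce to the same combination of ordered monomials.
\<close>

lemma antipode_relations:
  fixes S :: "'k free_alg \<Rightarrow> 'k double_alg"
  defines "S \<equiv> \<lambda>p. cls (antipode_free p)"
  assumes "(l, r) \<in> jordan_relations"
  shows "S l = S r"
proof -
  note simps = antipode_free_add antipode_free_diff antipode_free_mult antipode_free_gen
    antipode_free_one antipode_free_two antipode_free_scalar
  have "\<forall>p\<in>jordan_relations. S (fst p) = S (snd p)"
    unfolding jordan_relations_def Let_def ball_simps fst_conv snd_conv power2_eq_square S_def
      simps antipode_gen.simps cls_hom cls_two
      u_def[symmetric] v_def[symmetric] \<xi>_def[symmetric] g_def[symmetric] g'_def[symmetric]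
      x_def[symmetric] y_def[symmetric] half_def[symmetric]
    by (simp add: pbw_simps mult_2_right half_plus_half minus_half_minus_half)
  then show ?thesis using assms by fastforce
qed

text \<open>
  The summand \<open>\<xi> u / 2\<close> cancels the terms with \<open>g\<close> and
  \<open>u\<close> in the commutator of \<open>v\<close> and \<open>y\<close>. Hence
  \<open>e\<close>, \<open>\<xi>\<close> and \<open>y\<close> generate the action of an
  \<open>sl\<^sub>2\<close>, with \<open>2 e\<close> as raising and \<open>y\<close> as lowering
  operator. This is what makes extensions of the \<open>L(n)\<close> tractable.
\<close>

lemma sl2_relations:
  fixes e :: "'k double_alg"
  defines "e \<equiv> v + half * \<xi> * u"
  shows "e * y = y * e + half * \<xi>" "e * \<xi> = \<xi> * e - 2 * e"
  unfolding e_def by (simp_all add: pbw_simps mult_2_right half_plus_half minus_half_minus_half)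

text \<open>
  The square of the antipode is conjugation by \<open>g\<^sup>-\<^sup>1\<close>. In this form,
  without the second factor, it is used for the homomorphism into the dual of \<open>T(m,
  1)\<close>.
\<close>

lemma antipode_square_gen:
  "cls (antipode_free (antipode_free (gen a))) * g' = g' * cls (gen a)"
proof -
  note simps = antipode_free_add antipode_free_diff antipode_free_mult antipode_free_gen
    antipode_free_one antipode_free_two antipode_free_scalar antipode_free_uminus
  show ?thesis
    by (cases a; simp only: simps antipode_gen.simps cls_hom
          u_def[symmetric] v_def[symmetric] \<xi>_def[symmetric] g_def[symmetric] g'_def[symmetric]
          x_def[symmetric] y_def[symmetric] half_def[symmetric])
       (simp_all add: pbw_simps mult_2_right half_plus_half minus_half_minus_half)
qed

end

lemma jordan_ideal_induct [consumes 1, case_names relation zero add lmult rmult]: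
  fixes p :: "'k::field free_alg"
  assumes p: "p \<in> jordan_ideal"
    and relation: "\<And>l r. (l, r) \<in> jordan_relations \<Longrightarrow> P (l - r)"
    and zero: "P 0"
    and add: "\<And>p q. P p \<Longrightarrow> P q \<Longrightarrow> P (p + q)"
    and lmult: "\<And>p q. P p \<Longrightarrow> P (q * p)"
    and rmult: "\<And>p q. P p \<Longrightarrow> P (p * q)"
  shows "P p"
proof -
  have "ideal {p. P p} (class_ring :: 'k free_alg ring)"
  proof (rule idealI)
    show "subgroup {p. P p} (add_monoid (class_ring :: 'k free_alg ring))"
    proof (rule group.subgroupI)
      show grp: "Group.group (add_monoid (class_ring :: 'k free_alg ring))"
        by (rule abelian_group.a_group) (rule class_ring.abelian_group_axioms)
      show "{p. P p} \<noteq> {}" using zero by blast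
      fix q :: "'k free_alg" assume "q \<in> {p. P p}"
      moreover have "inv\<^bsub>add_monoid class_ring\<^esub> q = - q"
        by (rule group.inv_equality[OF grp]) auto
      ultimately show "inv\<^bsub>add_monoid class_ring\<^esub> q \<in> {p. P p}"
        using lmult[of q "- 1"] by simp
    qed (auto simp: add)
  qed (auto simp: lmult rmult intro: class_ring.ring_axioms)
  moreover have "{l - r | l r. (l, r) \<in> jordan_relations} \<subseteq> {p. P p}"
    using relation by blast
  ultimately have "jordan_ideal \<subseteq> {p. P p}"
    unfolding jordan_ideal_def by (intro ring.genideal_minimal class_ring.ring_axioms)
  then show ?thesis using p by blast
qed

lemma cls_eq_0_iff: "cls p = 0 \<longleftrightarrow> p \<in> jordan_ideal"
  by (simp add: zero_double_alg_def double_alg.abs_eq_iff)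

lemma antipode_free_ideal:
  fixes p :: "'k::field_char_0 free_alg"
  assumes "p \<in> jordan_ideal"
  shows "antipode_free p \<in> jordan_ideal"
  using assms
proof (induction p rule: jordan_ideal_induct)
  case (relation l r)
  then show ?case
    using antipode_relations[OF relation] by (simp add: antipode_free_diff cls_hom flip: cls_eq_0_iff)
next
  case zero
  show ?case
    using antipode_free_scalar[of "0 :: 'k"] by (simp add: scalar_hom jordan_ideal_closed)
qed (simp_all add: antipode_free_add antipode_free_mult jordan_ideal_closed)

text \<open>
  The sets united in \<open>antipode\<close> coincide, because the antipode maps the ideal of
  relations into itself.
\<close>

lemma antipode_residue_class:
  fixes p :: "'k::field_char_0 free_alg"
  shows "antipode (residue_class p) = residue_class (antipode_free p)"
proof -
  interpret ideal "jordan_ideal :: 'k free_alg set" class_ring by (rule ideal_jordan_ideal)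
  have "residue_class (antipode_free q) = residue_class (antipode_free p)"
    if q: "q \<in> residue_class p" for q
  proof -
    obtain h where "h \<in> jordan_ideal" "q = h + p"
      using q by (auto simp: residue_class_def a_r_coset_def r_coset_def)
    then show ?thesis
      by (simp add: residue_class_eq_iff antipode_free_add antipode_free_ideal)
  qed
  moreover have "p \<in> residue_class p"
    unfolding residue_class_def by (intro a_rcos_self) auto
  ultimately show ?thesis unfolding antipode_def by blast
qed

lemma antipode_square:
  fixes p :: "'k::field_char_0 free_alg"
  shows "cls (antipode_free (antipode_free p)) * cls (gen Ginv) = cls (gen Ginv) * cls p"
proof (induction p rule: free_alg_induct)
  case (single w c)
  let ?SS = "\<lambda>p :: 'k free_alg. cls (antipode_free (antipode_free p))"
  have word: "?SS (prod_list (map gen ws)) * cls (gen Ginv) = cls (gen Ginv) * cls (prod_list (map gen ws))"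
    for ws
  proof (induction ws)
    case (Cons a ws)
    then show ?case
      by (simp add: antipode_free_mult cls_hom mult.assoc)
        (simp add: antipode_square_gen flip: mult.assoc)
  qed (simp add: antipode_free_one cls_hom)
  have central: "cls (scalar c) * d = d * cls (scalar c)" for d :: "'k double_alg"
    by (rule cls_surj[of d]) (simp add: scalar_central flip: cls_hom)
  have "?SS (Poly_Mapping.single w c) = cls (scalar c) * ?SS (prod_list (map gen (letters w)))"
    by (simp add: single_word antipode_free_mult antipode_free_scalar central cls_hom)
  moreover have "cls (Poly_Mapping.single w c) = cls (scalar c) * cls (prod_list (map gen (letters w)))"
    by (simp add: single_word cls_hom)
  ultimately show ?case
    by (simp add: word mult.assoc) (simp add: central mult.assoc)
next
  case (sum p q)
  then show ?case by (simp add: antipode_free_add cls_hom algebra_simps)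
qed

section \<open>Actions of the free algebra\<close>

text \<open>
  Modules are studied through the action of free polynomials, which form a type. An identity in
  \<open>double_alg\<close> between two polynomials says that they act alike on every module
  (\<open>act_cong\<close>).
\<close>

definition act :: "('k::field jordan_double, 'm) module \<Rightarrow> 'k free_alg \<Rightarrow> 'm \<Rightarrow> 'm" where
  "act M p m = residue_class p \<odot>\<^bsub>M\<^esub> m"

lemma kscale_act: "kscale M c m = act M (scalar c) m"
  by (simp add: kscale_def act_def)

lemma carrier_jordan_doubleE:
  assumes "d \<in> carrier jordan_double"
  obtains p where "d = residue_class p"
  using assms by (auto simp: jordan_double_def FactRing_def A_RCOSETS_def RCOSETS_def
      residue_class_def a_r_coset_def)

lemma residue_class_closed: "residue_class p \<in> carrier jordan_double"
  by (auto simp: jordan_double_def FactRing_def A_RCOSETS_def RCOSETS_def residue_class_def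
      a_r_coset_def)

lemma residue_class_hom:
  fixes p q :: "'k::field free_alg"
  shows "residue_class p \<oplus>\<^bsub>jordan_double\<^esub> residue_class q = residue_class (p + q)" (is ?r1)
    "residue_class p \<otimes>\<^bsub>jordan_double\<^esub> residue_class q = residue_class (p * q)" (is ?r2)
    "\<one>\<^bsub>jordan_double\<^esub> = residue_class (1 :: 'k free_alg)" (is ?r3)
    "\<zero>\<^bsub>jordan_double\<^esub> = residue_class (0 :: 'k free_alg)" (is ?r4)
proof -
  interpret ideal "jordan_ideal :: 'k free_alg set" class_ring by (rule ideal_jordan_ideal)
  show ?r1
    using a_rcos_sum[of p q] by (simp add: jordan_double_def FactRing_def residue_class_def)
  show ?r2
    using rcoset_mult_add[of p q] by (simp add: jordan_double_def FactRing_def residue_class_def)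
  show ?r3
    by (simp add: jordan_double_def FactRing_def residue_class_def)
  show ?r4
    by (auto simp: jordan_double_def FactRing_def residue_class_def a_r_coset_def r_coset_def)
qed

locale double_module =
  fixes M :: "('k::field_char_0 jordan_double, 'm) module" (structure)
  assumes left_module: "left_module jordan_double M"
begin

sublocale left_module jordan_double M by (rule left_module)

lemma act_closed [simp, intro]: "m \<in> carrier M \<Longrightarrow> act M p m \<in> carrier M"
  by (simp add: act_def smult_closed residue_class_closed)

lemma act_add_left: "m \<in> carrier M \<Longrightarrow> act M (p + q) m = act M p m \<oplus> act M q m"
  unfolding act_def residue_class_hom[symmetric] by (rule smult_l_distr) (auto intro: residue_class_closed)

lemma act_mult: "m \<in> carrier M \<Longrightarrow> act M (p * q) m = act M p (act M q m)"
  unfolding act_def residue_class_hom[symmetric] by (rule smult_assoc1) (auto intro: residue_class_closed)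

lemma act_one [simp]: "m \<in> carrier M \<Longrightarrow> act M 1 m = m"
  unfolding act_def residue_class_hom[symmetric] by (rule smult_one)

lemma act_add: "m \<in> carrier M \<Longrightarrow> m' \<in> carrier M \<Longrightarrow> act M p (m \<oplus> m') = act M p m \<oplus> act M p m'"
  unfolding act_def by (rule smult_r_distr) (auto intro: residue_class_closed)

lemma act_zero [simp]: "act M p \<zero> = \<zero>"
  using act_add[of "\<zero>" "\<zero>" p] M.add.l_cancel_one[of "act M p \<zero>" "act M p \<zero>"] by simp

lemma act_zero_left [simp]: "m \<in> carrier M \<Longrightarrow> act M 0 m = \<zero>"
  using act_add_left[of m 0 0] M.add.l_cancel_one[of "act M 0 m" "act M 0 m"] by simp

lemma act_uminus_left: "m \<in> carrier M \<Longrightarrow> act M (- p) m = \<ominus> act M p m"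
  using act_add_left[of m p "- p"] M.minus_equality[of "act M (- p) m" "act M p m"]
  by (simp add: M.a_comm)

lemma act_cong: "cls p = cls q \<Longrightarrow> act M p m = act M q m"
  by (simp add: act_def cls_eq_iff)

end

section \<open>Homomorphisms, submodules and quotients\<close>

lemma module_homI:
  assumes "\<And>x. x \<in> carrier M \<Longrightarrow> f x \<in> carrier N"
    and "\<And>x y. x \<in> carrier M \<Longrightarrow> y \<in> carrier M \<Longrightarrow> f (x \<oplus>\<^bsub>M\<^esub> y) = f x \<oplus>\<^bsub>N\<^esub> f y"
    and "\<And>r x. r \<in> carrier R \<Longrightarrow> x \<in> carrier M \<Longrightarrow> f (r \<odot>\<^bsub>M\<^esub> x) = r \<odot>\<^bsub>N\<^esub> f x"
  shows "f \<in> module_hom R M N"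
  using assms by (auto simp: LinearCombinations.module_hom_def)

lemma module_homD:
  assumes "f \<in> module_hom R M N"
  shows "x \<in> carrier M \<Longrightarrow> f x \<in> carrier N"
    and "x \<in> carrier M \<Longrightarrow> y \<in> carrier M \<Longrightarrow> f (x \<oplus>\<^bsub>M\<^esub> y) = f x \<oplus>\<^bsub>N\<^esub> f y"
    and "r \<in> carrier R \<Longrightarrow> x \<in> carrier M \<Longrightarrow> f (r \<odot>\<^bsub>M\<^esub> x) = r \<odot>\<^bsub>N\<^esub> f x"
  using assms by (auto simp: LinearCombinations.module_hom_def)

lemma module_hom_0:
  assumes "left_module R M" "left_module R N" "f \<in> module_hom R M N"
  shows "f \<zero>\<^bsub>M\<^esub> = \<zero>\<^bsub>N\<^esub>"
proof -
  interpret M: left_module R M by fact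
  interpret N: left_module R N by fact
  have "f \<zero>\<^bsub>M\<^esub> \<oplus>\<^bsub>N\<^esub> f \<zero>\<^bsub>M\<^esub> = f \<zero>\<^bsub>M\<^esub>"
    using module_homD(2)[OF assms(3), of "\<zero>\<^bsub>M\<^esub>" "\<zero>\<^bsub>M\<^esub>"] by simp
  then show ?thesis using module_homD(1)[OF assms(3), of "\<zero>\<^bsub>M\<^esub>"] N.M.add.l_cancel_one by simp
qed

lemma module_hom_uminus:
  assumes "left_module R M" "left_module R N" "f \<in> module_hom R M N" "x \<in> carrier M"
  shows "f (\<ominus>\<^bsub>M\<^esub> x) = \<ominus>\<^bsub>N\<^esub> f x"
proof -
  interpret M: left_module R M by fact
  interpret N: left_module R N by fact
  have "f (\<ominus>\<^bsub>M\<^esub> x) \<oplus>\<^bsub>N\<^esub> f x = \<zero>\<^bsub>N\<^esub>"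
    using module_homD(2)[OF assms(3), of "\<ominus>\<^bsub>M\<^esub> x" x] module_hom_0[OF assms(1-3)] assms(4)
    by (simp add: M.M.l_neg)
  then show ?thesis
    using N.M.minus_equality[of "f (\<ominus>\<^bsub>M\<^esub> x)" "f x"] module_homD(1)[OF assms(3)] assms(4) by simp
qed

lemma module_iso_inv:
  assumes M: "left_module R M" and f: "f \<in> module_iso R M N"
  shows "inv_into (carrier M) f \<in> module_iso R N M"
proof -
  interpret M: left_module R M by fact
  let ?g = "inv_into (carrier M) f"
  have hom: "f \<in> module_hom R M N" and bij: "bij_betw f (carrier M) (carrier N)"
    using f by (auto simp: module_iso_def)
  have g: "?g y \<in> carrier M" "f (?g y) = y" if "y \<in> carrier N" for y
    using bij that by (auto simp: bij_betw_def intro: inv_into_into f_inv_into_f)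
  have eq: "?g y = x" if "x \<in> carrier M" "f x = y" for x y
    using bij that by (auto simp: bij_betw_def)
  have "?g \<in> module_hom R N M"
    by (rule module_homI) (auto intro!: eq M.smult_closed simp: g module_homD[OF hom])
  then show ?thesis using bij_betw_inv_into[OF bij] by (simp add: module_iso_def)
qed

lemma module_iso_comp:
  assumes "f \<in> module_iso R M N" "g \<in> module_iso R N P"
  shows "g \<circ> f \<in> module_iso R M P"
proof -
  have "bij_betw (g \<circ> f) (carrier M) (carrier P)"
    using assms by (intro bij_betw_trans[of f _ "carrier N"]) (auto simp: module_iso_def)
  then show ?thesis
    using assms by (simp add: module_iso_def LinearCombinations.module_hom_def Pi_iff)
qed

lemma isomorphic_modules_trans:
  "isomorphic_modules R M N \<Longrightarrow> isomorphic_modules R N P \<Longrightarrow> isomorphic_modules R M P"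
  unfolding isomorphic_modules_def ex_in_conv[symmetric] by (blast intro: module_iso_comp)

lemma left_submoduleI:
  assumes M: "left_module R M" and sub: "N \<subseteq> carrier M" and zero: "\<zero>\<^bsub>M\<^esub> \<in> N"
    and add: "\<And>x y. x \<in> N \<Longrightarrow> y \<in> N \<Longrightarrow> x \<oplus>\<^bsub>M\<^esub> y \<in> N"
    and smult: "\<And>r x. r \<in> carrier R \<Longrightarrow> x \<in> N \<Longrightarrow> r \<odot>\<^bsub>M\<^esub> x \<in> N"
  shows "left_submodule R M N"
proof -
  interpret M: left_module R M by fact
  have neg: "\<ominus>\<^bsub>M\<^esub> x \<in> N" if x: "x \<in> N" for x
  proof -
    let ?r = "\<ominus>\<^bsub>R\<^esub> \<one>\<^bsub>R\<^esub>"
    have xM: "x \<in> carrier M" using x sub by blast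
    have rx: "?r \<odot>\<^bsub>M\<^esub> x \<in> carrier M" using xM by (simp add: M.smult_closed)
    have z: "\<zero>\<^bsub>R\<^esub> \<odot>\<^bsub>M\<^esub> x = \<zero>\<^bsub>M\<^esub>"
      using M.smult_l_distr[of "\<zero>\<^bsub>R\<^esub>" "\<zero>\<^bsub>R\<^esub>" x] xM M.smult_closed[of "\<zero>\<^bsub>R\<^esub>" x]
        M.M.add.l_cancel_one[of "\<zero>\<^bsub>R\<^esub> \<odot>\<^bsub>M\<^esub> x" "\<zero>\<^bsub>R\<^esub> \<odot>\<^bsub>M\<^esub> x"] by simp
    have "?r \<odot>\<^bsub>M\<^esub> x \<oplus>\<^bsub>M\<^esub> x = \<zero>\<^bsub>M\<^esub>"
      using M.smult_l_distr[of ?r "\<one>\<^bsub>R\<^esub>" x] xM z by (simp add: M.smult_one M.R.l_neg)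
    then have "\<ominus>\<^bsub>M\<^esub> x = ?r \<odot>\<^bsub>M\<^esub> x" using M.M.minus_equality rx xM by blast
    then show ?thesis using smult[of ?r x] x by simp
  qed
  have "subgroup N (add_monoid M)"
    by (rule group.subgroupI[OF M.M.a_group])
      (use sub zero add neg in \<open>auto simp: a_inv_def\<close>)
  then show ?thesis
    using smult by (auto simp: left_submodule_def additive_subgroup_def)
qed

lemma left_submoduleD:
  assumes "left_submodule R M N"
  shows "N \<subseteq> carrier M" "\<zero>\<^bsub>M\<^esub> \<in> N" "x \<in> N \<Longrightarrow> y \<in> N \<Longrightarrow> x \<oplus>\<^bsub>M\<^esub> y \<in> N"
    "r \<in> carrier R \<Longrightarrow> x \<in> N \<Longrightarrow> r \<odot>\<^bsub>M\<^esub> x \<in> N"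
  using assms additive_subgroup.a_closed[of N M x y] additive_subgroup.zero_closed[of N M]
    additive_subgroup.a_subset[of N M]
  by (auto simp: left_submodule_def)

lemma left_submodule_uminus:
  assumes "left_module R M" "left_submodule R M N" "x \<in> N"
  shows "\<ominus>\<^bsub>M\<^esub> x \<in> N"
proof -
  interpret M: left_module R M by fact
  show ?thesis
    using assms subgroup.m_inv_closed[of N "add_monoid M" x]
    by (simp add: left_submodule_def additive_subgroup_def a_inv_def)
qed

lemma left_module_restrict:
  assumes M: "left_module R M" and N: "left_submodule R M N"
  shows "left_module R (M\<lparr>carrier := N\<rparr>)"
proof -
  interpret M: left_module R M by fact
  note D = left_submoduleD[OF N]
  have sub: "x \<in> N \<Longrightarrow> x \<in> carrier M" for x using D(1) by blast
  have "abelian_group (M\<lparr>carrier := N\<rparr>)"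
  proof (rule abelian_groupI)
    fix x assume "x \<in> carrier (M\<lparr>carrier := N\<rparr>)"
    then show "\<exists>y\<in>carrier (M\<lparr>carrier := N\<rparr>). y \<oplus>\<^bsub>M\<lparr>carrier := N\<rparr>\<^esub> x = \<zero>\<^bsub>M\<lparr>carrier := N\<rparr>\<^esub>"
      using left_submodule_uminus[OF M N] by (auto intro!: bexI[of _ "\<ominus>\<^bsub>M\<^esub> x"] simp: sub M.M.l_neg)
  qed (use D in \<open>auto simp: sub M.M.a_ac\<close>)
  then show ?thesis
    using D by (intro left_module.intro left_module_axioms.intro M.R.ring_axioms)
      (auto simp: sub M.smult_l_distr M.smult_r_distr M.smult_assoc1 M.smult_one)
qed

lemma left_module_direct_sum:
  assumes "left_module R M" "left_module R N"
  shows "left_module R (direct_sum M N)"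
proof -
  interpret M: left_module R M by fact
  interpret N: left_module R N by fact
  have "abelian_group (direct_sum M N)"
  proof (rule abelian_groupI)
    fix x assume "x \<in> carrier (direct_sum M N)"
    then show "\<exists>y\<in>carrier (direct_sum M N). y \<oplus>\<^bsub>direct_sum M N\<^esub> x = \<zero>\<^bsub>direct_sum M N\<^esub>"
      by (intro bexI[of _ "(\<ominus>\<^bsub>M\<^esub> fst x, \<ominus>\<^bsub>N\<^esub> snd x)"])
        (auto simp: direct_sum_def M.M.l_neg N.M.l_neg)
  qed (auto simp: direct_sum_def M.M.a_ac N.M.a_ac)
  then show ?thesis
    by (intro left_module.intro left_module_axioms.intro M.R.ring_axioms)
      (auto simp: direct_sum_def M.smult_closed N.smult_closed M.smult_l_distr M.smult_r_distr
        M.smult_assoc1 M.smult_one N.smult_l_distr N.smult_r_distr N.smult_assoc1 N.smult_one)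
qed

lemma left_module_regular:
  assumes "ring R" shows "left_module R (regular_module R)"
proof -
  interpret ring R by fact
  have "abelian_group (regular_module R)"
  proof (rule abelian_groupI)
    fix x assume "x \<in> carrier (regular_module R)"
    then show "\<exists>y\<in>carrier (regular_module R). y \<oplus>\<^bsub>regular_module R\<^esub> x = \<zero>\<^bsub>regular_module R\<^esub>"
      by (intro bexI[of _ "\<ominus>\<^bsub>R\<^esub> x"]) (auto simp: regular_module_def l_neg)
  qed (auto simp: regular_module_def a_ac)
  then show ?thesis
    by (intro left_module.intro left_module_axioms.intro assms)
      (auto simp: regular_module_def l_distr r_distr m_assoc)
qed

lemma generated_submodule_minimal:
  "left_submodule R M N \<Longrightarrow> Z \<subseteq> N \<Longrightarrow> generated_submodule R M Z \<subseteq> N"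
  by (auto simp: generated_submodule_def)

lemma left_submodule_carrier:
  assumes "left_module R M" shows "left_submodule R M (carrier M)"
proof -
  interpret M: left_module R M by fact
  show ?thesis by (rule left_submoduleI[OF assms]) (auto intro: M.smult_closed)
qed

lemma left_submodule_generated:
  assumes M: "left_module R M" and Z: "Z \<subseteq> carrier M"
  shows "left_submodule R M (generated_submodule R M Z)" "Z \<subseteq> generated_submodule R M Z"
proof -
  show "left_submodule R M (generated_submodule R M Z)"
  proof (rule left_submoduleI[OF M])
    show "generated_submodule R M Z \<subseteq> carrier M"
      using left_submodule_carrier[OF M] Z by (rule generated_submodule_minimal)
  qed (auto simp: generated_submodule_def intro: left_submoduleD(2-4))
  show "Z \<subseteq> generated_submodule R M Z"
    by (auto simp: generated_submodule_def)
qed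

context
  fixes R :: "'r ring" and M :: "('r, 'm) module" and N :: "'m set"
  assumes M: "left_module R M" and N: "left_submodule R M N"
begin

interpretation M: left_module R M by (rule M)

interpretation N: abelian_subgroup N M
  using N by (intro abelian_subgroupI3 M.M.abelian_group_axioms) (auto simp: left_submodule_def)

lemma coset_eq_iff:
  assumes x: "x \<in> carrier M" and y: "y \<in> carrier M"
  shows "N +>\<^bsub>M\<^esub> x = N +>\<^bsub>M\<^esub> y \<longleftrightarrow> (\<exists>\<nu>\<in>N. x = \<nu> \<oplus>\<^bsub>M\<^esub> y)"
proof
  assume "N +>\<^bsub>M\<^esub> x = N +>\<^bsub>M\<^esub> y"
  then have "x \<in> N +>\<^bsub>M\<^esub> y" using N.a_rcos_self[OF x] by simp
  then show "\<exists>\<nu>\<in>N. x = \<nu> \<oplus>\<^bsub>M\<^esub> y" by (auto simp: a_r_coset_def r_coset_def)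
next
  assume "\<exists>\<nu>\<in>N. x = \<nu> \<oplus>\<^bsub>M\<^esub> y"
  then have "x \<in> N +>\<^bsub>M\<^esub> y" by (auto simp: a_r_coset_def r_coset_def)
  then show "N +>\<^bsub>M\<^esub> x = N +>\<^bsub>M\<^esub> y"
    using M.M.a_repr_independence[OF _ y N.a_subgroup] by simp
qed

lemma carrier_quotient: "carrier (quotient_module M N) = (\<lambda>x. N +>\<^bsub>M\<^esub> x) ` carrier M"
  by (auto simp: quotient_module_def A_RCOSETS_def RCOSETS_def a_r_coset_def)

lemma quotient_add:
  assumes "x \<in> carrier M" "y \<in> carrier M"
  shows "(N +>\<^bsub>M\<^esub> x) \<oplus>\<^bsub>quotient_module M N\<^esub> (N +>\<^bsub>M\<^esub> y) = N +>\<^bsub>M\<^esub> (x \<oplus>\<^bsub>M\<^esub> y)"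
  using N.a_rcos_sum[OF assms] by (simp add: quotient_module_def)

lemma quotient_zero: "\<zero>\<^bsub>quotient_module M N\<^esub> = N +>\<^bsub>M\<^esub> \<zero>\<^bsub>M\<^esub>"
  using left_submoduleD(1)[OF N] by (simp add: quotient_module_def)

lemma quotient_zero_iff:
  "x \<in> carrier M \<Longrightarrow> N +>\<^bsub>M\<^esub> x = \<zero>\<^bsub>quotient_module M N\<^esub> \<longleftrightarrow> x \<in> N"
proof -
  assume x: "x \<in> carrier M"
  have "(\<exists>\<nu>\<in>N. x = \<nu> \<oplus>\<^bsub>M\<^esub> \<zero>\<^bsub>M\<^esub>) \<longleftrightarrow> x \<in> N"
  proof
    assume "x \<in> N"
    then show "\<exists>\<nu>\<in>N. x = \<nu> \<oplus>\<^bsub>M\<^esub> \<zero>\<^bsub>M\<^esub>" using x by (intro bexI[of _ x]) simp_all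
  next
    assume "\<exists>\<nu>\<in>N. x = \<nu> \<oplus>\<^bsub>M\<^esub> \<zero>\<^bsub>M\<^esub>"
    then show "x \<in> N" using left_submoduleD(1)[OF N] by (metis M.M.r_zero subsetD)
  qed
  then show ?thesis using x by (simp only: quotient_zero coset_eq_iff M.M.zero_closed)
qed

lemma quotient_smult:
  assumes r: "r \<in> carrier R" and x: "x \<in> carrier M"
  shows "r \<odot>\<^bsub>quotient_module M N\<^esub> (N +>\<^bsub>M\<^esub> x) = N +>\<^bsub>M\<^esub> (r \<odot>\<^bsub>M\<^esub> x)"
proof -
  have "N +>\<^bsub>M\<^esub> (r \<odot>\<^bsub>M\<^esub> y) = N +>\<^bsub>M\<^esub> (r \<odot>\<^bsub>M\<^esub> x)" if y: "y \<in> N +>\<^bsub>M\<^esub> x" for y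
  proof -
    obtain \<nu> where \<nu>: "\<nu> \<in> N" "y = \<nu> \<oplus>\<^bsub>M\<^esub> x"
      using y by (auto simp: a_r_coset_def r_coset_def)
    then have "\<nu> \<in> carrier M" using left_submoduleD(1)[OF N] by blast
    then show ?thesis
      using \<nu> r x left_submoduleD(4)[OF N r]
      by (subst coset_eq_iff) (auto simp: M.smult_r_distr M.smult_closed)
  qed
  then have "(\<Union>y\<in>N +>\<^bsub>M\<^esub> x. N +>\<^bsub>M\<^esub> (r \<odot>\<^bsub>M\<^esub> y)) = (\<Union>y\<in>N +>\<^bsub>M\<^esub> x. N +>\<^bsub>M\<^esub> (r \<odot>\<^bsub>M\<^esub> x))"
    by (rule SUP_cong[OF refl])
  moreover have "N +>\<^bsub>M\<^esub> x \<noteq> {}" using N.a_rcos_self[OF x] by blast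
  ultimately show ?thesis by (simp only: quotient_module_def module.simps) simp
qed

lemma left_module_quotient: "left_module R (quotient_module M N)"
proof -
  have "abelian_group (quotient_module M N)"
  proof (rule abelian_groupI)
    fix C assume "C \<in> carrier (quotient_module M N)"
    then obtain x where x: "x \<in> carrier M" "C = N +>\<^bsub>M\<^esub> x" by (auto simp: carrier_quotient)
    then show "\<exists>D\<in>carrier (quotient_module M N). D \<oplus>\<^bsub>quotient_module M N\<^esub> C = \<zero>\<^bsub>quotient_module M N\<^esub>"
      by (intro bexI[of _ "N +>\<^bsub>M\<^esub> (\<ominus>\<^bsub>M\<^esub> x)"])
        (auto simp: carrier_quotient quotient_add quotient_zero M.M.l_neg)
  qed (auto simp: carrier_quotient quotient_add quotient_zero M.M.a_ac)
  then show ?thesis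
    by (intro left_module.intro left_module_axioms.intro M.R.ring_axioms)
      (auto simp: carrier_quotient quotient_smult quotient_add M.smult_closed M.smult_l_distr
        M.smult_r_distr M.smult_assoc1 M.smult_one)
qed

end

section \<open>Extensions, Baer sums and pushouts\<close>

lemma left_submodule_image:
  assumes A: "left_module R A" and M: "left_module R M" and f: "f \<in> module_hom R A M"
  shows "left_submodule R M (f ` carrier A)"
proof -
  interpret A: left_module R A by fact
  show ?thesis
  proof (rule left_submoduleI[OF M])
    show "\<zero>\<^bsub>M\<^esub> \<in> f ` carrier A"
      using imageI[OF A.M.zero_closed, of f] module_hom_0[OF A M f] by simp
  next
    fix x y assume "x \<in> f ` carrier A" "y \<in> f ` carrier A"
    then obtain a b where "a \<in> carrier A" "x = f a" "b \<in> carrier A" "y = f b" by blast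
    then show "x \<oplus>\<^bsub>M\<^esub> y \<in> f ` carrier A"
      by (intro image_eqI[of _ f "a \<oplus>\<^bsub>A\<^esub> b"]) (simp_all add: module_homD(2)[OF f])
  next
    fix r x assume "r \<in> carrier R" "x \<in> f ` carrier A"
    then obtain a where "r \<in> carrier R" "a \<in> carrier A" "x = f a" by blast
    then show "r \<odot>\<^bsub>M\<^esub> x \<in> f ` carrier A"
      by (intro image_eqI[of _ f "r \<odot>\<^bsub>A\<^esub> a"]) (simp_all add: module_homD(3)[OF f] A.smult_closed)
  qed (use module_homD(1)[OF f] in blast)
qed

lemma (in left_module) smult_zero:
  assumes "r \<in> carrier R"
  shows "r \<odot>\<^bsub>M\<^esub> \<zero>\<^bsub>M\<^esub> = \<zero>\<^bsub>M\<^esub>"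
  using smult_r_distr[of r "\<zero>\<^bsub>M\<^esub>" "\<zero>\<^bsub>M\<^esub>"] smult_closed[of r "\<zero>\<^bsub>M\<^esub>"] assms
    M.add.l_cancel_one[of "r \<odot>\<^bsub>M\<^esub> \<zero>\<^bsub>M\<^esub>" "r \<odot>\<^bsub>M\<^esub> \<zero>\<^bsub>M\<^esub>"] by simp

lemma (in left_module) uminus_zero: "\<ominus>\<^bsub>M\<^esub> \<zero>\<^bsub>M\<^esub> = \<zero>\<^bsub>M\<^esub>"
  using M.minus_equality[of "\<zero>\<^bsub>M\<^esub>" "\<zero>\<^bsub>M\<^esub>"] by simp

lemma (in left_module) smult_uminus:
  assumes "r \<in> carrier R" "x \<in> carrier M"
  shows "r \<odot>\<^bsub>M\<^esub> (\<ominus>\<^bsub>M\<^esub> x) = \<ominus>\<^bsub>M\<^esub> (r \<odot>\<^bsub>M\<^esub> x)"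
proof -
  have "r \<odot>\<^bsub>M\<^esub> (\<ominus>\<^bsub>M\<^esub> x) \<oplus>\<^bsub>M\<^esub> r \<odot>\<^bsub>M\<^esub> x = \<zero>\<^bsub>M\<^esub>"
    using smult_r_distr[of r "\<ominus>\<^bsub>M\<^esub> x" x] assms by (simp add: M.l_neg smult_zero)
  then show ?thesis
    using M.minus_equality[of "r \<odot>\<^bsub>M\<^esub> (\<ominus>\<^bsub>M\<^esub> x)" "r \<odot>\<^bsub>M\<^esub> x"] assms by (simp add: smult_closed)
qed

lemma is_extensionD:
  assumes "is_extension R A B E"
  shows "left_module R A" "left_module R (middle E)" "left_module R B"
    "incl E \<in> module_hom R A (middle E)" "inj_on (incl E) (carrier A)"
    "proj E \<in> module_hom R (middle E) B" "proj E ` carrier (middle E) = carrier B"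
    "a \<in> carrier A \<Longrightarrow> incl E a \<in> carrier (middle E)"
    "s \<in> carrier (middle E) \<Longrightarrow> proj E s \<in> carrier B"
    "a \<in> carrier A \<Longrightarrow> proj E (incl E a) = \<zero>\<^bsub>B\<^esub>"
proof -
  note E = assms[unfolded is_extension_def]
  show "left_module R A" "left_module R (middle E)" "left_module R B"
    and i: "incl E \<in> module_hom R A (middle E)" and "inj_on (incl E) (carrier A)"
    and p: "proj E \<in> module_hom R (middle E) B" and "proj E ` carrier (middle E) = carrier B"
    using E by simp_all
  show "a \<in> carrier A \<Longrightarrow> incl E a \<in> carrier (middle E)" by (rule module_homD(1)[OF i])
  show "s \<in> carrier (middle E) \<Longrightarrow> proj E s \<in> carrier B" by (rule module_homD(1)[OF p])
  have ker: "incl E ` carrier A = {s \<in> carrier (middle E). proj E s = \<zero>\<^bsub>B\<^esub>}"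
    using E by (elim conjE)
  show "proj E (incl E a) = \<zero>\<^bsub>B\<^esub>" if "a \<in> carrier A"
    using imageI[OF that, of "incl E"] unfolding ker by simp
qed

lemma is_extension_lift:
  assumes "is_extension R A B E" "b \<in> carrier B"
  obtains s where "s \<in> carrier (middle E)" "proj E s = b"
proof -
  have "b \<in> proj E ` carrier (middle E)"
    using assms(2) by (simp only: is_extensionD(7)[OF assms(1)])
  then show ?thesis using that by blast
qed

lemma is_extension_kernel:
  assumes "is_extension R A B E" "s \<in> carrier (middle E)" "proj E s = \<zero>\<^bsub>B\<^esub>"
  obtains a where "a \<in> carrier A" "s = incl E a"
proof -
  have "s \<in> incl E ` carrier A" using assms by (simp add: is_extension_def)
  then show ?thesis using that by blast
qed

lemma equivalent_extensions_sym:
  assumes E: "is_extension R A B E" and eq: "equivalent_extensions R A E E'"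
  shows "equivalent_extensions R A E' E"
proof -
  obtain \<phi> where \<phi>: "\<phi> \<in> module_iso R (middle E) (middle E')"
    and i: "\<And>a. a \<in> carrier A \<Longrightarrow> \<phi> (incl E a) = incl E' a"
    and p: "\<And>s. s \<in> carrier (middle E) \<Longrightarrow> proj E' (\<phi> s) = proj E s"
    using eq by (auto simp: equivalent_extensions_def)
  let ?\<psi> = "inv_into (carrier (middle E)) \<phi>"
  have bij: "bij_betw \<phi> (carrier (middle E)) (carrier (middle E'))"
    using \<phi> by (simp add: module_iso_def)
  have "?\<psi> (incl E' a) = incl E a" if "a \<in> carrier A" for a
    using bij_betw_inv_into_left[OF bij is_extensionD(8)[OF E that]] i[OF that] by simp
  moreover have "proj E (?\<psi> s) = proj E' s" if "s \<in> carrier (middle E')" for s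
    using p[of "?\<psi> s"] bij_betw_inv_into_right[OF bij that] bij_betwE[OF bij_betw_inv_into[OF bij]] that
    by simp
  ultimately show ?thesis
    unfolding equivalent_extensions_def
    by (intro bexI[OF _ module_iso_inv[OF is_extensionD(2)[OF E] \<phi>]]) simp
qed

lemma equivalent_extensions_trans:
  assumes "equivalent_extensions R A E F" "equivalent_extensions R A F H"
  shows "equivalent_extensions R A E H"
proof -
  obtain \<phi> where \<phi>: "\<phi> \<in> module_iso R (middle E) (middle F)"
    and i: "\<And>a. a \<in> carrier A \<Longrightarrow> \<phi> (incl E a) = incl F a"
    and p: "\<And>s. s \<in> carrier (middle E) \<Longrightarrow> proj F (\<phi> s) = proj E s"
    using assms(1) by (auto simp: equivalent_extensions_def)
  obtain \<psi> where \<psi>: "\<psi> \<in> module_iso R (middle F) (middle H)"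
    and i': "\<And>a. a \<in> carrier A \<Longrightarrow> \<psi> (incl F a) = incl H a"
    and p': "\<And>s. s \<in> carrier (middle F) \<Longrightarrow> proj H (\<psi> s) = proj F s"
    using assms(2) by (auto simp: equivalent_extensions_def)
  have "\<phi> s \<in> carrier (middle F)" if "s \<in> carrier (middle E)" for s
    using \<phi> that by (auto simp: module_iso_def bij_betw_def)
  then show ?thesis
    unfolding equivalent_extensions_def
    by (intro bexI[OF _ module_iso_comp[OF \<phi> \<psi>]]) (simp add: i i' p p')
qed

text \<open>
  Baer sums and pushouts are quotients of a module \<open>P\<close> that maps onto
  \<open>B\<close> and receives a map from \<open>A\<close>. The exactness argument is the same
  for both.
\<close>

lemma quotient_extension:
  fixes P :: "('r, 'p) module"
  assumes A: "left_module R A" and B: "left_module R B" and P: "left_module R P"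
    and N: "left_submodule R P N"
    and i: "i \<in> module_hom R A P" and p: "p \<in> module_hom R P B"
    and surj: "p ` carrier P = carrier B"
    and ker: "\<And>t. t \<in> carrier P \<Longrightarrow> p t = \<zero>\<^bsub>B\<^esub> \<Longrightarrow> \<exists>\<nu>\<in>N. \<exists>a\<in>carrier A. t = \<nu> \<oplus>\<^bsub>P\<^esub> i a"
    and pN: "\<And>\<nu>. \<nu> \<in> N \<Longrightarrow> p \<nu> = \<zero>\<^bsub>B\<^esub>" and pi: "\<And>a. a \<in> carrier A \<Longrightarrow> p (i a) = \<zero>\<^bsub>B\<^esub>"
    and inj: "\<And>a. a \<in> carrier A \<Longrightarrow> i a \<in> N \<Longrightarrow> a = \<zero>\<^bsub>A\<^esub>"
    and p': "\<And>C. p' C = the_elem (p ` C)"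
  shows "is_extension R A B
      \<lparr>middle = quotient_module P N, incl = \<lambda>a. N +>\<^bsub>P\<^esub> i a, proj = p'\<rparr>"
    and "\<And>t. t \<in> carrier P \<Longrightarrow> p' (N +>\<^bsub>P\<^esub> t) = p t"
proof -
  interpret A: left_module R A by fact
  interpret B: left_module R B by fact
  interpret P: left_module R P by fact
  note q = carrier_quotient[OF P N] quotient_add[OF P N] quotient_smult[OF P N]
  have NP: "\<nu> \<in> carrier P" if "\<nu> \<in> N" for \<nu> using left_submoduleD(1)[OF N] that by blast
  have iP: "a \<in> carrier A \<Longrightarrow> i a \<in> carrier P" for a by (rule module_homD(1)[OF i])
  have pB: "t \<in> carrier P \<Longrightarrow> p t \<in> carrier B" for t by (rule module_homD(1)[OF p])
  have padd: "\<nu> \<in> N \<Longrightarrow> t \<in> carrier P \<Longrightarrow> p (\<nu> \<oplus>\<^bsub>P\<^esub> t) = p t" for \<nu> t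
    by (simp add: module_homD(2)[OF p] NP pN pB)
  show pcos: "p' (N +>\<^bsub>P\<^esub> t) = p t" if t: "t \<in> carrier P" for t
  proof -
    have "p ` (N +>\<^bsub>P\<^esub> t) = {p t}"
      using padd[OF _ t] left_submoduleD(2)[OF N]
      by (fastforce simp: a_r_coset_def r_coset_def intro: rev_image_eqI)
    then show ?thesis by (simp add: p')
  qed
  have ihom: "(\<lambda>a. N +>\<^bsub>P\<^esub> i a) \<in> module_hom R A (quotient_module P N)"
    by (rule module_homI) (auto simp: q iP module_homD(2,3)[OF i])
  have "inj_on (\<lambda>a. N +>\<^bsub>P\<^esub> i a) (carrier A)"
  proof (rule inj_onI)
    fix a b assume a: "a \<in> carrier A" and b: "b \<in> carrier A"
      and "N +>\<^bsub>P\<^esub> i a = N +>\<^bsub>P\<^esub> i b"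
    then obtain \<nu> where \<nu>: "\<nu> \<in> N" "i a = \<nu> \<oplus>\<^bsub>P\<^esub> i b"
      using coset_eq_iff[OF P N] iP by blast
    have "i (a \<ominus>\<^bsub>A\<^esub> b) = \<nu>"
      using a b \<nu> iP NP module_hom_uminus[OF A P i b]
      by (simp add: A.M.minus_eq module_homD(2)[OF i] P.M.a_assoc P.M.r_neg)
    then have "a \<ominus>\<^bsub>A\<^esub> b = \<zero>\<^bsub>A\<^esub>" using inj[of "a \<ominus>\<^bsub>A\<^esub> b"] a b \<nu>(1) by simp
    then show "a = b" using a b by simp
  qed
  moreover have "p' \<in> module_hom R (quotient_module P N) B"
    by (rule module_homI)
      (auto simp: q pcos pB module_homD(2,3)[OF p] P.smult_closed)
  moreover have "p' ` carrier (quotient_module P N) = carrier B"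
    by (simp add: q(1) image_image pcos surj cong: image_cong_simp)
  moreover have "(\<lambda>a. N +>\<^bsub>P\<^esub> i a) ` carrier A
      = {C \<in> carrier (quotient_module P N). p' C = \<zero>\<^bsub>B\<^esub>}"
  proof (intro equalityI subsetI)
    fix C assume "C \<in> {C \<in> carrier (quotient_module P N). p' C = \<zero>\<^bsub>B\<^esub>}"
    then obtain t where t: "t \<in> carrier P" "C = N +>\<^bsub>P\<^esub> t" "p t = \<zero>\<^bsub>B\<^esub>"
      by (auto simp: q(1) pcos)
    then obtain \<nu> a where "\<nu> \<in> N" "a \<in> carrier A" "t = \<nu> \<oplus>\<^bsub>P\<^esub> i a" using ker by blast
    then have "N +>\<^bsub>P\<^esub> t = N +>\<^bsub>P\<^esub> i a"
      using coset_eq_iff[OF P N t(1) iP] by blast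
    then show "C \<in> (\<lambda>a. N +>\<^bsub>P\<^esub> i a) ` carrier A" using \<open>a \<in> carrier A\<close> t(2) by blast
  qed (auto simp: q(1) pcos iP pi)
  ultimately show "is_extension R A B
      \<lparr>middle = quotient_module P N, incl = \<lambda>a. N +>\<^bsub>P\<^esub> i a, proj = p'\<rparr>"
    using A B left_module_quotient[OF P N] ihom by (simp add: is_extension_def)
qed

lemma is_extension_baer_sum:
  assumes E: "is_extension R A B E" and F: "is_extension R A B F"
  shows "is_extension R A B (baer_sum A E F)"
    and "left_module R (fibre_product E F)"
    and "left_submodule R (fibre_product E F) (antidiagonal A E F)"
    and "\<And>t. t \<in> carrier (fibre_product E F) \<Longrightarrow>
      proj (baer_sum A E F) (antidiagonal A E F +>\<^bsub>fibre_product E F\<^esub> t) = proj E (fst t)"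
proof -
  interpret A: left_module R A by (rule is_extensionD(1)[OF E])
  interpret B: left_module R B by (rule is_extensionD(3)[OF E])
  interpret S: left_module R "middle E" by (rule is_extensionD(2)[OF E])
  interpret T: left_module R "middle F" by (rule is_extensionD(2)[OF F])
  note e = is_extensionD[OF E] and f = is_extensionD[OF F]
  let ?D = "direct_sum (middle E) (middle F)" and ?P = "fibre_product E F"
  have D: "left_module R ?D" by (rule left_module_direct_sum) (rule e f)+
  have W: "left_submodule R ?D
      {(s, t). s \<in> carrier (middle E) \<and> t \<in> carrier (middle F) \<and> proj E s = proj F t}"
    using module_hom_0[OF e(2,3,6)] module_hom_0[OF f(2,3,6)]
    by (intro left_submoduleI[OF D])
      (auto simp: direct_sum_def module_homD[OF e(6)] module_homD[OF f(6)]
        S.smult_closed T.smult_closed)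
  show P: "left_module R ?P"
    unfolding fibre_product_def by (rule left_module_restrict[OF D W])
  note Psimps = fibre_product_def direct_sum_def
  have anti: "(\<lambda>a. (incl E a, \<ominus>\<^bsub>middle F\<^esub> incl F a)) \<in> module_hom R A ?P"
    by (intro module_homI)
      (auto simp: Psimps e f module_homD(2,3)[OF e(4)] module_homD(2,3)[OF f(4)] T.M.minus_add
        T.smult_uminus module_hom_uminus[OF f(2,3,6)] B.uminus_zero)
  show N: "left_submodule R ?P (antidiagonal A E F)"
    unfolding antidiagonal_def by (rule left_submodule_image[OF e(1) P anti])
  have i: "(\<lambda>a. (incl E a, \<zero>\<^bsub>middle F\<^esub>)) \<in> module_hom R A ?P"
    by (intro module_homI)
      (auto simp: Psimps e f module_homD(2,3)[OF e(4)] T.smult_zero module_hom_0[OF f(2,3,6)])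
  have p: "(\<lambda>(s, t). proj E s) \<in> module_hom R ?P B"
    by (intro module_homI) (auto simp: Psimps e f module_homD(2,3)[OF e(6)])
  have ext: "is_extension R A B
      \<lparr>middle = quotient_module ?P (antidiagonal A E F),
       incl = \<lambda>a. antidiagonal A E F +>\<^bsub>?P\<^esub> (incl E a, \<zero>\<^bsub>middle F\<^esub>),
       proj = (\<lambda>C. the_elem ((\<lambda>(s, t). proj E s) ` C))\<rparr> \<and>
      (\<forall>t\<in>carrier ?P. the_elem ((\<lambda>(s, t). proj E s) ` (antidiagonal A E F +>\<^bsub>?P\<^esub> t)) = proj E (fst t))"
  proof (intro conjI ballI)
    note qe = quotient_extension[OF e(1,3) P N i p]
    have 1: "(\<lambda>(s, t). proj E s) ` carrier ?P = carrier B"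
    proof (intro equalityI subsetI)
      fix b assume "b \<in> carrier B"
      obtain s where "s \<in> carrier (middle E)" "proj E s = b"
        by (rule is_extension_lift[OF E \<open>b \<in> carrier B\<close>])
      moreover obtain t where "t \<in> carrier (middle F)" "proj F t = b"
        by (rule is_extension_lift[OF F \<open>b \<in> carrier B\<close>])
      ultimately show "b \<in> (\<lambda>(s, t). proj E s) ` carrier ?P"
        by (intro image_eqI[of _ _ "(s, t)"]) (auto simp: Psimps)
    qed (auto simp: Psimps e f)
    have 2: "\<exists>\<nu>\<in>antidiagonal A E F. \<exists>a\<in>carrier A. t = \<nu> \<oplus>\<^bsub>?P\<^esub> (incl E a, \<zero>\<^bsub>middle F\<^esub>)"
      if t: "t \<in> carrier ?P" "(\<lambda>(s, t). proj E s) t = \<zero>\<^bsub>B\<^esub>" for t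
    proof -
      obtain s s' where t: "t = (s, s')" "s \<in> carrier (middle E)" "s' \<in> carrier (middle F)"
        "proj E s = \<zero>\<^bsub>B\<^esub>" "proj F s' = \<zero>\<^bsub>B\<^esub>"
        using t by (auto simp: Psimps)
      obtain a where a: "a \<in> carrier A" "s = incl E a" by (rule is_extension_kernel[OF E t(2,4)])
      obtain b where b: "b \<in> carrier A" "s' = incl F b" by (rule is_extension_kernel[OF F t(3,5)])
      (* Subtracting the antidiagonal element of -b moves the second component into the first. *)
      let ?\<nu> = "(incl E (\<ominus>\<^bsub>A\<^esub> b), \<ominus>\<^bsub>middle F\<^esub> incl F (\<ominus>\<^bsub>A\<^esub> b))"
      have "t = ?\<nu> \<oplus>\<^bsub>?P\<^esub> (incl E (b \<oplus>\<^bsub>A\<^esub> a), \<zero>\<^bsub>middle F\<^esub>)"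
        using a b t
        by (simp add: Psimps module_hom_uminus[OF f(1,2,4)] f A.M.r_neg1 flip: module_homD(2)[OF e(4)])
      moreover have "?\<nu> \<in> antidiagonal A E F" using b by (simp add: antidiagonal_def)
      ultimately show ?thesis using a b by blast
    qed
    have 3: "(\<lambda>(s, t). proj E s) \<nu> = \<zero>\<^bsub>B\<^esub>" if "\<nu> \<in> antidiagonal A E F" for \<nu>
      using that by (auto simp: antidiagonal_def e)
    have 4: "(\<lambda>(s, t). proj E s) (incl E a, \<zero>\<^bsub>middle F\<^esub>) = \<zero>\<^bsub>B\<^esub>" if "a \<in> carrier A" for a
      using that by (simp add: e)
    have 5: "a = \<zero>\<^bsub>A\<^esub>" if a: "a \<in> carrier A" "(incl E a, \<zero>\<^bsub>middle F\<^esub>) \<in> antidiagonal A E F" for a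
    proof -
      obtain b where b: "b \<in> carrier A" "incl E a = incl E b" "\<zero>\<^bsub>middle F\<^esub> = \<ominus>\<^bsub>middle F\<^esub> incl F b"
        using a(2) by (auto simp: antidiagonal_def)
      have "a = b" using inj_onD[OF e(5) b(2)] a(1) b(1) by simp
      moreover have "incl F b = incl F \<zero>\<^bsub>A\<^esub>"
        using b(1) T.M.minus_minus[of "incl F b"]
        by (simp add: f module_hom_0[OF f(1,2,4)] T.uminus_zero flip: b(3))
      then have "b = \<zero>\<^bsub>A\<^esub>" using inj_onD[OF f(5)] b(1) by simp
      ultimately show ?thesis by simp
    qed
    show "is_extension R A B
      \<lparr>middle = quotient_module ?P (antidiagonal A E F),
       incl = \<lambda>a. antidiagonal A E F +>\<^bsub>?P\<^esub> (incl E a, \<zero>\<^bsub>middle F\<^esub>),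
       proj = (\<lambda>C. the_elem ((\<lambda>(s, t). proj E s) ` C))\<rparr>"
      by (rule qe(1)[OF 1 2 3 4 5 refl])
    show "the_elem ((\<lambda>(s, t). proj E s) ` (antidiagonal A E F +>\<^bsub>?P\<^esub> t)) = proj E (fst t)"
      if "t \<in> carrier ?P" for t
      using qe(2)[OF 1 2 3 4 5 refl that] by (simp add: case_prod_beta)
  qed
  show "is_extension R A B (baer_sum A E F)" using ext by (simp add: baer_sum_def)
  show "proj (baer_sum A E F) (antidiagonal A E F +>\<^bsub>?P\<^esub> t) = proj E (fst t)"
    if "t \<in> carrier ?P" for t
    using ext that by (simp add: baer_sum_def)
qed

lemma is_extension_pushout:
  assumes E: "is_extension R A B E" and h: "h \<in> module_hom R A A"
  shows "is_extension R A B (pushout_extension A h E)"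
    and "left_submodule R (direct_sum A (middle E)) (pushout_relations A h E)"
    and "\<And>t. t \<in> carrier (direct_sum A (middle E)) \<Longrightarrow>
      proj (pushout_extension A h E) (pushout_relations A h E +>\<^bsub>direct_sum A (middle E)\<^esub> t) = proj E (snd t)"
proof -
  interpret A: left_module R A by (rule is_extensionD(1)[OF E])
  interpret B: left_module R B by (rule is_extensionD(3)[OF E])
  interpret S: left_module R "middle E" by (rule is_extensionD(2)[OF E])
  note e = is_extensionD[OF E] and h' = module_homD[OF h]
  let ?P = "direct_sum A (middle E)" and ?N = "pushout_relations A h E"
  let ?i = "\<lambda>a. (a, \<zero>\<^bsub>middle E\<^esub>)" and ?p = "\<lambda>(a :: 'b, s). proj E s"
  have P: "left_module R ?P" by (rule left_module_direct_sum) (rule e)+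
  note Psimps = direct_sum_def
  have anti: "(\<lambda>a. (h a, \<ominus>\<^bsub>middle E\<^esub> incl E a)) \<in> module_hom R A ?P"
    by (intro module_homI)
      (auto simp: Psimps e h' module_homD(2,3)[OF e(4)] S.M.minus_add S.smult_uminus)
  show N: "left_submodule R ?P ?N"
    unfolding pushout_relations_def by (rule left_submodule_image[OF e(1) P anti])
  have i: "?i \<in> module_hom R A ?P"
    by (intro module_homI) (auto simp: Psimps S.smult_zero)
  have p: "?p \<in> module_hom R ?P B"
    by (intro module_homI) (auto simp: Psimps e module_homD(2,3)[OF e(6)])
  have 1: "?p ` carrier ?P = carrier B"
  proof (intro equalityI subsetI)
    fix b assume "b \<in> carrier B"
    then obtain s where "s \<in> carrier (middle E)" "proj E s = b"
      by (rule is_extension_lift[OF E])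
    then show "b \<in> ?p ` carrier ?P"
      by (intro image_eqI[of _ _ "(\<zero>\<^bsub>A\<^esub>, s)"]) (auto simp: Psimps)
  qed (auto simp: Psimps e)
  have 2: "\<exists>\<nu>\<in>?N. \<exists>a\<in>carrier A. t = \<nu> \<oplus>\<^bsub>?P\<^esub> ?i a"
    if t: "t \<in> carrier ?P" "?p t = \<zero>\<^bsub>B\<^esub>" for t
  proof -
    obtain a s where t: "t = (a, s)" "a \<in> carrier A" "s \<in> carrier (middle E)" "proj E s = \<zero>\<^bsub>B\<^esub>"
      using t by (auto simp: Psimps)
    obtain b where b: "b \<in> carrier A" "s = incl E b" by (rule is_extension_kernel[OF E t(3,4)])
    let ?\<nu> = "(h (\<ominus>\<^bsub>A\<^esub> b), \<ominus>\<^bsub>middle E\<^esub> incl E (\<ominus>\<^bsub>A\<^esub> b))"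
    have "t = ?\<nu> \<oplus>\<^bsub>?P\<^esub> ?i (h b \<oplus>\<^bsub>A\<^esub> a)"
      using b t h'(1)[OF b(1)]
      by (simp add: Psimps module_hom_uminus[OF e(1,2,4)] module_hom_uminus[OF e(1,1) h] e A.M.r_neg1)
    moreover have "?\<nu> \<in> ?N" using b by (simp add: pushout_relations_def)
    ultimately show ?thesis using t b h' by blast
  qed
  have 3: "?p \<nu> = \<zero>\<^bsub>B\<^esub>" if "\<nu> \<in> ?N" for \<nu>
    using that by (auto simp: pushout_relations_def module_hom_uminus[OF e(2,3,6)] e)
  have 4: "?p (?i a) = \<zero>\<^bsub>B\<^esub>" if "a \<in> carrier A" for a
    by (simp add: module_hom_0[OF e(2,3,6)])
  have 5: "a = \<zero>\<^bsub>A\<^esub>" if a: "a \<in> carrier A" "?i a \<in> ?N" for a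
  proof -
    obtain b where b: "b \<in> carrier A" "a = h b" "\<zero>\<^bsub>middle E\<^esub> = \<ominus>\<^bsub>middle E\<^esub> incl E b"
      using a(2) by (auto simp: pushout_relations_def)
    have "incl E b = incl E \<zero>\<^bsub>A\<^esub>"
      using b(1) S.M.minus_minus[of "incl E b"]
      by (simp add: e module_hom_0[OF e(1,2,4)] S.uminus_zero flip: b(3))
    then have "b = \<zero>\<^bsub>A\<^esub>" using inj_onD[OF e(5)] b(1) by simp
    then show ?thesis using b(2) module_hom_0[OF e(1,1) h] by simp
  qed
  have p': "(\<lambda>C. the_elem (?p ` C)) C = the_elem (?p ` C)" for C by (rule refl)
  note qe = quotient_extension[OF e(1,3) P N i p]
  show "is_extension R A B (pushout_extension A h E)"
    unfolding pushout_extension_def by (rule qe(1)[OF 1 2 3 4 5 p'])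
  show "proj (pushout_extension A h E) (?N +>\<^bsub>?P\<^esub> t) = proj E (snd t)" if "t \<in> carrier ?P" for t
    using qe(2)[OF 1 2 3 4 5 p' that] by (simp add: pushout_extension_def case_prod_beta)
qed

lemma is_extension_split:
  assumes A: "left_module R A" and B: "left_module R B"
  shows "is_extension R A B (split_extension A B)"
proof -
  interpret A: left_module R A by fact
  interpret B: left_module R B by fact
  have surj: "b \<in> snd ` carrier (direct_sum A B)" if "b \<in> carrier B" for b
    using that by (intro image_eqI[of _ snd "(\<zero>\<^bsub>A\<^esub>, b)"]) (simp_all add: direct_sum_def)
  have "inj1 A B \<in> module_hom R A (direct_sum A B)" "snd \<in> module_hom R (direct_sum A B) B"
    by (auto intro!: module_homI simp: direct_sum_def inj1_def B.smult_zero)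
  moreover have "snd ` carrier (direct_sum A B) = carrier B"
    by (intro equalityI subsetI surj) (auto simp: direct_sum_def split: if_splits)
  ultimately show ?thesis
    using A B left_module_direct_sum[OF A B]
    by (auto simp: is_extension_def split_extension_def inj1_def inj_on_def direct_sum_def)
qed

section \<open>The invariant of an extension\<close>

lemma double_module_extension:
  fixes E :: "('k::field_char_0 jordan_double, 'a, 'b, 's) extension"
  assumes "is_extension jordan_double A B E"
  shows "double_module (middle E)" "double_module A" "double_module B"
  using is_extensionD(1-3)[OF assms] by (simp_all add: double_module_def)

lemma module_hom_act:
  assumes "f \<in> module_hom jordan_double M N" "m \<in> carrier M"
  shows "f (act M p m) = act N p (f m)"
  unfolding act_def by (rule module_homD(3)[OF assms(1) residue_class_closed assms(2)])

text \<open>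
  Products of generators and scalars span the free algebra.
\<close>

lemma module_homI_act:
  fixes M :: "('k::field_char_0 jordan_double, 'm) module"
    and N :: "('k jordan_double, 'n) module"
  assumes M: "double_module M" and N: "double_module N"
    and closed: "\<And>x. x \<in> carrier M \<Longrightarrow> f x \<in> carrier N"
    and add: "\<And>x y. x \<in> carrier M \<Longrightarrow> y \<in> carrier M \<Longrightarrow> f (x \<oplus>\<^bsub>M\<^esub> y) = f x \<oplus>\<^bsub>N\<^esub> f y"
    and scalar: "\<And>c x. x \<in> carrier M \<Longrightarrow> f (act M (scalar c) x) = act N (scalar c) (f x)"
    and gen: "\<And>a x. x \<in> carrier M \<Longrightarrow> f (act M (gen a) x) = act N (gen a) (f x)"
  shows "f \<in> module_hom jordan_double M N"
proof (rule module_homI)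
  interpret M: double_module M by fact
  interpret N: double_module N by fact
  have act: "f (act M p x) = act N p (f x)" if x: "x \<in> carrier M" for p x
  proof (induction p rule: free_alg_induct)
    case (single w c)
    have "f (act M (prod_list (map gen ws)) x) = act N (prod_list (map gen ws)) (f x)" for ws
      by (induction ws) (simp_all add: x closed M.act_mult N.act_mult gen)
    then show ?case
      by (simp add: single_word M.act_mult N.act_mult x closed scalar)
  next
    case (sum p q)
    then show ?case by (simp add: M.act_add_left N.act_add_left x closed add)
  qed
  fix r :: "'k jordan_double" and x assume "r \<in> carrier jordan_double" "x \<in> carrier M"
  then obtain p where "r = residue_class p" by (blast elim: carrier_jordan_doubleE)
  then show "f (r \<odot>\<^bsub>M\<^esub> x) = r \<odot>\<^bsub>N\<^esub> f x"
    using act[OF \<open>x \<in> carrier M\<close>, of p] by (simp add: act_def)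
qed (fact closed, fact add)

lemma double_module_L: "double_module (L n :: ('k::field_char_0 jordan_double, _) module)"
  by (simp add: double_module_def left_module_L)

lemma L_simps:
  "f \<in> carrier (L n) \<longleftrightarrow> (\<forall>i>n. f i = 0)"
  "f \<oplus>\<^bsub>L n\<^esub> h = (\<lambda>i. f i + h i)"
  "\<zero>\<^bsub>L n\<^esub> = (\<lambda>i. 0)"
  by (simp_all add: L_def)

lemma act_L: "f \<in> carrier (L n) \<Longrightarrow> act (L n) p f = L_free n p f"
  for f :: "nat \<Rightarrow> 'k::field_char_0"
  by (simp add: act_def L_smult_residue_class)

lemma act_L_gen: "f \<in> carrier (L n) \<Longrightarrow> act (L n) (gen a) f = L_gen n a f"
  for f :: "nat \<Rightarrow> 'k::field_char_0"
  by (simp add: act_L L_free_gen)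

lemma act_L_scalar: "f \<in> carrier (L n) \<Longrightarrow> act (L n) (scalar c) f = (\<lambda>i. c * f i)"
  for f :: "nat \<Rightarrow> 'k::field_char_0"
  by (simp add: act_L L_free_scalar)

lemma L_uminus:
  assumes "f \<in> carrier (L n)"
  shows "\<ominus>\<^bsub>L n\<^esub> f = (\<lambda>i. - f i :: 'k::field_char_0)"
proof -
  interpret double_module "L n :: ('k jordan_double, _) module" by (rule double_module_L)
  show ?thesis
    by (rule M.minus_equality) (use assms in \<open>auto simp: L_simps\<close>)
qed

lemma basis_vec_closed [simp]: "basis_vec n i \<in> carrier (L n)"
  by (simp add: L_simps basis_vec_def)

lemma scaled_basis_vec_closed [simp]: "(\<lambda>j. c * basis_vec n i j) \<in> carrier (L n)"
  by (simp add: L_simps basis_vec_def)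

lemma act_submodule:
  fixes E :: "('k::field_char_0 jordan_double, nat \<Rightarrow> 'k, 'b, 's) extension"
  assumes E: "is_extension jordan_double (L n) B E" and f: "f \<in> carrier (L n)"
  shows "act (middle E) (gen X) (incl E f) = \<zero>\<^bsub>middle E\<^esub>"
    "act (middle E) (gen U) (incl E f) = \<zero>\<^bsub>middle E\<^esub>"
    "act (middle E) (gen G) (incl E f) = incl E f"
proof -
  note e = is_extensionD[OF E]
  have "incl E (\<lambda>i. 0) = \<zero>\<^bsub>middle E\<^esub>"
    using module_hom_0[OF e(1,2,4)] by (simp add: L_simps)
  then show "act (middle E) (gen X) (incl E f) = \<zero>\<^bsub>middle E\<^esub>"
    "act (middle E) (gen U) (incl E f) = \<zero>\<^bsub>middle E\<^esub>"
    "act (middle E) (gen G) (incl E f) = incl E f"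
    using f by (simp_all add: act_L_gen L_gen_eq L_simps(1) flip: module_hom_act[OF e(4) f])
qed

text \<open>
  On \<open>L(n)\<close> and \<open>L(n - 2)\<close> the element \<open>x\<close> acts as zero. In
  an extension it therefore induces a map \<open>L(n - 2) \<rightarrow> L(n)\<close>, and as it
  lowers weights by 2, it sends \<open>z\<^sub>n\<^sub>-\<^sub>2\<^sub>,\<^sub>0\<close> to a
  multiple of \<open>z\<^sub>n\<^sub>,\<^sub>2\<close>. The factor turns out to determine the
  extension up to equivalence.
\<close>

type_synonym ('k, 's) weight_extension =
  "('k jordan_double, nat \<Rightarrow> 'k, nat \<Rightarrow> 'k, 's) extension"

definition x_coefficient ::
    "nat \<Rightarrow> ('k::field, 's) weight_extension \<Rightarrow> 'k \<Rightarrow> bool" where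
  "x_coefficient n E c \<longleftrightarrow>
     (\<forall>s\<in>carrier (middle E). proj E s = basis_vec (n - 2) 0 \<longrightarrow>
        act (middle E) (gen X) s = incl E (\<lambda>i. c * basis_vec n 2 i))"

text \<open>
  A single lift suffices: two lifts differ by an element of \<open>L(n)\<close>, and
  \<open>x\<close> annihilates it.
\<close>

lemma x_coefficientI:
  fixes E :: "('k::field_char_0, 's) weight_extension"
  assumes E: "is_extension jordan_double (L n) (L (n - 2)) E"
    and s: "s \<in> carrier (middle E)" "proj E s = basis_vec (n - 2) 0"
    and xs: "act (middle E) (gen X) s = incl E (\<lambda>i. c * basis_vec n 2 i)"
  shows "x_coefficient n E c"
  unfolding x_coefficient_def
proof (intro ballI impI)
  interpret S: double_module "middle E" by (rule double_module_extension(1)[OF E])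
  interpret B: double_module "L (n - 2) :: ('k jordan_double, _) module" by (rule double_module_L)
  note e = is_extensionD[OF E]
  fix t assume t: "t \<in> carrier (middle E)" "proj E t = basis_vec (n - 2) 0"
  let ?d = "t \<oplus>\<^bsub>middle E\<^esub> \<ominus>\<^bsub>middle E\<^esub> s"
  have d: "?d \<in> carrier (middle E)" using s t by simp
  have "proj E ?d = \<zero>\<^bsub>L (n - 2)\<^esub>"
    using s t by (simp add: module_homD(2)[OF e(6)] module_hom_uminus[OF e(2,3,6)] B.M.r_neg)
  then obtain f where f: "f \<in> carrier (L n)" "?d = incl E f"
    by (rule is_extension_kernel[OF E d])
  have "t = ?d \<oplus>\<^bsub>middle E\<^esub> s" using s t by (simp add: S.M.a_assoc S.M.l_neg)
  also have "act (middle E) (gen X) \<dots> = act (middle E) (gen X) ?d \<oplus>\<^bsub>middle E\<^esub> act (middle E) (gen X) s"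
    by (rule S.act_add[OF d s(1)])
  also have "\<dots> = act (middle E) (gen X) s"
    using s f by (simp only: act_submodule[OF E f(1)] S.M.l_zero S.act_closed)
  finally show "act (middle E) (gen X) t = incl E (\<lambda>i. c * basis_vec n 2 i)"
    by (simp only: xs)
qed

lemma x_coefficientE:
  assumes "is_extension jordan_double (L n) (L (n - 2)) E" "x_coefficient n E c"
  obtains s where "s \<in> carrier (middle E)" "proj E s = basis_vec (n - 2) 0"
    "act (middle E) (gen X) s = incl E (\<lambda>i. c * basis_vec n 2 i)"
proof -
  obtain s where "s \<in> carrier (middle E)" "proj E s = basis_vec (n - 2) 0"
    by (rule is_extension_lift[OF assms(1) basis_vec_closed])
  then show ?thesis using assms(2) that by (simp add: x_coefficient_def)
qed

lemma x_coefficient_unique: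
  fixes E :: "('k::field_char_0, 's) weight_extension"
  assumes n: "2 \<le> n" and E: "is_extension jordan_double (L n) (L (n - 2)) E"
    and c: "x_coefficient n E c" and d: "x_coefficient n E d"
  shows "c = d"
proof -
  obtain s where s: "s \<in> carrier (middle E)" "proj E s = basis_vec (n - 2) 0"
    "act (middle E) (gen X) s = incl E (\<lambda>i. c * basis_vec n 2 i)"
    by (rule x_coefficientE[OF E c])
  then have "incl E (\<lambda>i. c * basis_vec n 2 i) = incl E (\<lambda>i. d * basis_vec n 2 i)"
    using d by (simp add: x_coefficient_def)
  then have "(\<lambda>i. c * basis_vec n 2 i) = (\<lambda>i. d * basis_vec n 2 i)"
    by (rule inj_onD[OF is_extensionD(5)[OF E]]) simp_all
  from fun_cong[OF this, of 2] show ?thesis using n by (simp add: basis_vec_def)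
qed

lemma x_coefficient_equivalent:
  fixes E :: "('k::field_char_0, 's) weight_extension"
    and F :: "('k, 't) weight_extension"
  assumes E: "is_extension jordan_double (L n) (L (n - 2)) E"
    and F: "is_extension jordan_double (L n) (L (n - 2)) F"
    and eq: "equivalent_extensions jordan_double (L n) E F" and c: "x_coefficient n E c"
  shows "x_coefficient n F c"
proof -
  obtain \<phi> where \<phi>: "\<phi> \<in> module_iso jordan_double (middle E) (middle F)"
    and i: "\<And>a. a \<in> carrier (L n) \<Longrightarrow> \<phi> (incl E a) = incl F a"
    and p: "\<And>s. s \<in> carrier (middle E) \<Longrightarrow> proj F (\<phi> s) = proj E s"
    using eq by (auto simp: equivalent_extensions_def)
  have hom: "\<phi> \<in> module_hom jordan_double (middle E) (middle F)"
    using \<phi> by (simp add: module_iso_def)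
  obtain s where s: "s \<in> carrier (middle E)" "proj E s = basis_vec (n - 2) 0"
    "act (middle E) (gen X) s = incl E (\<lambda>i. c * basis_vec n 2 i)"
    by (rule x_coefficientE[OF E c])
  show ?thesis
  proof (rule x_coefficientI[OF F])
    show "\<phi> s \<in> carrier (middle F)" by (rule module_homD(1)[OF hom s(1)])
    show "proj F (\<phi> s) = basis_vec (n - 2) 0" using p s by simp
    show "act (middle F) (gen X) (\<phi> s) = incl F (\<lambda>i. c * basis_vec n 2 i)"
      by (simp add: s(3) i flip: module_hom_act[OF hom s(1)])
  qed
qed

lemma act_quotient:
  fixes M :: "('k::field_char_0 jordan_double, 'm) module"
  assumes "left_module jordan_double M" "left_submodule jordan_double M N" "m \<in> carrier M"
  shows "act (quotient_module M N) p (N +>\<^bsub>M\<^esub> m) = N +>\<^bsub>M\<^esub> act M p m"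
  unfolding act_def by (rule quotient_smult[OF assms(1,2) residue_class_closed assms(3)])

lemma act_direct_sum: "act (direct_sum M N) p (x, y) = (act M p x, act N p y)"
  by (simp add: act_def direct_sum_def)

lemma act_fibre_product: "act (fibre_product E F) p (x, y) = (act (middle E) p x, act (middle F) p y)"
  by (simp add: act_def fibre_product_def direct_sum_def)

lemma x_coefficient_split:
  "x_coefficient n (split_extension (L n) (L (n - 2)) ::
     ('k::field_char_0 jordan_double, nat \<Rightarrow> 'k, nat \<Rightarrow> 'k, _) extension) 0"
proof (rule x_coefficientI)
  let ?E = "split_extension (L n) (L (n - 2)) ::
     ('k jordan_double, nat \<Rightarrow> 'k, nat \<Rightarrow> 'k, _) extension"
  let ?s = "(\<lambda>i. 0, basis_vec (n - 2) 0) :: (nat \<Rightarrow> 'k) \<times> (nat \<Rightarrow> 'k)"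
  show "is_extension jordan_double (L n) (L (n - 2)) ?E"
    by (intro is_extension_split left_module_L)
  show "?s \<in> carrier (middle ?E)" "proj ?E ?s = basis_vec (n - 2) 0"
    using basis_vec_closed[of "n - 2" 0, where 'a = 'k]
    by (simp_all add: split_extension_def direct_sum_def L_simps)
  have "(\<lambda>i. 0) \<in> carrier (L n :: ('k jordan_double, _) module)" by (simp add: L_simps)
  then show "act (middle ?E) (gen X) ?s = incl ?E (\<lambda>i. 0 * basis_vec n 2 i)"
    using basis_vec_closed[of "n - 2" 0, where 'a = 'k]
    by (simp add: split_extension_def act_direct_sum inj1_def act_L_gen L_gen_eq L_simps)
qed

text \<open>
  If \<open>s\<close> and \<open>t\<close> are lifts in the two extensions, \<open>x\<close> maps
  the class of \<open>(s, t)\<close> to the class of \<open>(c z\<^sub>n\<^sub>,\<^sub>2, d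
  z\<^sub>n\<^sub>,\<^sub>2)\<close>, which modulo the antidiagonal is that of \<open>((c + d)
  z\<^sub>n\<^sub>,\<^sub>2, 0)\<close>.
\<close>

lemma x_coefficient_baer_sum:
  fixes E :: "('k::field_char_0, 's) weight_extension"
    and F :: "('k, 't) weight_extension"
  assumes E: "is_extension jordan_double (L n) (L (n - 2)) E"
    and F: "is_extension jordan_double (L n) (L (n - 2)) F"
    and c: "x_coefficient n E c" and d: "x_coefficient n F d"
  shows "x_coefficient n (baer_sum (L n) E F) (c + d)"
proof -
  interpret S: double_module "middle E" by (rule double_module_extension(1)[OF E])
  interpret T: double_module "middle F" by (rule double_module_extension(1)[OF F])
  note e = is_extensionD[OF E] and f = is_extensionD[OF F]
  obtain s where s: "s \<in> carrier (middle E)" "proj E s = basis_vec (n - 2) 0"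
    "act (middle E) (gen X) s = incl E (\<lambda>i. c * basis_vec n 2 i)"
    by (rule x_coefficientE[OF E c])
  obtain t where t: "t \<in> carrier (middle F)" "proj F t = basis_vec (n - 2) 0"
    "act (middle F) (gen X) t = incl F (\<lambda>i. d * basis_vec n 2 i)"
    by (rule x_coefficientE[OF F d])
  let ?P = "fibre_product E F" and ?N = "antidiagonal (L n) E F"
  note baer = is_extension_baer_sum[OF E F]
  have st: "(s, t) \<in> carrier ?P" using s t by (simp add: fibre_product_def)
  let ?a = "\<lambda>i. (- d) * basis_vec n 2 i" and ?b = "\<lambda>i. (c + d) * basis_vec n 2 i"
  have inP: "(incl E ?b, \<zero>\<^bsub>middle F\<^esub>) \<in> carrier ?P"
    using e(8)[of ?b] e(10)[of ?b] module_hom_0[OF f(2,3,6)] by (simp add: fibre_product_def)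
  have "(incl E (\<lambda>i. c * basis_vec n 2 i), incl F (\<lambda>i. d * basis_vec n 2 i))
      = (incl E ?a, \<ominus>\<^bsub>middle F\<^esub> incl F ?a) \<oplus>\<^bsub>?P\<^esub> (incl E ?b, \<zero>\<^bsub>middle F\<^esub>)"
  proof -
    have "\<ominus>\<^bsub>L n\<^esub> ?a = (\<lambda>i. d * basis_vec n 2 i)"
      using L_uminus[OF scaled_basis_vec_closed, of n "- d" 2] by simp
    moreover have "?a \<oplus>\<^bsub>L n\<^esub> ?b = (\<lambda>i. c * basis_vec n 2 i)"
      by (simp add: L_simps algebra_simps)
    ultimately show ?thesis
      using module_homD(2)[OF e(4), of ?a ?b] module_hom_uminus[OF f(1,2,4), of ?a]
        f(8)[of "\<lambda>i. d * basis_vec n 2 i"]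
      by (simp only: scaled_basis_vec_closed) (simp add: fibre_product_def direct_sum_def)
  qed
  moreover have "(incl E ?a, \<ominus>\<^bsub>middle F\<^esub> incl F ?a) \<in> ?N"
    unfolding antidiagonal_def by (rule imageI) (rule scaled_basis_vec_closed)
  moreover have "act ?P (gen X) (s, t) \<in> carrier ?P"
    using double_module.act_closed[of ?P "(s, t)"] baer(2) st by (simp add: double_module_def)
  ultimately have "?N +>\<^bsub>?P\<^esub> act ?P (gen X) (s, t) = ?N +>\<^bsub>?P\<^esub> (incl E ?b, \<zero>\<^bsub>middle F\<^esub>)"
    using coset_eq_iff[OF baer(2,3) _ inP] by (auto simp: act_fibre_product s(3) t(3))
  then have "act (middle (baer_sum (L n) E F)) (gen X) (?N +>\<^bsub>?P\<^esub> (s, t)) = incl (baer_sum (L n) E F) ?b"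
    using act_quotient[OF baer(2,3) st] by (simp add: baer_sum_def)
  moreover have "?N +>\<^bsub>?P\<^esub> (s, t) \<in> carrier (middle (baer_sum (L n) E F))"
    using carrier_quotient[OF baer(2,3)] st by (simp add: baer_sum_def)
  moreover have "proj (baer_sum (L n) E F) (?N +>\<^bsub>?P\<^esub> (s, t)) = basis_vec (n - 2) 0"
    using baer(4)[OF st] s by simp
  ultimately show ?thesis by (intro x_coefficientI[OF baer(1)])
qed

lemma kscale_L_hom:
  "kscale (L n) c \<in> module_hom jordan_double (L n :: ('k::field_char_0 jordan_double, _) module) (L n)"
proof -
  interpret A: double_module "L n :: ('k jordan_double, _) module" by (rule double_module_L)
  have commute: "act (L n) (scalar c) (act (L n) p x) = act (L n) p (act (L n) (scalar c) x)"
    if "x \<in> carrier (L n)" for p x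
    using scalar_central[of c p] that by (simp only: A.act_mult[symmetric])
  show ?thesis
    unfolding kscale_act[abs_def]
    by (rule module_homI_act[OF double_module_L double_module_L]) (simp_all add: A.act_add commute)
qed

text \<open>
  For a lift \<open>s\<close>, \<open>x\<close> maps the class of \<open>(0, s)\<close> to that of
  \<open>(0, c z\<^sub>n\<^sub>,\<^sub>2)\<close>, which modulo the pushout relations is that of
  \<open>(d c z\<^sub>n\<^sub>,\<^sub>2, 0)\<close>.
\<close>

lemma x_coefficient_pushout:
  fixes E :: "('k::field_char_0, 's) weight_extension"
  assumes E: "is_extension jordan_double (L n) (L (n - 2)) E" and c: "x_coefficient n E c"
  shows "x_coefficient n (pushout_extension (L n) (kscale (L n) d) E) (d * c)"
proof -
  interpret S: double_module "middle E" by (rule double_module_extension(1)[OF E])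
  interpret A: double_module "L n :: ('k jordan_double, _) module" by (rule double_module_L)
  note e = is_extensionD[OF E]
  obtain s where s: "s \<in> carrier (middle E)" "proj E s = basis_vec (n - 2) 0"
    "act (middle E) (gen X) s = incl E (\<lambda>i. c * basis_vec n 2 i)"
    by (rule x_coefficientE[OF E c])
  let ?h = "kscale (L n) d"
  let ?P = "direct_sum (L n) (middle E)" and ?N = "pushout_relations (L n) ?h E"
    and ?E = "pushout_extension (L n) ?h E"
  have P: "left_module jordan_double ?P" by (intro left_module_direct_sum e)
  note push = is_extension_pushout[OF E kscale_L_hom]
  let ?a = "\<lambda>i. (- c) * basis_vec n 2 i" and ?b = "\<lambda>i. (d * c) * basis_vec n 2 i"
  have st: "(\<zero>\<^bsub>L n\<^esub>, s) \<in> carrier ?P" using s by (simp add: direct_sum_def)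
  have inP: "(?b, \<zero>\<^bsub>middle E\<^esub>) \<in> carrier ?P" by (simp add: direct_sum_def)
  have "(\<zero>\<^bsub>L n\<^esub>, incl E (\<lambda>i. c * basis_vec n 2 i))
      = (?h ?a, \<ominus>\<^bsub>middle E\<^esub> incl E ?a) \<oplus>\<^bsub>?P\<^esub> (?b, \<zero>\<^bsub>middle E\<^esub>)"
  proof -
    have "\<ominus>\<^bsub>L n\<^esub> ?a = (\<lambda>i. c * basis_vec n 2 i)"
      using L_uminus[OF scaled_basis_vec_closed, of n "- c" 2] by simp
    moreover have "?h ?a \<oplus>\<^bsub>L n\<^esub> ?b = \<zero>\<^bsub>L n\<^esub>"
      using act_L_scalar[OF scaled_basis_vec_closed, of n d "- c" 2]
      by (simp add: kscale_act L_simps(2,3))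
    ultimately show ?thesis
      using module_hom_uminus[OF e(1,2,4), of ?a] e(8)[of "\<lambda>i. c * basis_vec n 2 i"]
      by (simp only: scaled_basis_vec_closed) (simp add: direct_sum_def)
  qed
  moreover have "(?h ?a, \<ominus>\<^bsub>middle E\<^esub> incl E ?a) \<in> ?N"
    unfolding pushout_relations_def by (rule imageI) (rule scaled_basis_vec_closed)
  moreover have "act ?P (gen X) (\<zero>\<^bsub>L n\<^esub>, s) \<in> carrier ?P"
    using double_module.act_closed[of ?P "(\<zero>\<^bsub>L n\<^esub>, s)"] P st by (simp add: double_module_def)
  ultimately have "?N +>\<^bsub>?P\<^esub> act ?P (gen X) (\<zero>\<^bsub>L n\<^esub>, s) = ?N +>\<^bsub>?P\<^esub> (?b, \<zero>\<^bsub>middle E\<^esub>)"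
    using coset_eq_iff[OF P push(2) _ inP] by (auto simp: act_direct_sum s(3))
  then have "act (middle ?E) (gen X) (?N +>\<^bsub>?P\<^esub> (\<zero>\<^bsub>L n\<^esub>, s)) = incl ?E ?b"
    using act_quotient[OF P push(2) st] by (simp add: pushout_extension_def)
  moreover have "?N +>\<^bsub>?P\<^esub> (\<zero>\<^bsub>L n\<^esub>, s) \<in> carrier (middle ?E)"
    using carrier_quotient[OF P push(2)] st by (simp add: pushout_extension_def)
  moreover have "proj ?E (?N +>\<^bsub>?P\<^esub> (\<zero>\<^bsub>L n\<^esub>, s)) = basis_vec (n - 2) 0"
    using push(3)[OF st] s by simp
  ultimately show ?thesis by (intro x_coefficientI[OF push(1)])
qed

section \<open>Modules of coordinate functions\<close>

definition rep_free ::
    "(generator \<Rightarrow> ('i \<Rightarrow> 'k) \<Rightarrow> 'i \<Rightarrow> 'k) \<Rightarrow> 'k::field free_alg \<Rightarrow> ('i \<Rightarrow> 'k) \<Rightarrow> 'i \<Rightarrow> 'k" where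
  "rep_free \<rho> p s =
     (\<lambda>i. \<Sum>w\<in>Poly_Mapping.keys p. Poly_Mapping.lookup p w * foldr \<rho> (letters w) s i)"

text \<open>
  The multiplicativity of the evaluation of polynomials at a family of operators depends only on
  their linearity. It is kept apart from the relations, because it reduces these to identities
  between composed operators.
\<close>

locale coordinate_operators =
  fixes \<rho> :: "generator \<Rightarrow> ('i \<Rightarrow> 'k) \<Rightarrow> 'i \<Rightarrow> 'k::field_char_0"
  assumes rho_add: "\<rho> a (\<lambda>i. s i + t i) = (\<lambda>i. \<rho> a s i + \<rho> a t i)"
    and rho_scale: "\<rho> a (\<lambda>i. c * s i) = (\<lambda>i. c * \<rho> a s i)"
begin

abbreviation "eval \<equiv> rep_free \<rho>"

lemma rep_add: "eval (p + q) s = (\<lambda>i. eval p s i + eval q s i)"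
proof
  fix i
  let ?K = "Poly_Mapping.keys p \<union> Poly_Mapping.keys q"
  let ?w = "\<lambda>r w. Poly_Mapping.lookup r w * foldr \<rho> (letters w) s i"
  have *: "eval r s i = (\<Sum>w\<in>?K. ?w r w)" if "Poly_Mapping.keys r \<subseteq> ?K" for r
    unfolding rep_free_def using that
    by (intro sum.mono_neutral_left) (auto simp: in_keys_iff)
  show "eval (p + q) s i = eval p s i + eval q s i"
    by (subst (1 2 3) *)
       (use Poly_Mapping.keys_add[of p q] in \<open>auto simp: lookup_add distrib_right sum.distrib\<close>)
qed

lemma rep_single: "eval (Poly_Mapping.single w c) s = (\<lambda>i. c * foldr \<rho> (letters w) s i)"
  by (cases "c = 0") (auto simp: rep_free_def)

lemma rep_gen: "eval (gen a) s = \<rho> a s"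
  by (simp add: gen_def rep_single)

lemma rep_scalar: "eval (scalar c) s = (\<lambda>i. c * s i)"
  by (simp add: scalar_def rep_single zero_free_monoid_def)

lemma rep_one: "eval 1 s = s"
  using rep_scalar[of 1 s] by (simp add: scalar_hom)

lemma rho_word_linear:
  "foldr \<rho> w (\<lambda>i. s i + t i) = (\<lambda>i. foldr \<rho> w s i + foldr \<rho> w t i)"
  "foldr \<rho> w (\<lambda>i. c * s i) = (\<lambda>i. c * foldr \<rho> w s i)"
  by (induction w) (simp_all add: rho_add rho_scale)

lemma rep_linear:
  "eval p (\<lambda>i. s i + t i) = (\<lambda>i. eval p s i + eval p t i)"
  "eval p (\<lambda>i. c * s i) = (\<lambda>i. c * eval p s i)"
  by (auto simp: rep_free_def rho_word_linear distrib_left sum.distrib sum_distrib_left ac_simps)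

lemma rep_zero: "eval p (\<lambda>i. 0) = (\<lambda>i. 0)" "eval 0 s = (\<lambda>i. 0)"
  using rep_linear(2)[of p 0 "\<lambda>i. 0"] by (auto simp: rep_free_def)

lemma rep_mult: "eval (p * q) s = eval p (eval q s)"
proof (induction p rule: free_alg_induct)
  case (single v c)
  show ?case
  proof (induction q rule: free_alg_induct)
    case (single w d)
    then show ?case
      by (simp add: mult_single rep_single plus_free_monoid_def rho_word_linear mult.assoc)
  next
    case (sum q1 q2)
    then show ?case by (simp add: distrib_left rep_add rep_linear)
  qed
next
  case (sum p1 p2)
  then show ?case by (simp add: distrib_right rep_add)
qed

lemma rep_uminus: "eval (- p) s = (\<lambda>i. - eval p s i)"
  using rep_add[of p "- p" s] by (simp add: rep_zero fun_eq_iff eq_neg_iff_add_eq_0 add.commute)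

lemma rep_diff: "eval (p - q) s = (\<lambda>i. eval p s i - eval q s i)"
  using rep_add[of p "- q" s] by (simp add: rep_uminus)

lemma rep_two: "eval 2 s = (\<lambda>i. 2 * s i)"
  using rep_add[of 1 1 s] by (simp add: rep_one)

end

locale coordinate_rep = coordinate_operators \<rho>
  for \<rho> :: "generator \<Rightarrow> ('i \<Rightarrow> 'k) \<Rightarrow> 'i \<Rightarrow> 'k::field_char_0" +
  fixes C :: "('i \<Rightarrow> 'k) set"
  assumes C_zero: "(\<lambda>i. 0) \<in> C"
    and C_add: "s \<in> C \<Longrightarrow> t \<in> C \<Longrightarrow> (\<lambda>i. s i + t i) \<in> C"
    and C_scale: "s \<in> C \<Longrightarrow> (\<lambda>i. c * s i) \<in> C"
    and C_rho: "s \<in> C \<Longrightarrow> \<rho> a s \<in> C"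
    and relations: "s \<in> C \<Longrightarrow> (l, r) \<in> jordan_relations \<Longrightarrow> rep_free \<rho> l s = rep_free \<rho> r s"
begin

lemma rep_closed: "s \<in> C \<Longrightarrow> eval p s \<in> C"
proof (induction p rule: free_alg_induct)
  case (single w c)
  then have "foldr \<rho> ws s \<in> C" for ws by (induction ws) (simp_all add: C_rho)
  then show ?case by (simp add: rep_single C_scale)
qed (simp add: rep_add C_add)

lemma rep_ideal: "p \<in> jordan_ideal \<Longrightarrow> s \<in> C \<Longrightarrow> eval p s = (\<lambda>i. 0)"
proof (induction p arbitrary: s rule: jordan_ideal_induct)
  case (relation l r)
  then show ?case by (simp add: rep_diff relations)
qed (simp_all add: rep_zero rep_add rep_mult rep_closed)

definition rep_module :: "('k jordan_double, 'i \<Rightarrow> 'k) module" where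
  "rep_module = \<lparr>carrier = C, mult = undefined, one = undefined, zero = (\<lambda>i. 0),
     add = (\<lambda>s t i. s i + t i), smult = (\<lambda>d. eval (SOME p. p \<in> d))\<rparr>"

lemma act_rep_module: "s \<in> C \<Longrightarrow> act rep_module p s = eval p s"
proof -
  assume s: "s \<in> C"
  interpret ideal "jordan_ideal :: 'k free_alg set" class_ring by (rule ideal_jordan_ideal)
  let ?q = "SOME q. q \<in> residue_class p"
  have "p \<in> residue_class p"
    unfolding residue_class_def by (intro a_rcos_self) auto
  then have "?q \<in> residue_class p" by (rule someI)
  then obtain h where "h \<in> jordan_ideal" "?q = h + p"
    unfolding residue_class_def a_r_coset_def r_coset_def by auto
  then show ?thesis
    using s by (simp add: act_def rep_module_def rep_add rep_ideal)
qed

lemma double_module_rep: "double_module rep_module"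
proof -
  have sm: "residue_class p \<odot>\<^bsub>rep_module\<^esub> s = eval p s" if "s \<in> C" for p s
    using act_rep_module[OF that] by (simp add: act_def)
  have "abelian_group rep_module"
  proof (rule abelian_groupI)
    fix s assume "s \<in> carrier rep_module"
    then show "\<exists>t\<in>carrier rep_module. t \<oplus>\<^bsub>rep_module\<^esub> s = \<zero>\<^bsub>rep_module\<^esub>"
      using C_scale[of s "- 1"] by (intro bexI[of _ "\<lambda>i. - s i"]) (auto simp: rep_module_def)
  qed (auto simp: rep_module_def add_ac C_zero C_add)
  moreover have "carrier rep_module = C" "s \<oplus>\<^bsub>rep_module\<^esub> t = (\<lambda>i. s i + t i)" for s t
    by (simp_all add: rep_module_def)
  ultimately show ?thesis
    unfolding double_module_def
    by (intro left_module.intro left_module_axioms.intro ring_jordan_double)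
      (auto elim!: carrier_jordan_doubleE simp: residue_class_hom sm rep_closed rep_add rep_linear
        rep_mult rep_one C_add)
qed

end

section \<open>The model extensions\<close>

text \<open>
  The operators of the model on \<open>L(m + 2) \<oplus> L(m)\<close>, whose summands are indexed
  by \<open>Inl\<close> and \<open>Inr\<close>. The \<open>sl\<^sub>2\<close> of
  \<open>\<xi>\<close>, \<open>y\<close> and \<open>v + \<xi> u / 2\<close> acts diagonally, and
  the second summand in the row of \<open>V\<close> is that of \<open>- \<xi> u / 2\<close>. The
  parts of \<open>x\<close>, \<open>g - 1\<close> and \<open>u\<close> that map
  \<open>L(m)\<close> to \<open>L(m + 2)\<close> are the weight vectors of the copy of the adjoint
  representation in \<open>Hom(L(m), L(m + 2))\<close>, scaled by \<open>\<kappa>\<close>. At the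
  ends of the weight strings most bounds are enforced by a linear factor that vanishes there.
\<close>

definition model_gen :: "nat \<Rightarrow> 'k::field_char_0 \<Rightarrow> generator \<Rightarrow> (nat + nat \<Rightarrow> 'k) \<Rightarrow> nat + nat \<Rightarrow> 'k" where
  "model_gen m \<kappa> a s = (case a of
      Xi \<Rightarrow> case_sum (\<lambda>i. (of_nat m + 2 - 2 * of_nat i) * s (Inl i))
              (\<lambda>j. (of_nat m - 2 * of_nat j) * s (Inr j))
    | Y \<Rightarrow> case_sum (\<lambda>i. if 1 \<le> i \<and> i \<le> m + 2 then s (Inl (i - 1)) else 0)
             (\<lambda>j. if 1 \<le> j \<and> j \<le> m then s (Inr (j - 1)) else 0)
    | V \<Rightarrow> case_sum
             (\<lambda>i. (of_nat i + 1) * (of_nat m + 2 - of_nat i) / 2 * s (Inl (i + 1)) +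
                \<kappa> * (of_nat m + 2 - 2 * of_nat i) * (of_nat m + 2 - of_nat i) *
                  (of_nat m + 1 - of_nat i) / 4 * s (Inr i))
             (\<lambda>j. (of_nat j + 1) * (of_nat m - of_nat j) / 2 * s (Inr (j + 1)))
    | X \<Rightarrow> case_sum (\<lambda>i. if 2 \<le> i then \<kappa> * s (Inr (i - 2)) else 0) (\<lambda>j. 0)
    | U \<Rightarrow> case_sum (\<lambda>i. - (\<kappa> * (of_nat m + 2 - of_nat i) * (of_nat m + 1 - of_nat i) / 2 * s (Inr i)))
             (\<lambda>j. 0)
    | G \<Rightarrow> case_sum
             (\<lambda>i. s (Inl i) - (if 1 \<le> i then \<kappa> * (of_nat m + 2 - of_nat i) * s (Inr (i - 1)) else 0))
             (\<lambda>j. s (Inr j))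
    | Ginv \<Rightarrow> case_sum
             (\<lambda>i. s (Inl i) + (if 1 \<le> i then \<kappa> * (of_nat m + 2 - of_nat i) * s (Inr (i - 1)) else 0))
             (\<lambda>j. s (Inr j)))"

definition model_carrier :: "nat \<Rightarrow> (nat + nat \<Rightarrow> 'k::field) set" where
  "model_carrier m = {s. (\<forall>i>m + 2. s (Inl i) = 0) \<and> (\<forall>j>m. s (Inr j) = 0)}"

text \<open>
  The operators look back by at most two indices in the first and one in the second summand, so
  after this case distinction the relations are polynomial identities.
\<close>

lemma model_ext:
  assumes "f (Inl 0) = h (Inl 0)" "f (Inl (Suc 0)) = h (Inl (Suc 0))"
    and "\<And>i. f (Inl (Suc (Suc i))) = h (Inl (Suc (Suc i)))"
    and "f (Inr 0) = h (Inr 0)" "\<And>j. f (Inr (Suc j)) = h (Inr (Suc j))"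
  shows "f = h"
proof
  fix i show "f i = h i"
    using assms by (cases i) (metis nat.exhaust)+
qed

lemma model_gen_linear:
  "model_gen m \<kappa> a (\<lambda>i. s i + t i) = (\<lambda>i. model_gen m \<kappa> a s i + model_gen m \<kappa> a t i)"
  "model_gen m \<kappa> a (\<lambda>i. c * s i) = (\<lambda>i. c * model_gen m \<kappa> a s i)"
  by (cases a; rule model_ext; simp add: model_gen_def ring_distribs add_divide_distrib mult_ac diff_divide_distrib)+

lemma model_gen_closed:
  assumes "s \<in> model_carrier m" shows "model_gen m \<kappa> a s \<in> model_carrier m"
  using assms by (cases a) (simp_all add: model_gen_def model_carrier_def)

lemma model_relations:
  fixes s :: "nat + nat \<Rightarrow> 'k::field_char_0" and \<kappa> :: 'k
  assumes s: "s \<in> model_carrier m"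
  defines "\<rho> \<equiv> model_gen m \<kappa>"
  shows "\<rho> G (\<rho> Ginv s) = s" (is ?r1) "\<rho> Ginv (\<rho> G s) = s" (is ?r2)
    "\<rho> Xi (\<rho> G s) = \<rho> G (\<rho> Xi s)" (is ?r3)
    "\<rho> G (\<rho> X s) = \<rho> X (\<rho> G s)" (is ?r4)
    "\<rho> G (\<rho> Y s) = (\<lambda>i. \<rho> Y (\<rho> G s) i + \<rho> X (\<rho> G s) i)" (is ?r5)
    "\<rho> Xi (\<rho> Y s) = (\<lambda>i. \<rho> Y (\<rho> Xi s) i - 2 * \<rho> Y s i)" (is ?r6)
    "\<rho> Xi (\<rho> X s) = (\<lambda>i. \<rho> X (\<rho> Xi s) i - 2 * \<rho> X s i)" (is ?r7)
    "\<rho> U (\<rho> G s) = \<rho> G (\<rho> U s)" (is ?r8)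
    "\<rho> V (\<rho> G s) = (\<lambda>i. \<rho> G (\<rho> V s) i + \<rho> G (\<rho> U s) i)" (is ?r9)
    "\<rho> V (\<rho> Xi s) = (\<lambda>i. \<rho> Xi (\<rho> V s) i - 2 * \<rho> V s i)" (is ?r10)
    "\<rho> U (\<rho> Xi s) = (\<lambda>i. \<rho> Xi (\<rho> U s) i - 2 * \<rho> U s i)" (is ?r11)
    "\<rho> Y (\<rho> X s) = (\<lambda>i. \<rho> X (\<rho> Y s) i - 1 / 2 * \<rho> X (\<rho> X s) i)" (is ?r12)
    "\<rho> V (\<rho> U s) = (\<lambda>i. \<rho> U (\<rho> V s) i - 1 / 2 * \<rho> U (\<rho> U s) i)" (is ?r13)
    "\<rho> U (\<rho> X s) = \<rho> X (\<rho> U s)" (is ?r14)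
    "\<rho> V (\<rho> X s) = (\<lambda>i. \<rho> X (\<rho> V s) i + (s i - \<rho> G s i) + \<rho> X (\<rho> U s) i)" (is ?r15)
    "\<rho> U (\<rho> Y s) = (\<lambda>i. \<rho> Y (\<rho> U s) i + (s i - \<rho> G s i))" (is ?r16)
    "\<rho> V (\<rho> Y s) = (\<lambda>i. \<rho> Y (\<rho> V s) i + 1 / 2 * \<rho> G (\<rho> Xi s) i + \<rho> Y (\<rho> U s) i)" (is ?r17)
proof -
  have s1: "s (Inl i) = 0" if "\<not> i \<le> m + 2" for i using s that by (simp add: model_carrier_def)
  have s2: "s (Inr i) = 0" if "\<not> i \<le> m" for i using s that by (simp add: model_carrier_def)
  note simps = \<rho>_def model_gen_def s1 s2 field_simps
  show ?r1
    by (rule model_ext; simp add: simps)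
  show ?r2
    by (rule model_ext; simp add: simps)
  show ?r3
    by (rule model_ext; simp add: simps)
  show ?r4
    by (rule model_ext; simp add: simps)
  show ?r5
    by (rule model_ext; simp add: simps)
  show ?r6
    by (rule model_ext; simp add: simps)
  show ?r7
    by (rule model_ext; simp add: simps)
  show ?r8
    by (rule model_ext; simp add: simps)
  show ?r9
    by (rule model_ext; simp add: simps)
  show ?r10
    by (rule model_ext; simp add: simps)
  show ?r11
    by (rule model_ext; simp add: simps)
  show ?r12
    by (rule model_ext; simp add: simps)
  show ?r13
    by (rule model_ext; simp add: simps)
  show ?r14
    by (rule model_ext; simp add: simps)
  show ?r15
    by (rule model_ext; simp add: simps)
  show ?r16
    by (rule model_ext; simp add: simps) (auto simp: not_less_eq_eq le_Suc_eq simps)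
  show ?r17
    by (rule model_ext; simp add: simps) (auto simp: not_less_eq_eq le_Suc_eq simps)
qed

lemma model_coordinate_rep: "coordinate_rep (model_gen m \<kappa>) (model_carrier m)"
proof
  fix s :: "nat + nat \<Rightarrow> 'a" and l r :: "'a free_alg"
  assume s: "s \<in> model_carrier m" and lr: "(l, r) \<in> jordan_relations"
  interpret pre: coordinate_operators "model_gen m \<kappa>"
    by standard (simp_all add: model_gen_linear)
  note simps = pre.rep_add pre.rep_diff pre.rep_mult pre.rep_gen pre.rep_scalar pre.rep_one
    pre.rep_two
  note rel = model_relations[OF s, of \<kappa>]
  have "\<forall>p\<in>jordan_relations. pre.eval (fst p) s = pre.eval (snd p) s"
    unfolding jordan_relations_def Let_def ball_simps fst_conv snd_conv power2_eq_square simps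
    by (intro conjI TrueI rel)
  then show "pre.eval l s = pre.eval r s" using lr by fastforce
qed (simp_all add: model_gen_linear model_gen_closed, simp_all add: model_carrier_def)

interpretation model: coordinate_rep "model_gen m \<kappa>" "model_carrier m" for m \<kappa>
  by (rule model_coordinate_rep)

abbreviation "model m \<kappa> \<equiv> model.rep_module m \<kappa>"

(* With these rules m + 2 would become Suc (Suc m), also inside L (m + 2). *)
declare add_2_eq_Suc [simp del] add_2_eq_Suc' [simp del]

text \<open>
  This is the short five lemma: a morphism of extensions that is the identity on both ends is
  bijective.
\<close>

lemma equivalent_extensionsI:
  assumes E: "is_extension R A B E" and F: "is_extension R A B F"
    and \<phi>: "\<phi> \<in> module_hom R (middle E) (middle F)"
    and i: "\<And>a. a \<in> carrier A \<Longrightarrow> \<phi> (incl E a) = incl F a"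
    and p: "\<And>s. s \<in> carrier (middle E) \<Longrightarrow> proj F (\<phi> s) = proj E s"
  shows "equivalent_extensions R A E F"
proof -
  note e = is_extensionD[OF E] and f = is_extensionD[OF F] and h = module_homD[OF \<phi>]
  interpret A: left_module R A by (rule e)
  interpret B: left_module R B by (rule e)
  interpret S: left_module R "middle E" by (rule e)
  interpret T: left_module R "middle F" by (rule f)
  have "inj_on \<phi> (carrier (middle E))"
  proof (rule inj_onI)
    fix s t assume s: "s \<in> carrier (middle E)" and t: "t \<in> carrier (middle E)" and st: "\<phi> s = \<phi> t"
    let ?d = "s \<oplus>\<^bsub>middle E\<^esub> \<ominus>\<^bsub>middle E\<^esub> t"
    have d: "?d \<in> carrier (middle E)" using s t by simp
    have \<phi>d: "\<phi> ?d = \<zero>\<^bsub>middle F\<^esub>"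
      using s t st h(1)[OF t] by (simp add: h(2) module_hom_uminus[OF e(2) f(2) \<phi>] T.M.r_neg)
    then have "proj E ?d = \<zero>\<^bsub>B\<^esub>" using p[OF d] module_hom_0[OF f(2,3,6)] by simp
    then obtain a where a: "a \<in> carrier A" "?d = incl E a" by (rule is_extension_kernel[OF E d])
    then have "incl F a = incl F \<zero>\<^bsub>A\<^esub>" using i \<phi>d module_hom_0[OF f(1,2,4)] by simp
    then have "a = \<zero>\<^bsub>A\<^esub>" by (rule inj_onD[OF f(5)]) (use a in simp_all)
    then have "?d = \<zero>\<^bsub>middle E\<^esub>" using a module_hom_0[OF e(1,2,4)] by simp
    then show "s = t" using s t S.M.minus_equality[of s "\<ominus>\<^bsub>middle E\<^esub> t"] by simp
  qed
  moreover have "t \<in> \<phi> ` carrier (middle E)" if t: "t \<in> carrier (middle F)" for t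
  proof -
    obtain s where s: "s \<in> carrier (middle E)" "proj E s = proj F t"
      by (rule is_extension_lift[OF E f(9)[OF t]])
    let ?d = "t \<oplus>\<^bsub>middle F\<^esub> \<ominus>\<^bsub>middle F\<^esub> \<phi> s"
    have d: "?d \<in> carrier (middle F)" using s t h by simp
    have "proj F ?d = \<zero>\<^bsub>B\<^esub>"
      using s t h(1)[OF s(1)] f(9)[OF t] p[OF s(1)]
      by (simp add: module_homD(2)[OF f(6)] module_hom_uminus[OF f(2,3,6)] B.M.r_neg)
    then obtain a where a: "a \<in> carrier A" "?d = incl F a" by (rule is_extension_kernel[OF F d])
    have "t = ?d \<oplus>\<^bsub>middle F\<^esub> \<phi> s" using s t h(1)[OF s(1)] by (simp add: T.M.a_assoc T.M.l_neg)
    also have "\<dots> = \<phi> (incl E a \<oplus>\<^bsub>middle E\<^esub> s)" using a s i e(8) h(2) by simp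
    finally show ?thesis using a s e(8) by blast
  qed
  ultimately have "bij_betw \<phi> (carrier (middle E)) (carrier (middle F))"
    using h(1) by (auto simp: bij_betw_def)
  then show ?thesis
    unfolding equivalent_extensions_def module_iso_def using \<phi> i p by blast
qed

lemma cls_scalar_simps:
  "cls (scalar 2) = (2 :: 'k::field_char_0 double_alg)"
  "cls (scalar (- 2)) = (- 2 :: 'k double_alg)"
proof -
  have 2: "scalar 2 = (2 :: 'k free_alg)" using scalar_hom(1)[of "1 :: 'k" 1] by (simp add: scalar_hom)
  show "cls (scalar 2) = (2 :: 'k double_alg)" by (simp add: 2 cls_two)
  show "cls (scalar (- 2)) = (- 2 :: 'k double_alg)" by (simp add: 2 cls_two cls_hom scalar_hom(3))
qed

definition raising :: "'k::field free_alg" where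
  "raising = gen V + scalar (1 / 2) * gen Xi * gen U"

context double_module
begin

text \<open>
  The relations of the double as rules for moving one operator past another. Those that involve
  \<open>1 - g\<close> are written as equalities of sums.
\<close>

lemma act_relations:
  assumes t: "t \<in> carrier M"
  shows "act M (gen Xi) (act M (gen Y) t) = act M (gen Y) (act M (gen Xi) t) \<oplus> act M (scalar (- 2)) (act M (gen Y) t)" (is ?r1)
    "act M (gen Xi) (act M (gen X) t) = act M (gen X) (act M (gen Xi) t) \<oplus> act M (scalar (- 2)) (act M (gen X) t)" (is ?r2)
    "act M (gen X) (act M (gen Y) t) = act M (gen Y) (act M (gen X) t) \<oplus> act M (scalar (1 / 2)) (act M (gen X) (act M (gen X) t))" (is ?r3)
    "act M (gen G) (act M (gen Y) t) = act M (gen Y) (act M (gen G) t) \<oplus> act M (gen X) (act M (gen G) t)" (is ?r4)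
    "act M (gen V) (act M (gen X) t) \<oplus> act M (gen G) t = act M (gen X) (act M (gen V) t) \<oplus> t \<oplus> act M (gen X) (act M (gen U) t)" (is ?r5)
    "act M (gen V) (act M (gen G) t) = act M (gen G) (act M (gen V) t) \<oplus> act M (gen G) (act M (gen U) t)" (is ?r6)
    "act M (gen U) (act M (gen Y) t) \<oplus> act M (gen G) t = act M (gen Y) (act M (gen U) t) \<oplus> t" (is ?r7)
    "act M raising (act M (gen Y) t) = act M (gen Y) (act M raising t) \<oplus> act M (scalar (1 / 2)) (act M (gen Xi) t)" (is ?r8)
    "act M (gen Xi) (act M raising t) = act M raising (act M (gen Xi) t) \<oplus> act M (scalar 2) (act M raising t)" (is ?r9)
    "act M raising t = act M (gen V) t \<oplus> act M (scalar (1 / 2)) (act M (gen Xi) (act M (gen U) t))" (is ?r10)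
    "act M (gen Ginv) (act M (gen G) t) = t" (is ?r11)
proof -
  note s = act_mult act_add_left t act_closed
  have raising: "cls raising = cls (gen V) + cls (scalar (1 / 2)) * cls (gen Xi) * cls (gen U)"
    by (simp add: raising_def cls_hom)
  show ?r1
    using act_cong[of "gen Xi * gen Y" "gen Y * gen Xi + scalar (- 2) * gen Y" t]
    by (simp add: s cls_hom cls_scalar_simps defining_relations)
  show ?r2
    using act_cong[of "gen Xi * gen X" "gen X * gen Xi + scalar (- 2) * gen X" t]
    by (simp add: s cls_hom cls_scalar_simps defining_relations)
  show ?r3
    using act_cong[of "gen X * gen Y" "gen Y * gen X + scalar (1 / 2) * gen X * gen X" t]
    by (simp add: s cls_hom defining_relations power2_eq_square mult.assoc)
  show ?r4
    using act_cong[of "gen G * gen Y" "gen Y * gen G + gen X * gen G" t]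
    by (simp add: s cls_hom defining_relations)
  show ?r5
    using act_cong[of "gen V * gen X + gen G" "gen X * gen V + 1 + gen X * gen U" t]
    by (simp add: s cls_hom defining_relations)
  show ?r6
    using act_cong[of "gen V * gen G" "gen G * gen V + gen G * gen U" t]
    by (simp add: s cls_hom defining_relations)
  show ?r7
    using act_cong[of "gen U * gen Y + gen G" "gen Y * gen U + 1" t]
    by (simp add: s cls_hom defining_relations)
  show ?r8
    using act_cong[of "raising * gen Y" "gen Y * raising + scalar (1 / 2) * gen Xi" t]
    by (simp add: s cls_hom raising sl2_relations)
  show ?r9
    using act_cong[of "gen Xi * raising" "raising * gen Xi + scalar 2 * raising" t]
    by (simp add: s cls_hom raising sl2_relations cls_scalar_simps)
  show ?r10
    by (simp add: raising_def s mult.assoc)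
  show ?r11
    using act_cong[of "gen Ginv * gen G" 1 t]
    by (simp add: s cls_hom defining_relations)
qed

lemma act_scalar_commute:
  assumes "t \<in> carrier M"
  shows "act M p (act M (scalar c) t) = act M (scalar c) (act M p t)"
  using scalar_central[of c p] assms by (simp only: act_mult[symmetric])

lemma act_scalar_simps:
  assumes "t \<in> carrier M"
  shows "act M (scalar c) (act M (scalar d) t) = act M (scalar (c * d)) t"
    "act M (scalar c) t \<oplus> act M (scalar d) t = act M (scalar (c + d)) t"
    "act M (scalar 1) t = t" "act M (scalar 0) t = \<zero>"
  using assms by (simp_all add: scalar_hom act_mult act_add_left)

end

definition model_extension ::
    "nat \<Rightarrow> 'k::field_char_0 \<Rightarrow> ('k jordan_double, nat \<Rightarrow> 'k, nat \<Rightarrow> 'k, nat + nat \<Rightarrow> 'k) extension" where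
  "model_extension m \<kappa> =
     \<lparr>middle = model m \<kappa>, incl = (\<lambda>f. case_sum f (\<lambda>j. 0)), proj = (\<lambda>s j. s (Inr j))\<rparr>"

lemma model_simps:
  "s \<in> carrier (model m \<kappa>) \<longleftrightarrow> (\<forall>i>m + 2. s (Inl i) = 0) \<and> (\<forall>j>m. s (Inr j) = 0)"
  "s \<oplus>\<^bsub>model m \<kappa>\<^esub> t = (\<lambda>i. s i + t i)"
  "\<zero>\<^bsub>model m \<kappa>\<^esub> = (\<lambda>i. 0)"
  by (simp_all add: model.rep_module_def) (simp add: model_carrier_def)

lemma act_model:
  assumes "s \<in> carrier (model m \<kappa>)"
  shows "act (model m \<kappa>) (gen a) s = model_gen m \<kappa> a s"
    "act (model m \<kappa>) (scalar c) s = (\<lambda>i. c * s i)"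
proof -
  have "s \<in> model_carrier m" using assms by (simp add: model.rep_module_def)
  then show "act (model m \<kappa>) (gen a) s = model_gen m \<kappa> a s"
    "act (model m \<kappa>) (scalar c) s = (\<lambda>i. c * s i)"
    by (simp_all only: model.act_rep_module model.rep_gen model.rep_scalar)
qed

lemma is_extension_model:
  "is_extension jordan_double (L (m + 2)) (L m) (model_extension m \<kappa> ::
     ('k::field_char_0 jordan_double, _, _, _) extension)"
proof -
  let ?i = "\<lambda>f :: nat \<Rightarrow> 'k. case_sum f (\<lambda>j :: nat. 0 :: 'k)"
  let ?p = "\<lambda>(s :: nat + nat \<Rightarrow> 'k) j. s (Inr j)"
  have iC: "?i f \<in> carrier (model m \<kappa>)" if "f \<in> carrier (L (m + 2))" for f
    using that by (simp add: model_simps(1) L_simps(1))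
  have pC: "?p s \<in> carrier (L m)" if "s \<in> carrier (model m \<kappa>)" for s
    using that by (simp add: model_simps(1) L_simps(1))
  have "?i \<in> module_hom jordan_double (L (m + 2)) (model m \<kappa>)"
  proof (rule module_homI_act[OF double_module_L model.double_module_rep])
    fix f :: "nat \<Rightarrow> 'k" and a assume f: "f \<in> carrier (L (m + 2))"
    have f0: "f i = 0" if "\<not> i \<le> m + 2" for i using f that by (simp add: L_simps(1))
    have "?i (L_gen (m + 2) a f) = model_gen m \<kappa> a (?i f)"
    proof -
      have "\<forall>i>m + 2. f i = 0" using f by (simp only: L_simps(1))
      note L_gen_eq[OF this]
      then show ?thesis
        by (cases a; intro model_ext; simp add: model_gen_def f0 not_less of_nat_diff field_simps)
    qed
    then show "?i (act (L (m + 2)) (gen a) f) = act (model m \<kappa>) (gen a) (?i f)"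
      using f by (simp add: act_L_gen act_model iC)
  qed (auto simp: iC L_simps(2) model_simps(2) act_L_scalar act_model fun_eq_iff split: sum.splits)
  moreover have "?p \<in> module_hom jordan_double (model m \<kappa>) (L m)"
  proof (rule module_homI_act[OF model.double_module_rep double_module_L])
    fix s :: "nat + nat \<Rightarrow> 'k" and a assume s: "s \<in> carrier (model m \<kappa>)"
    have s0: "s (Inr j) = 0" if "\<not> j \<le> m" for j using s that by (simp add: model_simps(1))
    have "?p (model_gen m \<kappa> a s) = L_gen m a (?p s)"
    proof -
      have "\<forall>j>m. ?p s j = 0" using s unfolding model_simps(1) by blast
      note L_gen_eq[OF this]
      then show ?thesis
        by (cases a) (auto simp: model_gen_def s0 fun_eq_iff not_less of_nat_diff field_simps)
    qed
    then show "?p (act (model m \<kappa>) (gen a) s) = act (L m) (gen a) (?p s)"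
      using s by (simp add: act_L_gen act_model pC)
  qed (auto simp: pC L_simps(2) model_simps(2) act_L_scalar act_model)
  moreover have "inj_on ?i (carrier (L (m + 2)))"
    by (rule inj_onI) (metis (no_types) ext sum.case(1))
  moreover have "h \<in> ?p ` carrier (model m \<kappa>)" if "h \<in> carrier (L m)" for h
    using that by (intro image_eqI[of _ _ "case_sum (\<lambda>i. 0) h"]) (auto simp: model_simps(1) L_simps(1))
  then have "?p ` carrier (model m \<kappa>) = carrier (L m)" using pC by blast
  moreover have "?i ` carrier (L (m + 2)) = {s \<in> carrier (model m \<kappa>). ?p s = \<zero>\<^bsub>L m\<^esub>}"
  proof (intro equalityI subsetI)
    fix s assume "s \<in> {s \<in> carrier (model m \<kappa>). ?p s = \<zero>\<^bsub>L m\<^esub>}"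
    then have s: "s \<in> carrier (model m \<kappa>)" "s (Inr j) = 0" for j
      by (auto simp: L_simps(3) fun_eq_iff)
    then show "s \<in> ?i ` carrier (L (m + 2))"
      by (intro image_eqI[of _ _ "\<lambda>i. s (Inl i)"])
        (auto simp: model_simps(1) L_simps(1) fun_eq_iff split: sum.splits)
  qed (auto simp: iC L_simps(3))
  ultimately show ?thesis
    using left_module_L[of "m + 2", where 'k = 'k] left_module_L[of m, where 'k = 'k]
      double_module.left_module[OF model.double_module_rep[of m \<kappa>]]
    by (simp add: is_extension_def model_extension_def)
qed

lemma x_coefficient_model: "x_coefficient (m + 2) (model_extension m \<kappa>) \<kappa>"
proof (rule x_coefficientI)
  let ?s = "case_sum (\<lambda>i. 0) (basis_vec m 0) :: nat + nat \<Rightarrow> 'a"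
  have s: "?s \<in> carrier (model m \<kappa>)" by (simp add: model_simps(1) basis_vec_def)
  then show "?s \<in> carrier (middle (model_extension m \<kappa>))"
    by (simp add: model_extension_def)
  show "act (middle (model_extension m \<kappa>)) (gen X) ?s
      = incl (model_extension m \<kappa>) (\<lambda>i. \<kappa> * basis_vec (m + 2) 2 i)"
    using s by (simp add: model_extension_def act_model)
      (rule model_ext; simp add: model_gen_def basis_vec_def)
qed (simp_all add: model_extension_def is_extension_model[unfolded model_extension_def])

lemma model_gen_submodule:
  assumes f: "f \<in> carrier (L (m + 2))"
  shows "model_gen m \<kappa> z (case_sum f (\<lambda>j. 0)) = case_sum (L_gen (m + 2) z f) (\<lambda>j. 0 :: 'k::field_char_0)"
proof -
  have hom: "(\<lambda>f. case_sum f (\<lambda>j. 0)) \<in> module_hom jordan_double (L (m + 2)) (model m \<kappa>)"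
    using is_extensionD(4)[OF is_extension_model[of m \<kappa>]] by (simp add: model_extension_def)
  have "case_sum f (\<lambda>j. 0) \<in> carrier (model m \<kappa>)" using module_homD(1)[OF hom f] .
  then show ?thesis
    using module_hom_act[OF hom f, of "gen z"] f by (simp add: act_model act_L_gen)
qed

lemma model_gen_lift:
  fixes \<kappa> :: "'k::field_char_0"
  assumes k: "k \<le> m"
  defines "e \<equiv> case_sum (\<lambda>i. 0) (\<lambda>j. 1 * basis_vec m k j)"
  shows
    "model_gen m \<kappa> Xi e = case_sum (\<lambda>i. 0) (\<lambda>j. (of_nat m - 2 * of_nat k) * basis_vec m k j)"
    "model_gen m \<kappa> Y e = case_sum (\<lambda>i. 0) (\<lambda>j. 1 * basis_vec m (Suc k) j)"
    "model_gen m \<kappa> V e = case_sum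
       (\<lambda>i. (\<kappa> * (of_nat m + 2 - 2 * of_nat k) * (of_nat m + 2 - of_nat k) * (of_nat m + 1 - of_nat k) / 4) *
          basis_vec (m + 2) k i)
       (\<lambda>j. (of_nat k * (of_nat m + 1 - of_nat k) / 2) * basis_vec m (k - 1) j)"
    "model_gen m \<kappa> X e = case_sum (\<lambda>i. \<kappa> * basis_vec (m + 2) (k + 2) i) (\<lambda>j. 0)"
    "model_gen m \<kappa> U e = case_sum
       (\<lambda>i. - (\<kappa> * (of_nat m + 2 - of_nat k) * (of_nat m + 1 - of_nat k) / 2) * basis_vec (m + 2) k i)
       (\<lambda>j. 0)"
    "model_gen m \<kappa> G e = case_sum (\<lambda>i. - (\<kappa> * (of_nat m + 1 - of_nat k)) * basis_vec (m + 2) (Suc k) i)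
       (\<lambda>j. 1 * basis_vec m k j)"
    "model_gen m \<kappa> Ginv e = case_sum (\<lambda>i. (\<kappa> * (of_nat m + 1 - of_nat k)) * basis_vec (m + 2) (Suc k) i)
       (\<lambda>j. 1 * basis_vec m k j)"
  unfolding e_def using k
  by (cases k; auto simp: model_gen_def basis_vec_def fun_eq_iff field_simps split: sum.splits)+

text \<open>
  A vector of the model is its component in \<open>L(m + 2)\<close> plus a combination of the
  basis vectors of \<open>L(m)\<close>. It suffices therefore to compare linear maps on these.
\<close>

lemma model_induct [consumes 1, case_names submodule lift add scale]:
  fixes s :: "nat + nat \<Rightarrow> 'k::field_char_0"
  assumes s: "s \<in> carrier (model m \<kappa>)"
    and submodule: "\<And>f. f \<in> carrier (L (m + 2) :: ('k jordan_double, _) module) \<Longrightarrow> P (case_sum f (\<lambda>j. 0))"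
    and lift: "\<And>k. k \<le> m \<Longrightarrow> P (case_sum (\<lambda>i. 0) (\<lambda>j. 1 * basis_vec m k j))"
    and add: "\<And>s t. s \<in> carrier (model m \<kappa>) \<Longrightarrow> t \<in> carrier (model m \<kappa>) \<Longrightarrow> P s \<Longrightarrow> P t \<Longrightarrow>
      P (\<lambda>i. s i + t i)"
    and scale: "\<And>s c. s \<in> carrier (model m \<kappa>) \<Longrightarrow> P s \<Longrightarrow> P (\<lambda>i. c * s i)"
  shows "P s"
proof -
  let ?s = "\<lambda>k. case_sum (\<lambda>i. s (Inl i)) (\<lambda>j. if j < k then s (Inr j) else 0)"
  have s0: "s (Inl i) = 0" if "m + 2 < i" for i using s that by (simp add: model_simps(1))
  have s1: "s (Inr j) = 0" if "m < j" for j using s that by (simp add: model_simps(1))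
  have "P (?s k)" if "k \<le> Suc m" for k
    using that
  proof (induction k)
    case 0
    then show ?case using submodule[of "\<lambda>i. s (Inl i)"] s0 by (simp add: L_simps(1))
  next
    case (Suc k)
    let ?e = "case_sum (\<lambda>i. 0) (\<lambda>j. 1 * basis_vec m k j) :: nat + nat \<Rightarrow> 'k"
    have e: "?e \<in> carrier (model m \<kappa>)" by (simp add: model_simps(1) basis_vec_def)
    have "P (\<lambda>i. ?s k i + s (Inr k) * ?e i)"
      using Suc e by (intro add scale lift) (auto simp: model_simps(1) s0 s1 basis_vec_def)
    also have "(\<lambda>i. ?s k i + s (Inr k) * ?e i) = ?s (Suc k)"
      using Suc.prems by (auto simp: fun_eq_iff basis_vec_def less_Suc_eq split: sum.splits)
    finally show ?case .
  qed
  from this[of "Suc m"] have "P (?s (Suc m))" by simp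
  also have "?s (Suc m) = s" using s1 by (auto simp: fun_eq_iff split: sum.splits)
  finally show ?thesis .
qed

section \<open>Classification of extensions\<close>

text \<open>
  From here on \<open>S\<close> is an arbitrary extension of \<open>L(m + 2)\<close> by
  \<open>L(m)\<close>. The aim is a lift of \<open>z\<^sub>m\<^sub>,\<^sub>0\<close> that
  generates a copy of \<open>L(m)\<close> for \<open>sl\<^sub>2\<close>; on this copy the
  relations leave only one scalar free.
\<close>

locale L_extension =
  fixes m :: nat and E :: "('k::field_char_0, 's) weight_extension"
  assumes ses: "is_extension jordan_double (L (m + 2)) (L m) E"
begin

abbreviation "S \<equiv> middle E"

sublocale S: double_module "middle E"
  by (rule double_module_extension(1)[OF ses])

abbreviation "\<iota> \<equiv> incl E"

text \<open>
  The vector \<open>c z\<^sub>m\<^sub>+\<^sub>2\<^sub>,\<^sub>k\<close> of the submodule. As a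
  constant of its own it keeps the coefficient and the index visible to rewriting.
\<close>

definition sub_vec :: "'k \<Rightarrow> nat \<Rightarrow> 's" where
  "sub_vec c k = \<iota> (\<lambda>i. c * basis_vec (m + 2) k i)"

lemmas ext_simps = is_extensionD[OF ses]

lemma iota_closed: "f \<in> carrier (L (m + 2)) \<Longrightarrow> \<iota> f \<in> carrier S"
  by (rule ext_simps)

lemma sub_vec_closed [simp, intro]: "sub_vec c k \<in> carrier S"
  unfolding sub_vec_def by (intro iota_closed) simp

lemma iota_zero: "\<iota> (\<lambda>i. 0) = \<zero>\<^bsub>S\<^esub>"
  using module_hom_0[OF ext_simps(1,2,4)] by (simp add: L_simps)

lemma iota_add:
  assumes "f \<in> carrier (L (m + 2))" "h \<in> carrier (L (m + 2))"
  shows "\<iota> f \<oplus>\<^bsub>S\<^esub> \<iota> h = \<iota> (\<lambda>i. f i + h i)"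
  using module_homD(2)[OF ext_simps(4) assms] by (simp add: L_simps)

lemma iota_inj:
  assumes "f \<in> carrier (L (m + 2))" "h \<in> carrier (L (m + 2))" "\<iota> f = \<iota> h"
  shows "f = h"
  using inj_onD[OF ext_simps(5) assms(3,1,2)] .

lemma act_iota:
  assumes "f \<in> carrier (L (m + 2))"
  shows "act S (gen z) (\<iota> f) = \<iota> (L_gen (m + 2) z f)"
    "act S (scalar c) (\<iota> f) = \<iota> (\<lambda>i. c * f i)"
  using module_hom_act[OF ext_simps(4) assms] act_L_gen[OF assms] act_L_scalar[OF assms]
  by metis+

lemma L_gen_in_L: "L_gen (m + 2) z f \<in> carrier (L (m + 2) :: ('k jordan_double, _) module)"
  by (simp add: L_simps L_gen_closed)

lemma proj_act:
  assumes "t \<in> carrier S"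
  shows "proj E (act S (gen z) t) = L_gen m z (proj E t)"
    "proj E (act S (scalar c) t) = (\<lambda>i. c * proj E t i)"
  using module_hom_act[OF ext_simps(6) assms] act_L_gen[OF ext_simps(9)[OF assms]]
    act_L_scalar[OF ext_simps(9)[OF assms]]
  by metis+

lemma proj_add:
  assumes "s \<in> carrier S" "t \<in> carrier S"
  shows "proj E (s \<oplus>\<^bsub>S\<^esub> t) = (\<lambda>i. proj E s i + proj E t i)"
  using module_homD(2)[OF ext_simps(6) assms] by (simp add: L_simps)

lemma proj_iota: "f \<in> carrier (L (m + 2)) \<Longrightarrow> proj E (\<iota> f) = (\<lambda>i. 0)"
  using ext_simps(10) by (simp add: L_simps)

lemma proj_sub_vec: "proj E (sub_vec c k) = (\<lambda>i. 0)"
  by (simp add: sub_vec_def proj_iota)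

lemma kernelE:
  assumes "s \<in> carrier S" "proj E s = (\<lambda>i. 0)"
  obtains f where "f \<in> carrier (L (m + 2))" "s = \<iota> f"
  using is_extension_kernel[OF ses assms(1)] assms(2) by (auto simp: L_simps(3))

lemma L_gen_basis_vec:
  fixes c :: 'k
  shows
  "L_gen n Xi (\<lambda>i. c * basis_vec n k i) = (\<lambda>i. ((of_nat n - 2 * of_nat k) * c) * basis_vec n k i)" (is ?r1)
  "L_gen n Y (\<lambda>i. c * basis_vec n k i) = (\<lambda>i. c * basis_vec n (Suc k) i)" (is ?r2)
  "L_gen n V (\<lambda>i. c * basis_vec n (Suc k) i) =
     (\<lambda>i. ((of_nat k + 1) * (of_nat n - of_nat k) / 2 * c) * basis_vec n k i)" (is ?r3)
  "L_gen n V (\<lambda>i. c * basis_vec n 0 i) = (\<lambda>i. 0)" (is ?r4)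
  "L_gen n X (\<lambda>i. c * basis_vec n k i) = (\<lambda>i. 0)" (is ?r5)
  "L_gen n U (\<lambda>i. c * basis_vec n k i) = (\<lambda>i. 0)" (is ?r6)
  "L_gen n G (\<lambda>i. c * basis_vec n k i) = (\<lambda>i. c * basis_vec n k i)" (is ?r7)
  "L_gen n Ginv (\<lambda>i. c * basis_vec n k i) = (\<lambda>i. c * basis_vec n k i)" (is ?r8)
proof -
  have "\<forall>i>n. c * basis_vec n k i = 0" for k by (simp add: basis_vec_def)
  note g = L_gen_eq[OF this]
  show ?r1 ?r2 ?r3 ?r4 ?r5 ?r6 ?r7 ?r8
    unfolding g by (auto simp: basis_vec_def fun_eq_iff of_nat_diff) (simp_all add: algebra_simps)
qed

lemma act_sub_vec:
  "act S (gen Xi) (sub_vec c k) = sub_vec ((of_nat m + 2 - 2 * of_nat k) * c) k"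
  "act S (gen Y) (sub_vec c k) = sub_vec c (Suc k)"
  "act S (gen V) (sub_vec c (Suc k)) = sub_vec ((of_nat k + 1) * (of_nat m + 2 - of_nat k) / 2 * c) k"
  "act S (gen V) (sub_vec c 0) = \<zero>\<^bsub>S\<^esub>"
  "act S (gen X) (sub_vec c k) = \<zero>\<^bsub>S\<^esub>"
  "act S (gen U) (sub_vec c k) = \<zero>\<^bsub>S\<^esub>"
  "act S (gen G) (sub_vec c k) = sub_vec c k"
  "act S (gen Ginv) (sub_vec c k) = sub_vec c k"
  "act S (scalar d) (sub_vec c k) = sub_vec (d * c) k"
  by (simp_all add: sub_vec_def act_iota L_gen_basis_vec iota_zero mult.assoc)

lemma sub_vec_add: "sub_vec c k \<oplus>\<^bsub>S\<^esub> sub_vec d k = sub_vec (c + d) k"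
  by (simp add: sub_vec_def iota_add distrib_right)

lemma sub_vec_zero: "sub_vec 0 k = \<zero>\<^bsub>S\<^esub>"
  by (simp add: sub_vec_def iota_zero)

lemma act_raising_iota:
  assumes "f \<in> carrier (L (m + 2))"
  shows "act S raising (\<iota> f) = \<iota> (L_gen (m + 2) V f)"
proof -
  have "act S (gen U) (\<iota> f) = \<zero>\<^bsub>S\<^esub>"
    by (rule act_submodule(2)[OF ses assms])
  then show ?thesis
    using S.act_relations(10)[OF iota_closed[OF assms]]
    by (simp add: act_iota[OF assms] iota_closed L_gen_in_L)
qed

lemma proj_raising:
  assumes "t \<in> carrier S"
  shows "proj E (act S raising t) = L_gen m V (proj E t)"
proof -
  have p: "\<forall>i>m. proj E t i = 0" using ext_simps(9)[OF assms] by (simp add: L_simps)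
  have z: "L_gen m Xi (\<lambda>i. 0) = (\<lambda>i. 0 :: 'k)" by (simp add: L_gen_eq)
  show ?thesis
    using assms by (simp add: S.act_relations(10) proj_add proj_act L_gen_eq(5)[OF p] z)
qed

text \<open>
  On \<open>L(m + 2)\<close> the operator \<open>\<xi> - m\<close> is diagonal with entries
  \<open>2 - 2 j\<close>. It can be inverted except at \<open>j = 1\<close>, so a correction from
  the submodule reduces the defect of a lift to a multiple of
  \<open>z\<^sub>m\<^sub>+\<^sub>2\<^sub>,\<^sub>1\<close>.
\<close>

lemma approximate_weight_lift:
  obtains w f where "w \<in> carrier S" "proj E w = basis_vec m 0"
    "act S (gen Xi) w = act S (scalar (of_nat m)) w \<oplus>\<^bsub>S\<^esub> sub_vec f (Suc 0)"
proof -
  obtain s where s: "s \<in> carrier S" "proj E s = basis_vec m 0"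
    by (rule is_extension_lift[OF ses basis_vec_closed])
  let ?d = "act S (gen Xi) s \<oplus>\<^bsub>S\<^esub> act S (scalar (- of_nat m)) s"
  have "proj E ?d = (\<lambda>i. 0)"
    using s L_gen_basis_vec(1)[of m 1 0] by (simp add: proj_add proj_act)
  then obtain f where f: "f \<in> carrier (L (m + 2))" "?d = \<iota> f"
    using kernelE[of ?d] s by blast
  have ds: "act S (gen Xi) s = act S (scalar (of_nat m)) s \<oplus>\<^bsub>S\<^esub> \<iota> f"
  proof -
    have "act S (scalar (of_nat m)) s \<oplus>\<^bsub>S\<^esub> ?d
        = act S (gen Xi) s \<oplus>\<^bsub>S\<^esub> (act S (scalar (of_nat m)) s \<oplus>\<^bsub>S\<^esub> act S (scalar (- of_nat m)) s)"
      using s by (simp add: S.M.a_ac)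
    then show ?thesis using s f(2) by (simp add: S.act_scalar_simps)
  qed
  (* At j = 1 the divisor is zero; this component of f remains as the defect. *)
  define h where "h = (\<lambda>j. if j = 1 then 0 else - f j / (2 - 2 * of_nat j))"
  have h: "h \<in> carrier (L (m + 2))" using f by (auto simp: L_simps h_def)
  let ?w = "s \<oplus>\<^bsub>S\<^esub> \<iota> h"
  have two: "(2 :: 'k) - 2 * of_nat j \<noteq> 0" if "j \<noteq> 1" for j
  proof
    assume "(2 :: 'k) - 2 * of_nat j = 0"
    then have "(of_nat 1 :: 'k) = of_nat j" by (simp add: algebra_simps)
    then show False using that by (simp only: of_nat_eq_iff)
  qed
  have "act S (gen Xi) ?w = act S (scalar (of_nat m)) s \<oplus>\<^bsub>S\<^esub> (\<iota> f \<oplus>\<^bsub>S\<^esub> \<iota> (L_gen (m + 2) Xi h))"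
    using s f h by (simp add: S.act_add act_iota iota_closed ds S.M.a_assoc L_gen_in_L)
  also have "\<iota> f \<oplus>\<^bsub>S\<^esub> \<iota> (L_gen (m + 2) Xi h) = \<iota> (\<lambda>j. of_nat m * h j) \<oplus>\<^bsub>S\<^esub> sub_vec (f (Suc 0)) (Suc 0)"
  proof -
    have c: "(\<lambda>j. of_nat m * h j) \<in> carrier (L (m + 2))" using h by (simp add: L_simps)
    have hh: "\<forall>i>m + 2. h i = 0" using h by (simp only: L_simps)
    have "f j + (of_nat (m + 2) - 2 * of_nat j) * h j = of_nat m * h j + f (Suc 0) * basis_vec (m + 2) (Suc 0) j" for j
      using two[of j] by (cases "j = 1") (auto simp: h_def basis_vec_def field_simps)
    then show ?thesis
      unfolding sub_vec_def iota_add[OF f(1) L_gen_in_L] iota_add[OF c scaled_basis_vec_closed]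
      unfolding L_gen_eq(1)[OF hh] by simp
  qed
  also have "act S (scalar (of_nat m)) s \<oplus>\<^bsub>S\<^esub> (\<iota> (\<lambda>j. of_nat m * h j) \<oplus>\<^bsub>S\<^esub> sub_vec (f (Suc 0)) (Suc 0))
      = act S (scalar (of_nat m)) ?w \<oplus>\<^bsub>S\<^esub> sub_vec (f (Suc 0)) (Suc 0)"
    using s h act_iota(2)[OF h, of "of_nat m", symmetric]
    by (simp add: S.act_add iota_closed S.M.a_assoc)
  finally have "act S (gen Xi) ?w = act S (scalar (of_nat m)) ?w \<oplus>\<^bsub>S\<^esub> sub_vec (f (Suc 0)) (Suc 0)" .
  moreover have "proj E ?w = basis_vec m 0"
    using s h by (simp add: proj_add proj_iota iota_closed)
  ultimately show ?thesis using that s h iota_closed by blast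
qed

text \<open>
  Write \<open>e\<close> for the raising operator and \<open>f
  z\<^sub>m\<^sub>+\<^sub>2\<^sub>,\<^sub>1\<close> for the defect of a lift \<open>s\<close> as
  above. In \<open>(\<xi> - (m + 2)) e s = e (\<xi> - m) s = f e
  z\<^sub>m\<^sub>+\<^sub>2\<^sub>,\<^sub>1\<close> the left side has no component at
  \<open>z\<^sub>m\<^sub>+\<^sub>2\<^sub>,\<^sub>0\<close>, since \<open>e s\<close> lies in the
  submodule, and the right side is a nonzero multiple of \<open>f
  z\<^sub>m\<^sub>+\<^sub>2\<^sub>,\<^sub>0\<close>. Hence \<open>f = 0\<close>, and \<open>e
  s\<close> is a multiple of \<open>z\<^sub>m\<^sub>+\<^sub>2\<^sub>,\<^sub>0\<close>, which a
  multiple of \<open>z\<^sub>m\<^sub>+\<^sub>2\<^sub>,\<^sub>1\<close> added to \<open>s\<close>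
  removes.
\<close>

lemma weight_lift:
  obtains w where "w \<in> carrier S" "proj E w = basis_vec m 0"
    "act S (gen Xi) w = act S (scalar (of_nat m)) w" "act S raising w = \<zero>\<^bsub>S\<^esub>"
proof -
  obtain s f where s: "s \<in> carrier S" "proj E s = basis_vec m 0"
    and xs: "act S (gen Xi) s = act S (scalar (of_nat m)) s \<oplus>\<^bsub>S\<^esub> sub_vec f (Suc 0)"
    by (rule approximate_weight_lift)
  have "proj E (act S raising s) = (\<lambda>i. 0)"
    using s L_gen_basis_vec(4)[of m 1] by (simp add: proj_raising)
  then obtain h where h: "h \<in> carrier (L (m + 2))" "act S raising s = \<iota> h"
    using kernelE[of "act S raising s"] s by blast
  have hh: "\<forall>i>m + 2. h i = 0" using h(1) by (simp only: L_simps)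
  have m: "(of_nat (m + 2) :: 'k) \<noteq> 0" by (simp only: of_nat_eq_0_iff)
  have a1: "act S raising (sub_vec c (Suc 0)) = sub_vec ((of_nat m + 2) / 2 * c) 0" for c
    using L_gen_basis_vec(3)[of "m + 2" c 0] by (simp add: act_raising_iota sub_vec_def mult.assoc)
  define F where "F = (of_nat m + 2) / 2 * f"
  have "act S (gen Xi) (\<iota> h) = act S raising (act S (gen Xi) s) \<oplus>\<^bsub>S\<^esub> act S (scalar 2) (\<iota> h)"
    using S.act_relations(9)[OF s(1)] h(2) by simp
  also have "act S raising (act S (gen Xi) s)
      = act S (scalar (of_nat m)) (\<iota> h) \<oplus>\<^bsub>S\<^esub> sub_vec F 0"
    using s by (simp add: xs S.act_add S.act_scalar_commute[of _ raising] h(2) a1 F_def)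
  finally have "act S (gen Xi) (\<iota> h)
      = act S (scalar (of_nat m)) (\<iota> h) \<oplus>\<^bsub>S\<^esub> sub_vec F 0 \<oplus>\<^bsub>S\<^esub> act S (scalar 2) (\<iota> h)" .
  moreover have c: "(\<lambda>i. c * h i) \<in> carrier (L (m + 2))" for c using h(1) by (simp add: L_simps)
  moreover have "(\<lambda>i. p i + q i) \<in> carrier (L (m + 2))"
    if "p \<in> carrier (L (m + 2))" "q \<in> carrier (L (m + 2))" for p q :: "nat \<Rightarrow> 'k"
    using that by (simp add: L_simps(1))
  ultimately have "\<iota> (L_gen (m + 2) Xi h)
      = \<iota> (\<lambda>i. of_nat m * h i + F * basis_vec (m + 2) 0 i + 2 * h i)"
    using h(1) c by (simp add: act_iota iota_add sub_vec_def)
  then have "L_gen (m + 2) Xi h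
      = (\<lambda>i. of_nat m * h i + F * basis_vec (m + 2) 0 i + 2 * h i)"
    by (rule iota_inj[OF L_gen_in_L, rotated]) (use hh in \<open>simp add: L_simps(1) basis_vec_def\<close>)
  then have eq: "(of_nat (m + 2) - 2 * of_nat i) * h i
      = of_nat m * h i + F * basis_vec (m + 2) 0 i + 2 * h i" for i
    using L_gen_eq(1)[OF hh] by (simp add: fun_eq_iff)
  have f: "f = 0"
  proof -
    have "F = 0" using eq[of 0] by (simp add: basis_vec_def algebra_simps)
    then have "(of_nat m + 2) * f = 0" by (simp add: F_def)
    then show ?thesis using m by simp
  qed
  have "h i = h 0 * basis_vec (m + 2) 0 i" for i
  proof (cases "i = 0")
    case False
    have "of_nat i * h i = 0" using eq[of i] f by (simp add: F_def algebra_simps)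
    then show ?thesis using False by (simp add: basis_vec_def)
  qed (simp add: basis_vec_def)
  then have "h = (\<lambda>i. h 0 * basis_vec (m + 2) 0 i)" by (intro ext)
  then have h0: "\<iota> h = sub_vec (h 0) 0" unfolding sub_vec_def by (rule arg_cong)
  (* The raising operator sends z_1 to (m + 2) / 2 times z_0. *)
  let ?c = "- (2 * h 0 / of_nat (m + 2))"
  let ?w = "s \<oplus>\<^bsub>S\<^esub> sub_vec ?c (Suc 0)"
  show ?thesis
  proof (rule that)
    show "?w \<in> carrier S" using s by simp
    show "proj E ?w = basis_vec m 0" using s by (simp add: proj_add proj_sub_vec)
    show "act S (gen Xi) ?w = act S (scalar (of_nat m)) ?w"
      using s xs f by (simp add: S.act_add act_sub_vec sub_vec_zero)
    have "act S raising ?w = sub_vec (h 0) 0 \<oplus>\<^bsub>S\<^esub> sub_vec ((of_nat m + 2) / 2 * ?c) 0"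
      using s by (simp only: S.act_add sub_vec_closed a1 h(2) h0)
    also have "\<dots> = \<zero>\<^bsub>S\<^esub>" using m by (simp add: sub_vec_add sub_vec_zero)
    finally show "act S raising ?w = \<zero>\<^bsub>S\<^esub>" .
  qed
qed

end

locale L_extension_lift = L_extension +
  fixes w
  assumes w_closed [simp, intro]: "w \<in> carrier S"
    and proj_w: "proj E w = basis_vec m 0"
    and Xi_w: "act S (gen Xi) w = act S (scalar (of_nat m)) w"
    and raising_w: "act S raising w = \<zero>\<^bsub>S\<^esub>"
begin

definition b :: "nat \<Rightarrow> 'b" where
  "b j = act S (gen Y ^ j) w"

lemma b_closed [simp, intro]: "b j \<in> carrier S"
  by (simp add: b_def)

lemma b_0: "b 0 = w"
  by (simp add: b_def)

lemma b_Suc: "b (Suc j) = act S (gen Y) (b j)"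
  by (simp add: b_def S.act_mult)

lemma proj_b: "proj E (b j) = basis_vec m j"
proof (induction j)
  case 0
  show ?case by (simp add: b_0 proj_w)
next
  case (Suc j)
  then show ?case using L_gen_basis_vec(2)[of m 1 j] by (simp add: b_Suc proj_act)
qed

lemma Xi_b: "act S (gen Xi) (b j) = act S (scalar (of_nat m - 2 * of_nat j)) (b j)"
proof (induction j)
  case 0
  show ?case by (simp add: b_0 Xi_w)
next
  case (Suc j)
  have "act S (gen Xi) (b (Suc j)) = act S (gen Y) (act S (gen Xi) (b j)) \<oplus>\<^bsub>S\<^esub> act S (scalar (- 2)) (b (Suc j))"
    by (simp add: b_Suc S.act_relations(1))
  also have "\<dots> = act S (scalar (of_nat m - 2 * of_nat j + - 2)) (b (Suc j))"
    by (simp only: Suc.IH S.act_scalar_commute[of _ "gen Y"] b_closed S.act_scalar_simps flip: b_Suc)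
  finally show ?case by (simp add: algebra_simps)
qed

lemma raising_b:
  "act S raising (b (Suc j)) = act S (scalar ((of_nat j + 1) * (of_nat m - of_nat j) / 2)) (b j)"
proof (induction j)
  case 0
  show ?case by (simp add: b_Suc b_0 S.act_relations(8) raising_w Xi_w S.act_scalar_simps)
next
  case (Suc j)
  have "act S raising (b (Suc (Suc j)))
      = act S (gen Y) (act S raising (b (Suc j))) \<oplus>\<^bsub>S\<^esub> act S (scalar (1 / 2)) (act S (gen Xi) (b (Suc j)))"
    by (simp add: b_Suc[of "Suc j"] S.act_relations(8))
  also have "\<dots> = act S (scalar ((of_nat j + 1) * (of_nat m - of_nat j) / 2 +
      1 / 2 * (of_nat m - 2 * of_nat (Suc j)))) (b (Suc j))"
    by (simp only: Suc.IH Xi_b S.act_scalar_commute[of _ "gen Y"] b_closed S.act_scalar_simps flip: b_Suc)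
  also have "(of_nat j + 1) * (of_nat m - of_nat j) / 2 + 1 / 2 * (of_nat m - 2 * of_nat (Suc j))
      = (of_nat (Suc j) + 1) * (of_nat m - of_nat (Suc j)) / (2 :: 'a)"
    by (simp add: field_simps)
  finally show ?case .
qed

text \<open>
  The vector lies in the submodule and the raising operator kills it, so it is a multiple of
  \<open>z\<^sub>m\<^sub>+\<^sub>2\<^sub>,\<^sub>0\<close>. That has weight \<open>m + 2\<close>,
  while the vector has weight \<open>- m - 2\<close>.
\<close>

lemma b_top: "b (Suc m) = \<zero>\<^bsub>S\<^esub>"
proof -
  have "proj E (b (Suc m)) = (\<lambda>i. 0)" by (simp add: proj_b basis_vec_def)
  then obtain f where f: "f \<in> carrier (L (m + 2))" "b (Suc m) = \<iota> f"
    using kernelE[of "b (Suc m)"] by blast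
  have ff: "\<forall>i>m + 2. f i = 0" using f(1) by (simp only: L_simps)
  have z: "(\<lambda>i. 0) \<in> carrier (L (m + 2) :: ('a jordan_double, _) module)" by (simp add: L_simps)
  have "\<iota> (L_gen (m + 2) V f) = act S raising (b (Suc m))"
    using f by (simp add: act_raising_iota)
  also have "\<dots> = \<iota> (\<lambda>i. 0)"
    by (simp add: raising_b S.act_scalar_simps iota_zero)
  finally have "L_gen (m + 2) V f = (\<lambda>i. 0)" by (rule iota_inj[OF L_gen_in_L z])
  then have "(if j < m + 2 then of_nat ((j + 1) * (m + 2 - j)) / 2 * f (j + 1) else 0) = 0" for j
    unfolding L_gen_eq(2)[OF ff] by (rule fun_cong)
  then have "of_nat ((j + 1) * (m + 2 - j)) / 2 * f (j + 1) = 0" if "j < m + 2" for j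
    using that by (metis (full_types))
  then have pos: "f (Suc j) = 0" if "j < m + 2" for j
    using that by (simp del: of_nat_mult of_nat_Suc of_nat_add)
  have c: "(\<lambda>i. c * f i) \<in> carrier (L (m + 2))" for c using f(1) by (simp add: L_simps)
  have "\<iota> (L_gen (m + 2) Xi f) = act S (gen Xi) (b (Suc m))"
    using f by (simp add: act_iota)
  also have "\<dots> = \<iota> (\<lambda>i. (of_nat m - 2 * of_nat (Suc m)) * f i)"
    by (subst Xi_b) (simp only: f(2) act_iota(2)[OF f(1)])
  finally have "L_gen (m + 2) Xi f = (\<lambda>i. (of_nat m - 2 * of_nat (Suc m)) * f i)"
    by (rule iota_inj[OF L_gen_in_L c])
  then have "(of_nat (m + 2) - 2 * of_nat 0) * f 0 = (of_nat m - 2 * of_nat (Suc m)) * f 0"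
    unfolding L_gen_eq(1)[OF ff] by (rule fun_cong)
  then have "of_nat (2 * (m + 2)) * f 0 = 0" by (simp add: algebra_simps)
  then have "f 0 = 0" by (simp only: mult_eq_0_iff of_nat_eq_0_iff) simp
  then have "f i = 0" for i using pos[of "i - 1"] ff by (cases i; cases "i \<le> m + 2") auto
  then have "f = (\<lambda>i. 0)" by (intro ext)
  then show ?thesis using f(2) iota_zero by simp
qed

text \<open>
  The vector \<open>x w\<close> lies in the submodule and has weight \<open>m - 2\<close>, as has
  \<open>z\<^sub>m\<^sub>+\<^sub>2\<^sub>,\<^sub>2\<close>; weight spaces of \<open>L(m +
  2)\<close> are at most one-dimensional.
\<close>

lemma ex_X_w: "\<exists>\<kappa>. act S (gen X) w = sub_vec \<kappa> 2"
proof -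
  have "proj E (act S (gen X) w) = (\<lambda>i. 0)"
    using L_gen_basis_vec(5)[of m 1 0] by (simp add: proj_act proj_w)
  then obtain f where f: "f \<in> carrier (L (m + 2))" "act S (gen X) w = \<iota> f"
    using kernelE[of "act S (gen X) w"] by blast
  have ff: "\<forall>i>m + 2. f i = 0" using f(1) by (simp only: L_simps)
  have c: "(\<lambda>i. c * f i) \<in> carrier (L (m + 2))" for c using f(1) by (simp add: L_simps)
  have "\<iota> (L_gen (m + 2) Xi f) = act S (gen X) (act S (gen Xi) w) \<oplus>\<^bsub>S\<^esub> act S (scalar (- 2)) (act S (gen X) w)"
    using S.act_relations(2)[OF w_closed] f by (simp add: act_iota)
  also have "\<dots> = act S (scalar (of_nat m + - 2)) (\<iota> f)"
    by (simp only: Xi_w S.act_scalar_commute[of _ "gen X"] w_closed S.act_scalar_simps f(2)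
        iota_closed[OF f(1)])
  also have "\<dots> = \<iota> (\<lambda>i. (of_nat m + - 2) * f i)" by (rule act_iota(2)[OF f(1)])
  finally have "L_gen (m + 2) Xi f = (\<lambda>i. (of_nat m + - 2) * f i)"
    by (rule iota_inj[OF L_gen_in_L c])
  then have eq: "(of_nat (m + 2) - 2 * of_nat i) * f i = (of_nat m + - 2) * f i" for i
    unfolding L_gen_eq(1)[OF ff] by (rule fun_cong)
  have "f i = f 2 * basis_vec (m + 2) 2 i" for i
  proof (cases "i = 2")
    case False
    have "(of_nat 2 - of_nat i) * f i = 0" using eq[of i] by (simp add: algebra_simps)
    moreover have "(of_nat 2 :: 'a) \<noteq> of_nat i" using False by (simp only: of_nat_eq_iff)
    ultimately show ?thesis using False by (simp add: basis_vec_def)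
  qed (simp add: basis_vec_def)
  then have "f = (\<lambda>i. f 2 * basis_vec (m + 2) 2 i)" by (intro ext)
  then have "\<iota> f = sub_vec (f 2) 2" unfolding sub_vec_def by (rule arg_cong)
  then show ?thesis using f(2) by auto
qed

text \<open>
  The combination of the vectors \<open>b j\<close> is expressed as the action of a polynomial in
  \<open>y\<close> on \<open>w\<close>, so that its sum takes place in the free algebra.
\<close>

definition from_model :: "(nat + nat \<Rightarrow> 'a) \<Rightarrow> 'b" where
  "from_model s = \<iota> (\<lambda>i. s (Inl i)) \<oplus>\<^bsub>S\<^esub> act S (\<Sum>j\<le>m. scalar (s (Inr j)) * gen Y ^ j) w"

lemma model_Inl: "s \<in> carrier (model m \<kappa>) \<Longrightarrow> (\<lambda>i. s (Inl i)) \<in> carrier (L (m + 2))"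
  by (simp add: model_simps(1) L_simps(1))

lemma from_model_closed: "s \<in> carrier (model m \<kappa>) \<Longrightarrow> from_model s \<in> carrier S"
  by (simp add: from_model_def iota_closed[OF model_Inl])

lemma from_model_add:
  assumes "s \<in> carrier (model m \<kappa>)" "t \<in> carrier (model m \<kappa>)"
  shows "from_model (\<lambda>i. s i + t i) = from_model s \<oplus>\<^bsub>S\<^esub> from_model t"
  using assms
  by (simp add: from_model_def scalar_hom distrib_right sum.distrib S.act_add_left
      iota_closed[OF model_Inl] S.M.a_ac flip: iota_add[OF model_Inl model_Inl])

lemma from_model_scale:
  assumes "s \<in> carrier (model m \<kappa>)"
  shows "from_model (\<lambda>i. c * s i) = act S (scalar c) (from_model s)"
  using assms
  by (simp add: from_model_def scalar_hom mult.assoc S.act_mult S.act_add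
      iota_closed[OF model_Inl] act_iota(2)[OF model_Inl] flip: sum_distrib_left)

lemma from_model_submodule: "f \<in> carrier (L (m + 2)) \<Longrightarrow> from_model (case_sum f (\<lambda>j. 0)) = \<iota> f"
  by (simp add: from_model_def scalar_hom iota_closed)

lemma from_model_lift:
  assumes f: "f \<in> carrier (L (m + 2))" and k: "k \<le> Suc m"
  shows "from_model (case_sum f (\<lambda>j. c * basis_vec m k j)) = \<iota> f \<oplus>\<^bsub>S\<^esub> act S (scalar c) (b k)"
proof -
  have "(\<Sum>j\<le>m. scalar (c * basis_vec m k j) * gen Y ^ j)
      = (\<Sum>j\<le>m. if k = j then scalar c * gen Y ^ k else 0)"
    by (intro sum.cong) (auto simp: basis_vec_def scalar_hom)
  also have "\<dots> = (if k \<le> m then scalar c * gen Y ^ k else 0)" by simp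
  finally show ?thesis
    using k b_top by (cases "k \<le> m") (auto simp: from_model_def b_def S.act_mult le_Suc_eq)
qed

lemma proj_from_model:
  assumes "s \<in> carrier (model m \<kappa>)"
  shows "proj E (from_model s) = (\<lambda>j. s (Inr j))"
  using assms
proof (induction s rule: model_induct)
  case (submodule f)
  then show ?case by (simp add: from_model_submodule proj_iota)
next
  case (lift k)
  have "(\<lambda>i. 0) \<in> carrier (L (m + 2) :: ('a jordan_double, _) module)" by (simp add: L_simps)
  then have "from_model (case_sum (\<lambda>i. 0) (\<lambda>j. 1 * basis_vec m k j)) = b k"
    using from_model_lift[of "\<lambda>i. 0" k 1] lift by (simp add: iota_zero S.act_scalar_simps)
  then show ?case by (simp only: proj_b sum.case mult_1)
next
  case (add s t)
  then show ?case by (simp add: from_model_add proj_add from_model_closed)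
next
  case (scale s c)
  then show ?case by (simp add: from_model_scale proj_act from_model_closed)
qed

context
  fixes \<kappa>
  assumes X_w: "act S (gen X) w = sub_vec \<kappa> 2"
begin

lemma X_b: "act S (gen X) (b j) = sub_vec \<kappa> (j + 2)"
proof (induction j)
  case 0
  show ?case by (simp add: b_0 X_w)
next
  case (Suc j)
  then show ?case
    by (simp add: b_Suc S.act_relations(3) act_sub_vec add_2_eq_Suc')
qed

lemma kernel_act:
  assumes "s \<in> carrier S" "proj E s = (\<lambda>i. 0)"
  shows "act S (gen X) s = \<zero>\<^bsub>S\<^esub>" "act S (gen G) s = s" "act S (gen U) s = \<zero>\<^bsub>S\<^esub>"
  using act_submodule[OF ses] kernelE[OF assms] by metis+

text \<open>
  Apply \<open>v x + g = x v + 1 + x u\<close> to \<open>w\<close>: the vectors \<open>v w\<close>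
  and \<open>u w\<close> lie in the submodule, where \<open>x\<close> is zero.
\<close>

lemma G_w: "act S (gen G) w = sub_vec (- (\<kappa> * (of_nat m + 1))) (Suc 0) \<oplus>\<^bsub>S\<^esub> w"
proof -
  have "proj E (act S (gen V) w) = (\<lambda>i. 0)" "proj E (act S (gen U) w) = (\<lambda>i. 0)"
    using L_gen_basis_vec(4,6)[of m 1] by (simp_all add: proj_act proj_w)
  then have "act S (gen V) (sub_vec \<kappa> 2) \<oplus>\<^bsub>S\<^esub> act S (gen G) w = w"
    using S.act_relations(5)[OF w_closed] by (simp add: X_w kernel_act)
  moreover have "act S (gen V) (sub_vec \<kappa> 2) = sub_vec (\<kappa> * (of_nat m + 1)) (Suc 0)"
    using act_sub_vec(3)[of \<kappa> "Suc 0"] by (simp add: numeral_2_eq_2 algebra_simps add_divide_distrib)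
  ultimately have eq: "sub_vec (\<kappa> * (of_nat m + 1)) (Suc 0) \<oplus>\<^bsub>S\<^esub> act S (gen G) w = w" by simp
  let ?c = "\<kappa> * (of_nat m + 1)"
  have "sub_vec (- ?c) (Suc 0) \<oplus>\<^bsub>S\<^esub> w
      = (sub_vec (- ?c) (Suc 0) \<oplus>\<^bsub>S\<^esub> sub_vec ?c (Suc 0)) \<oplus>\<^bsub>S\<^esub> act S (gen G) w"
    by (subst eq[symmetric]) (simp only: S.M.a_assoc sub_vec_closed S.act_closed w_closed)
  then show ?thesis by (simp add: sub_vec_add sub_vec_zero del: mult_minus_left)
qed

lemma G_b: "act S (gen G) (b j) = sub_vec (- (\<kappa> * (of_nat m + 1 - of_nat j))) (Suc j) \<oplus>\<^bsub>S\<^esub> b j"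
proof (induction j)
  case 0
  show ?case by (simp add: b_0 G_w)
next
  case (Suc j)
  let ?c = "- (\<kappa> * (of_nat m + 1 - of_nat j))"
  have "act S (gen G) (b (Suc j)) = act S (gen Y) (sub_vec ?c (Suc j) \<oplus>\<^bsub>S\<^esub> b j)
      \<oplus>\<^bsub>S\<^esub> act S (gen X) (sub_vec ?c (Suc j) \<oplus>\<^bsub>S\<^esub> b j)"
    by (simp only: b_Suc S.act_relations(4) b_closed Suc.IH)
  also have "\<dots> = (sub_vec ?c (Suc (Suc j)) \<oplus>\<^bsub>S\<^esub> sub_vec \<kappa> (Suc (Suc j))) \<oplus>\<^bsub>S\<^esub> b (Suc j)"
    by (simp add: S.act_add act_sub_vec X_b add_2_eq_Suc' S.M.a_ac flip: b_Suc)
  also have "\<dots> = sub_vec (- (\<kappa> * (of_nat m + 1 - of_nat (Suc j)))) (Suc (Suc j)) \<oplus>\<^bsub>S\<^esub> b (Suc j)"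
    by (simp add: sub_vec_add algebra_simps)
  finally show ?case .
qed

text \<open>
  Apply \<open>v g = g v + g u\<close> to \<open>w\<close>: on \<open>v w\<close> and \<open>u
  w\<close>, which lie in the submodule, \<open>g\<close> is the identity.
\<close>

lemma U_w: "act S (gen U) w = sub_vec (- (\<kappa> * (of_nat m + 2) * (of_nat m + 1) / 2)) 0"
proof -
  have k: "proj E (act S (gen V) w) = (\<lambda>i. 0)" "proj E (act S (gen U) w) = (\<lambda>i. 0)"
    using L_gen_basis_vec(4,6)[of m 1] by (simp_all add: proj_act proj_w)
  let ?d = "(of_nat 0 + 1) * (of_nat m + 2 - of_nat 0) / 2 * - (\<kappa> * (of_nat m + 1))"
  have "sub_vec ?d 0 \<oplus>\<^bsub>S\<^esub> act S (gen V) w = act S (gen V) w \<oplus>\<^bsub>S\<^esub> act S (gen U) w"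
    using S.act_relations(6)[OF w_closed]
    by (simp only: G_w S.act_add sub_vec_closed w_closed act_sub_vec(3) kernel_act k S.act_closed)
  then have "act S (gen U) w \<oplus>\<^bsub>S\<^esub> act S (gen V) w = sub_vec ?d 0 \<oplus>\<^bsub>S\<^esub> act S (gen V) w"
    by (simp only: S.M.a_comm[of "act S (gen U) w"] w_closed S.act_closed)
  then have "act S (gen U) w = sub_vec ?d 0"
    by (simp only: S.M.add.right_cancel sub_vec_closed w_closed S.act_closed)
  also have "?d = - (\<kappa> * (of_nat m + 2) * (of_nat m + 1) / 2)" by (simp add: algebra_simps)
  finally show ?thesis .
qed

lemma U_b:
  "act S (gen U) (b j)
    = sub_vec (- (\<kappa> * (of_nat m + 2 - of_nat j) * (of_nat m + 1 - of_nat j) / 2)) j"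
proof (induction j)
  case 0
  show ?case by (simp add: b_0 U_w)
next
  case (Suc j)
  let ?c = "- (\<kappa> * (of_nat m + 1 - of_nat j))"
    and ?d = "- (\<kappa> * (of_nat m + 2 - of_nat j) * (of_nat m + 1 - of_nat j) / 2)"
  have "act S (gen U) (b (Suc j)) \<oplus>\<^bsub>S\<^esub> (sub_vec ?c (Suc j) \<oplus>\<^bsub>S\<^esub> b j) = sub_vec ?d (Suc j) \<oplus>\<^bsub>S\<^esub> b j"
    using S.act_relations(7)[OF b_closed[of j]] by (simp only: Suc.IH G_b act_sub_vec(2) flip: b_Suc)
  then have "act S (gen U) (b (Suc j)) \<oplus>\<^bsub>S\<^esub> sub_vec ?c (Suc j) = sub_vec ?d (Suc j)"
    by (simp only: S.M.add.right_cancel sub_vec_closed b_closed S.act_closed S.M.a_closed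
        flip: S.M.a_assoc)
  then have "act S (gen U) (b (Suc j)) \<oplus>\<^bsub>S\<^esub> sub_vec ?c (Suc j)
      = sub_vec (?d - ?c) (Suc j) \<oplus>\<^bsub>S\<^esub> sub_vec ?c (Suc j)"
    by (simp only: sub_vec_add diff_add_cancel)
  then have "act S (gen U) (b (Suc j)) = sub_vec (?d - ?c) (Suc j)"
    by (simp only: S.M.add.right_cancel sub_vec_closed b_closed S.act_closed)
  also have "?d - ?c = - (\<kappa> * (of_nat m + 2 - of_nat (Suc j)) * (of_nat m + 1 - of_nat (Suc j)) / 2)"
    by (simp add: field_simps)
  finally show ?case .
qed

text \<open>
  This is \<open>v = (v + \<xi> u / 2) - \<xi> u / 2\<close>.
\<close>

lemma V_b:
  "act S (gen V) (b j)
    = sub_vec (\<kappa> * (of_nat m + 2 - 2 * of_nat j) * (of_nat m + 2 - of_nat j) * (of_nat m + 1 - of_nat j) / 4) j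
      \<oplus>\<^bsub>S\<^esub> act S raising (b j)"
proof -
  let ?d = "- (\<kappa> * (of_nat m + 2 - of_nat j) * (of_nat m + 1 - of_nat j) / 2)"
  let ?e = "1 / 2 * ((of_nat m + 2 - 2 * of_nat j) * ?d)"
  have "act S raising (b j) = act S (gen V) (b j) \<oplus>\<^bsub>S\<^esub> sub_vec ?e j"
    by (simp only: S.act_relations(10) b_closed U_b act_sub_vec(1,9))
  then have "sub_vec (- ?e) j \<oplus>\<^bsub>S\<^esub> act S raising (b j)
      = (sub_vec (- ?e) j \<oplus>\<^bsub>S\<^esub> sub_vec ?e j) \<oplus>\<^bsub>S\<^esub> act S (gen V) (b j)"
    by (simp only: S.M.a_ac sub_vec_closed b_closed S.act_closed S.M.a_closed)
  also have "\<dots> = act S (gen V) (b j)"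
    by (simp only: sub_vec_add add.left_inverse sub_vec_zero S.M.l_zero b_closed S.act_closed)
  also have "- ?e = \<kappa> * (of_nat m + 2 - 2 * of_nat j) * (of_nat m + 2 - of_nat j) * (of_nat m + 1 - of_nat j) / 4"
    by (simp add: field_simps)
  finally show ?thesis by (rule sym)
qed

lemma Ginv_b: "act S (gen Ginv) (b j) = sub_vec (\<kappa> * (of_nat m + 1 - of_nat j)) (Suc j) \<oplus>\<^bsub>S\<^esub> b j"
proof -
  let ?c = "\<kappa> * (of_nat m + 1 - of_nat j)"
  have "b j = act S (gen Ginv) (act S (gen G) (b j))"
    by (simp add: S.act_relations(11))
  also have "\<dots> = sub_vec (- ?c) (Suc j) \<oplus>\<^bsub>S\<^esub> act S (gen Ginv) (b j)"
    by (simp only: G_b S.act_add sub_vec_closed b_closed act_sub_vec(8))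
  finally have "sub_vec ?c (Suc j) \<oplus>\<^bsub>S\<^esub> b j
      = (sub_vec ?c (Suc j) \<oplus>\<^bsub>S\<^esub> sub_vec (- ?c) (Suc j)) \<oplus>\<^bsub>S\<^esub> act S (gen Ginv) (b j)"
    by (simp only: S.M.a_assoc sub_vec_closed b_closed S.act_closed)
  then show ?thesis by (simp add: sub_vec_add sub_vec_zero del: mult_minus_left)
qed

lemma raising_b': "act S raising (b k) = act S (scalar (of_nat k * (of_nat m + 1 - of_nat k) / 2)) (b (k - 1))"
  by (cases k) (simp_all add: b_0 raising_w S.act_scalar_simps raising_b add.commute)

lemma from_model_gen:
  assumes "s \<in> carrier (model m \<kappa>)"
  shows "from_model (model_gen m \<kappa> z s) = act S (gen z) (from_model s)"
  using assms
proof (induction s rule: model_induct)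
  case (submodule f)
  then show ?case
    by (simp add: model_gen_submodule from_model_submodule L_gen_in_L act_iota)
next
  case (lift k)
  have zero: "(\<lambda>i. 0) \<in> carrier (L (m + 2) :: ('a jordan_double, _) module)" by (simp add: L_simps)
  have b: "from_model (case_sum (\<lambda>i. 0) (\<lambda>j. 1 * basis_vec m k j)) = b k"
    using from_model_lift[OF zero, of k 1] lift by (simp add: iota_zero S.act_scalar_simps)
  have k: "k \<le> Suc m" "Suc k \<le> Suc m" "k - 1 \<le> Suc m" using lift by auto
  note t = from_model_lift[OF zero] from_model_lift[OF scaled_basis_vec_closed]
    from_model_submodule[OF scaled_basis_vec_closed]
  show ?case
    unfolding b
    by (cases z; simp only: model_gen_lift[OF lift] t k sub_vec_def[symmetric] iota_zero U_b V_b X_b Xi_b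
          G_b Ginv_b raising_b' S.act_scalar_simps S.M.l_zero b_closed S.act_closed b_Suc)
next
  case (add s t)
  have "model_gen m \<kappa> z s \<in> carrier (model m \<kappa>)" if "s \<in> carrier (model m \<kappa>)" for s
    using model_gen_closed[of s m \<kappa> z] that by (simp add: model.rep_module_def)
  from from_model_add[OF this[OF add(1)] this[OF add(2)]] show ?case
    using add by (simp add: model_gen_linear(1) from_model_add S.act_add from_model_closed)
next
  case (scale s c)
  have "model_gen m \<kappa> z s \<in> carrier (model m \<kappa>)" if "s \<in> carrier (model m \<kappa>)" for s
    using model_gen_closed[of s m \<kappa> z] that by (simp add: model.rep_module_def)
  from from_model_scale[OF this[OF scale(1)]] show ?case
    using scale by (simp add: model_gen_linear(2) from_model_scale from_model_closed
        S.act_scalar_commute[of _ "gen z"])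
qed

lemma equivalent_model: "equivalent_extensions jordan_double (L (m + 2)) (model_extension m \<kappa>) E"
proof (rule equivalent_extensionsI[OF is_extension_model ses])
  have "from_model \<in> module_hom jordan_double (model m \<kappa>) (middle E)"
    by (rule module_homI_act[OF model.double_module_rep S.double_module_axioms])
      (simp_all add: from_model_closed from_model_add from_model_scale from_model_gen
        model_simps(2) act_model)
  then show "from_model \<in> module_hom jordan_double (middle (model_extension m \<kappa>)) (middle E)"
    by (simp add: model_extension_def)
qed (simp_all add: model_extension_def from_model_submodule proj_from_model)

end

end

lemma extension_equivalent_model:
  fixes E :: "('k::field_char_0, 's) weight_extension"
  assumes "is_extension jordan_double (L (m + 2)) (L m) E"
  shows "\<exists>\<kappa>. equivalent_extensions jordan_double (L (m + 2)) (model_extension m \<kappa>) E"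
proof -
  interpret L_extension m E by standard (rule assms)
  obtain w where w: "w \<in> carrier S" "proj E w = basis_vec m 0"
    "act S (gen Xi) w = act S (scalar (of_nat m)) w" "act S raising w = \<zero>\<^bsub>S\<^esub>"
    by (rule weight_lift)
  interpret L_extension_lift m E w by standard (fact w)+
  show ?thesis using ex_X_w equivalent_model by blast
qed

section \<open>The module T(m, 1)\<close>

text \<open>
  Rules for \<open>x' = - g\<^sup>-\<^sup>1 x\<close> and \<open>y' = - g\<^sup>-\<^sup>1
  y\<close>, the antipodes of \<open>x\<close> and \<open>y\<close>, similar to those for
  \<open>x\<close> and \<open>y\<close>.
\<close>

lemma antipode_generator_relations:
  fixes x' y' :: "'k::field_char_0 double_alg"
  defines "x' \<equiv> cls (antipode_gen X)" and "y' \<equiv> cls (antipode_gen Y)"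
  shows "cls (gen Xi) * y' = y' * cls (gen Xi) - 2 * y'"
    "cls (gen Xi) * x' = x' * cls (gen Xi) - 2 * x'"
    "cls (gen G) * y' = y' * cls (gen G) + x' * cls (gen G)"
    "cls (gen G) * x' = x' * cls (gen G)"
    "cls (gen Ginv) * y' = y' * cls (gen Ginv) - x' * cls (gen Ginv)"
    "cls (gen Ginv) * x' = x' * cls (gen Ginv)"
    "x' * y' = y' * x' - cls (scalar (1 / 2)) * x' * x'"
    "cls (gen U) * x' = x' * cls (gen U)"
    "cls (gen U) * y' = y' * cls (gen U) + 1 - cls (gen Ginv)"
    "cls (gen V) * x' = x' * cls (gen V) + 1 - cls (gen Ginv)"
    "cls (gen V) * y' = y' * cls (gen V) - cls (scalar (1 / 2)) * cls (gen Xi) + cls (gen Ginv) - 1"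
    "cls (gen Y) = - (cls (gen G) * y')"
    "cls (gen X) = - (cls (gen G) * x')"
    "x' * x' = cls (gen Ginv) * cls (gen Ginv) * cls (gen X) * cls (gen X)"
  unfolding x'_def y'_def
  by (simp_all add: cls_hom pbw_simps mult_2_right half_plus_half minus_half_minus_half)

context double_module
begin

lemma act_antipode_relations:
  fixes x' y' :: "'k free_alg"
  defines "x' \<equiv> antipode_gen X" and "y' \<equiv> antipode_gen Y"
  assumes t: "t \<in> carrier M"
  shows
    "act M (gen Xi) (act M y' t) = act M y' (act M (gen Xi) t) \<oplus> act M (scalar (- 2)) (act M y' t)" (is ?r1)
    "act M (gen Xi) (act M x' t) = act M x' (act M (gen Xi) t) \<oplus> act M (scalar (- 2)) (act M x' t)" (is ?r2)
    "act M (gen G) (act M y' t) = act M y' (act M (gen G) t) \<oplus> act M x' (act M (gen G) t)" (is ?r3)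
    "act M (gen G) (act M x' t) = act M x' (act M (gen G) t)" (is ?r4)
    "act M (gen Ginv) (act M y' t) =
       act M y' (act M (gen Ginv) t) \<oplus> act M (scalar (- 1)) (act M x' (act M (gen Ginv) t))" (is ?r5)
    "act M (gen Ginv) (act M x' t) = act M x' (act M (gen Ginv) t)" (is ?r6)
    "act M x' (act M y' t) = act M y' (act M x' t) \<oplus> act M (scalar (- (1 / 2))) (act M x' (act M x' t))" (is ?r7)
    "act M (gen U) (act M x' t) = act M x' (act M (gen U) t)" (is ?r8)
    "act M (gen U) (act M y' t) = act M y' (act M (gen U) t) \<oplus> (t \<oplus> act M (scalar (- 1)) (act M (gen Ginv) t))" (is ?r9)
    "act M (gen V) (act M x' t) = act M x' (act M (gen V) t) \<oplus> (t \<oplus> act M (scalar (- 1)) (act M (gen Ginv) t))" (is ?r10)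
    "act M (gen V) (act M y' t) = act M y' (act M (gen V) t) \<oplus> (act M (scalar (- (1 / 2))) (act M (gen Xi) t)
       \<oplus> (act M (gen Ginv) t \<oplus> act M (scalar (- 1)) t))" (is ?r11)
    "act M (gen Y) t = act M (scalar (- 1)) (act M (gen G) (act M y' t))" (is ?r12)
    "act M (gen X) t = act M (scalar (- 1)) (act M (gen G) (act M x' t))" (is ?r13)
    "act M x' (act M x' t) = act M (gen Ginv) (act M (gen Ginv) (act M (gen X) (act M (gen X) t)))" (is ?r14)
proof -
  have scal: "cls (scalar (- 1)) = (- 1 :: 'k double_alg)"
    "cls (scalar (- (1 / 2))) = - cls (scalar (1 / 2) :: 'k free_alg)"
    by (simp_all add: scalar_hom cls_hom)
  note rel = antipode_generator_relations[where 'k = 'k, folded x'_def y'_def]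
  have via: "act M p t = act M q t" if "cls p = cls q" for p q
    using that by (rule act_cong)
  note s = act_mult act_add_left t act_closed act_one
  note c = cls_hom scal cls_scalar_simps rel(1-11,14) rel(12,13)
  show ?r1
    using via[of "gen Xi * y'" "y' * gen Xi + scalar (- 2) * y'"] by (simp add: s cls_hom scal cls_scalar_simps rel(1))
  show ?r2
    using via[of "gen Xi * x'" "x' * gen Xi + scalar (- 2) * x'"] by (simp add: s cls_hom scal cls_scalar_simps rel(2))
  show ?r3
    using via[of "gen G * y'" "y' * gen G + x' * gen G"] by (simp add: s cls_hom rel(3))
  show ?r4
    using via[of "gen G * x'" "x' * gen G"] by (simp add: s cls_hom rel(4))
  show ?r5
    using via[of "gen Ginv * y'" "y' * gen Ginv + scalar (- 1) * (x' * gen Ginv)"]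
    by (simp add: s cls_hom scal rel(5))
  show ?r6
    using via[of "gen Ginv * x'" "x' * gen Ginv"] by (simp add: s cls_hom rel(6))
  show ?r7
    using via[of "x' * y'" "y' * x' + scalar (- (1 / 2)) * (x' * x')"]
    by (simp add: s cls_hom scal rel(7) mult.assoc)
  show ?r8
    using via[of "gen U * x'" "x' * gen U"] by (simp add: s cls_hom rel(8))
  show ?r9
    using via[of "gen U * y'" "y' * gen U + (1 + scalar (- 1) * gen Ginv)"]
    by (simp add: s cls_hom scal rel(9))
  show ?r10
    using via[of "gen V * x'" "x' * gen V + (1 + scalar (- 1) * gen Ginv)"]
    by (simp add: s cls_hom scal rel(10))
  show ?r11
    using via[of "gen V * y'" "y' * gen V + (scalar (- (1 / 2)) * gen Xi + (gen Ginv + scalar (- 1)))"]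
    by (simp add: s cls_hom scal rel(11))
  show ?r12
    using via[of "gen Y" "scalar (- 1) * (gen G * y')"] rel(12) by (simp add: s cls_hom scal)
  show ?r13
    using via[of "gen X" "scalar (- 1) * (gen G * x')"] rel(13) by (simp add: s cls_hom scal)
  show ?r14
    using via[of "x' * x'" "gen Ginv * (gen Ginv * (gen X * gen X))"]
    by (simp add: s cls_hom rel(14) mult.assoc)
qed

end

text \<open>
  What is needed of \<open>T(m, 1)\<close> is that its generator satisfies the relations and spans
  the module.
\<close>

locale T_generator = double_module T
  for T :: "('k::field_char_0 jordan_double, 'm) module" (structure) +
  fixes z :: 'm and m :: nat
  assumes z_closed [simp, intro]: "z \<in> carrier T"
    and G_z: "act T (gen G) z = z"
    and Xi_z: "act T (gen Xi) z = act T (scalar (of_nat (m + 2))) z"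
    and U_z: "act T (gen U) z = \<zero>" and V_z: "act T (gen V) z = \<zero>"
    and XX_z: "act T (gen X) (act T (gen X) z) = \<zero>"
    and Y_z: "act T (gen Y ^ (m + 3)) z = \<zero>"
    and YX_z: "act T (gen Y ^ (m + 1)) (act T (gen X) z) = \<zero>"
begin

abbreviation "x' \<equiv> antipode_gen X :: 'k free_alg"
abbreviation "y' \<equiv> antipode_gen Y :: 'k free_alg"

text \<open>
  The antipodes of \<open>y\<^sup>i\<close> and \<open>x y\<^sup>i\<close>, applied to the
  generator. They span \<open>T(m, 1)\<close> as the more obvious \<open>y\<^sup>i z\<close> and
  \<open>y\<^sup>i x z\<close> do, and the functionals of \<open>to_dual\<close> below take simple
  values on them.
\<close>

definition p :: "nat \<Rightarrow> 'm" where "p i = act T (y' ^ i) z"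

definition q :: "nat \<Rightarrow> 'm" where "q i = act T (y' ^ i) (act T x' z)"

lemma pq_closed [simp, intro]: "p i \<in> carrier T" "q i \<in> carrier T"
  by (simp_all add: p_def q_def)

lemma pq_0: "p 0 = z" "q 0 = act T x' z"
  by (simp_all add: p_def q_def)

lemma pq_Suc: "p (Suc i) = act T y' (p i)" "q (Suc i) = act T y' (q i)"
  by (simp_all only: p_def q_def power_Suc act_mult z_closed act_closed)

text \<open>
  The vectors \<open>t\<close> with \<open>x' x' t = 0\<close> are stable under \<open>y'\<close>,
  and \<open>x' y' t = y' x' t\<close> holds for them. The generator is one of them.
\<close>

lemma x'_p: "act T x' (p i) = q i" and x'_q: "act T x' (q i) = \<zero>"
proof -
  have step: "act T x' (act T x' (act T y' t)) = \<zero>" "act T x' (act T y' t) = act T y' (act T x' t)"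
    if t: "t \<in> carrier T" "act T x' (act T x' t) = \<zero>" for t
  proof -
    show 1: "act T x' (act T y' t) = act T y' (act T x' t)"
      using act_antipode_relations(7)[OF t(1)] t by (simp only: act_zero M.r_zero act_closed)
    show "act T x' (act T x' (act T y' t)) = \<zero>"
      unfolding 1 using act_antipode_relations(7)[OF act_closed[OF t(1)], of x'] t
      by (simp only: act_zero M.r_zero act_closed M.zero_closed)
  qed
  have z: "act T x' (act T x' z) = \<zero>"
    by (simp only: act_antipode_relations(14) z_closed XX_z act_zero)
  have p: "act T x' (act T x' (p i)) = \<zero>" for i
  proof (induction i)
    case 0
    show ?case by (simp only: pq_0 z)
  next
    case (Suc i)
    show ?case unfolding pq_Suc by (rule step(1)[OF pq_closed(1) Suc])
  qed
  show xp: "act T x' (p i) = q i" for i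
  proof (induction i)
    case 0
    show ?case by (simp only: pq_0)
  next
    case (Suc i)
    then show ?case by (simp only: pq_Suc step(2)[OF pq_closed(1) p])
  qed
  show "act T x' (q i) = \<zero>" using p[of i] by (simp only: xp)
qed

lemma G_q: "act T (gen G) (q i) = q i"
proof (induction i)
  case 0
  show ?case by (simp only: pq_0 act_antipode_relations(4) z_closed G_z)
next
  case (Suc i)
  then show ?case
    by (simp only: pq_Suc act_antipode_relations(3) pq_closed x'_q M.r_zero act_closed)
qed

lemma G_p: "act T (gen G) (p (Suc i)) = p (Suc i) \<oplus> act T (scalar (of_nat (Suc i))) (q i)"
proof (induction i)
  case 0
  have "act T (gen G) (act T y' z) = act T y' z \<oplus> act T x' z"
    by (simp only: act_antipode_relations(3) z_closed G_z)
  then show ?case by (simp add: pq_Suc(1)[of 0] pq_0 act_scalar_simps)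
next
  case (Suc i)
  have "act T (gen G) (p (Suc (Suc i)))
      = act T y' (p (Suc i) \<oplus> act T (scalar (of_nat (Suc i))) (q i))
        \<oplus> act T x' (p (Suc i) \<oplus> act T (scalar (of_nat (Suc i))) (q i))"
    by (simp only: pq_Suc(1)[of "Suc i"] act_antipode_relations(3) pq_closed Suc.IH)
  also have "\<dots> = p (Suc (Suc i)) \<oplus> (act T (scalar (of_nat (Suc i))) (q (Suc i)) \<oplus> q (Suc i))"
    by (simp only: act_add pq_closed act_closed act_scalar_commute[of _ y'] act_scalar_commute[of _ x']
        x'_p x'_q act_zero M.r_zero M.a_assoc flip: pq_Suc)
  also have "act T (scalar (of_nat (Suc i))) (q (Suc i)) \<oplus> q (Suc i)
      = act T (scalar (of_nat (Suc i) + 1)) (q (Suc i))"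
    by (simp only: act_add_left scalar_hom pq_closed act_one)
  finally show ?case by (simp add: add.commute)
qed

lemma Y_power_q: "act T (gen Y ^ i) (q 0) = act T (scalar ((- 1) ^ i)) (q i)"
proof (induction i)
  case 0
  show ?case by (simp add: act_scalar_simps)
next
  case (Suc i)
  have "act T (gen Y ^ Suc i) (q 0) = act T (gen Y) (act T (scalar ((- 1) ^ i)) (q i))"
    by (simp only: power_Suc act_mult pq_closed Suc.IH)
  also have "\<dots> = act T (scalar ((- 1) ^ i)) (act T (scalar (- 1)) (q (Suc i)))"
    by (simp only: act_scalar_commute[of _ "gen Y"] pq_closed act_antipode_relations(12) G_q flip: pq_Suc)
  finally show ?case by (simp add: act_scalar_simps)
qed

lemma scalar_eq_zeroD:
  assumes "t \<in> carrier T" "act T (scalar c) t = \<zero>" "c \<noteq> 0"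
  shows "t = \<zero>"
proof -
  have "act T (scalar (inverse c)) (act T (scalar c) t) = t"
    using assms(1,3) by (simp add: act_scalar_simps(1,3))
  then show ?thesis unfolding assms(2) by simp
qed

text \<open>
  The defining relation concerns a power of \<open>y = - g y'\<close>. As \<open>g\<close> fixes
  every \<open>q i\<close>, this is a power of \<open>y'\<close> up to sign.
\<close>

lemma q_vanish: "m + 1 \<le> i \<Longrightarrow> q i = \<zero>"
proof (induction i rule: dec_induct)
  case base
  have "act T (gen X) z = act T (scalar (- 1)) (q 0)"
    by (simp only: act_antipode_relations(13) z_closed G_q flip: pq_0(2))
  then have "act T (scalar (- 1)) (act T (gen Y ^ (m + 1)) (q 0)) = \<zero>"
    using YX_z by (simp only: act_scalar_commute[of _ "gen Y ^ (m + 1)"] pq_closed)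
  then have "act T (scalar (- 1 * (- 1) ^ (m + 1))) (q (m + 1)) = \<zero>"
    by (simp only: Y_power_q act_scalar_simps pq_closed)
  then show ?case by (rule scalar_eq_zeroD[rotated]) simp_all
next
  case (step i)
  then show ?case by (simp only: pq_Suc act_zero)
qed

text \<open>
  Here \<open>g\<close> does not act trivially, which accounts for the multiple of \<open>q
  i\<close>. It disappears for \<open>i = m + 2\<close>, as \<open>q (m + 2)\<close> vanishes.
\<close>

lemma Y_power_z:
  "\<exists>c. act T (gen Y ^ Suc i) z = act T (scalar ((- 1) ^ Suc i)) (p (Suc i)) \<oplus> act T (scalar c) (q i)"
proof (induction i)
  case 0
  have "act T (gen Y ^ Suc 0) z = act T (scalar (- 1)) (act T (gen G) (p (Suc 0)))"
    by (simp only: power_Suc power_0 mult_1_right act_antipode_relations(12) z_closed pq_Suc pq_0)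
  then show ?case
    by (intro exI[of _ "- 1"]) (simp add: G_p act_add act_scalar_simps)
next
  case (Suc i)
  then obtain c where c: "act T (gen Y ^ Suc i) z
      = act T (scalar ((- 1) ^ Suc i)) (p (Suc i)) \<oplus> act T (scalar c) (q i)" by blast
  let ?d = "(- 1) ^ Suc i :: 'k"
  have "act T (gen Y ^ Suc (Suc i)) z = act T (scalar ?d) (act T (gen Y) (p (Suc i))) \<oplus> act T (scalar c) (act T (gen Y) (q i))"
    by (simp only: power_Suc[of "gen Y" "Suc i"] act_mult z_closed c act_add act_closed pq_closed
        act_scalar_commute[of _ "gen Y"])
  also have "\<dots> = act T (scalar (?d * - 1)) (p (Suc (Suc i))) \<oplus>
      (act T (scalar (?d * - 1 * of_nat (Suc (Suc i)))) (q (Suc i)) \<oplus> act T (scalar (c * - 1)) (q (Suc i)))"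
    by (simp only: act_antipode_relations(12) pq_closed G_p G_q act_add act_closed act_scalar_simps(1)
        mult.assoc M.a_assoc flip: pq_Suc)
  also have "\<dots> = act T (scalar ((- 1) ^ Suc (Suc i))) (p (Suc (Suc i))) \<oplus>
      act T (scalar (?d * - 1 * of_nat (Suc (Suc i)) + c * - 1)) (q (Suc i))"
    by (simp only: act_scalar_simps(2) pq_closed power_Suc2[symmetric])
  finally show ?case by blast
qed

lemma p_vanish: "m + 3 \<le> i \<Longrightarrow> p i = \<zero>"
proof (induction i rule: dec_induct)
  case base
  have q0: "q (m + 2) = \<zero>" by (rule q_vanish) simp
  have Suc: "Suc (m + 2) = m + 3" by simp
  obtain c where "act T (gen Y ^ (m + 3)) z = act T (scalar ((- 1) ^ (m + 3))) (p (m + 3)) \<oplus> act T (scalar c) (q (m + 2))"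
    using Y_power_z[of "m + 2"] unfolding Suc by blast
  then have "act T (scalar ((- 1) ^ (m + 3))) (p (m + 3)) = \<zero>"
    unfolding Y_z q0 act_zero by (simp only: M.r_zero act_closed pq_closed)
  then show ?case by (rule scalar_eq_zeroD[rotated]) simp_all
next
  case (step i)
  then show ?case by (simp only: pq_Suc act_zero)
qed

text \<open>
  The linear span of the vectors \<open>p i\<close> and \<open>q i\<close>. It is a submodule,
  since each generator can be moved past \<open>y'\<close> (\<open>W_act_induct\<close>).
\<close>

inductive_set W :: "'m set" where
  p: "p i \<in> W"
| q: "q i \<in> W"
| add: "s \<in> W \<Longrightarrow> t \<in> W \<Longrightarrow> s \<oplus> t \<in> W"
| scale: "t \<in> W \<Longrightarrow> act T (scalar c) t \<in> W"

lemma W_closed: "t \<in> W \<Longrightarrow> t \<in> carrier T"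
  by (induction rule: W.induct) auto

lemma W_zero: "\<zero> \<in> W"
  using W.scale[OF W.p, of 0] by (simp add: act_scalar_simps)

lemma W_actI:
  assumes "\<And>i. act T r (p i) \<in> W" "\<And>i. act T r (q i) \<in> W" "t \<in> W"
  shows "act T r t \<in> W"
  using assms(3)
  by (induction rule: W.induct)
    (simp_all add: assms(1,2) act_add act_scalar_commute[of _ r] W_closed W.add W.scale)

lemma W_y': "t \<in> W \<Longrightarrow> act T y' t \<in> W"
  by (rule W_actI) (simp_all only: W.p W.q flip: pq_Suc)

lemma W_x': "t \<in> W \<Longrightarrow> act T x' t \<in> W"
  by (rule W_actI) (simp_all only: x'_p x'_q W.q W_zero)

lemma W_act_induct:
  assumes z: "act T r z \<in> W" and xz: "act T r (act T x' z) \<in> W"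
    and step: "\<And>t. t \<in> W \<Longrightarrow> act T r t \<in> W \<Longrightarrow> act T r (act T y' t) \<in> W"
    and t: "t \<in> W"
  shows "act T r t \<in> W"
proof (rule W_actI[OF _ _ t])
  show "act T r (p i) \<in> W" for i
    by (induction i) (simp_all only: pq_0 pq_Suc z step W.p)
  show "act T r (q i) \<in> W" for i
    by (induction i) (simp_all only: pq_0 pq_Suc xz step W.q)
qed

lemma W_z: "z \<in> W" "act T x' z \<in> W"
  using W.p[of 0] W.q[of 0] by (simp_all only: pq_0)

lemma Ginv_z: "act T (gen Ginv) z = z"
  using act_relations(11)[OF z_closed] by (simp only: G_z)

lemma W_gen: "t \<in> W \<Longrightarrow> act T (gen a) t \<in> W"
proof -
  note rel = act_antipode_relations
  have G: "act T (gen G) t \<in> W" if "t \<in> W" for t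
    by (rule W_act_induct[OF _ _ _ that])
      (simp_all only: rel(3,4) W_closed z_closed G_z W_z W.add W_x' W_y')
  have Ginv: "act T (gen Ginv) t \<in> W" if "t \<in> W" for t
    by (rule W_act_induct[OF _ _ _ that])
      (simp_all only: rel(5,6) W_closed z_closed Ginv_z W_z W.add W_x' W_y' W.scale)
  have Xi: "act T (gen Xi) t \<in> W" if "t \<in> W" for t
    by (rule W_act_induct[OF _ _ _ that])
      (simp_all only: rel(1,2) W_closed z_closed Xi_z W_z W.add W_x' W_y' W.scale)
  have U: "act T (gen U) t \<in> W" if "t \<in> W" for t
    by (rule W_act_induct[OF _ _ _ that])
      (simp_all only: rel(8,9) W_closed z_closed U_z W_zero W_z W.add W_x' W_y' W.scale Ginv)
  have V: "act T (gen V) t \<in> W" if "t \<in> W" for t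
    by (rule W_act_induct[OF _ _ _ that])
      (simp_all only: rel(10,11) W_closed z_closed V_z W_zero W_z W.add W_x' W_y' W.scale Ginv Xi)
  have "act T (gen Y) t \<in> W" "act T (gen X) t \<in> W" if "t \<in> W" for t
    using that by (simp_all only: rel(12,13) W_closed W.scale G W_x' W_y')
  then show "t \<in> W \<Longrightarrow> act T (gen a) t \<in> W"
    using G Ginv Xi U V by (cases a) simp_all
qed

lemma W_act_z: "act T r z \<in> W"
proof (induction r rule: free_alg_induct)
  case (single w c)
  have "act T (prod_list (map gen ws)) z \<in> W" for ws
    by (induction ws) (simp_all add: W_z act_mult W_gen)
  then show ?case by (simp add: single_word act_mult W.scale)
next
  case (sum r s)
  then show ?case by (simp add: act_add_left W.add)
qed

end

lemma act_regular: "act (regular_module jordan_double) p (residue_class q) = residue_class (p * q)"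
  by (simp add: act_def regular_module_def residue_class_hom)

definition T_ideal :: "nat \<Rightarrow> 'k::field_char_0 jordan_double set" where
  "T_ideal k = generated_submodule jordan_double (regular_module jordan_double)
       (residue_class ` T_relations k)"

lemma T1_alt: "T1 k = quotient_module (regular_module jordan_double) (T_ideal k)"
  by (simp add: T1_def T_ideal_def)

lemma T_ideal:
  "left_submodule jordan_double (regular_module jordan_double) (T_ideal k :: 'k::field_char_0 jordan_double set)"
  "p \<in> T_relations k \<Longrightarrow> residue_class p \<in> (T_ideal k :: 'k jordan_double set)"
proof -
  have "residue_class ` T_relations k \<subseteq> carrier (regular_module (jordan_double :: 'k jordan_double ring))"
    using residue_class_closed by (auto simp: regular_module_def)
  note gen = left_submodule_generated[OF left_module_regular[OF ring_jordan_double] this, folded T_ideal_def]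
  show "left_submodule jordan_double (regular_module jordan_double) (T_ideal k :: 'k jordan_double set)"
    by (rule gen(1))
  show "p \<in> T_relations k \<Longrightarrow> residue_class p \<in> (T_ideal k :: 'k jordan_double set)"
    using gen(2) by blast
qed

lemma double_module_T1: "double_module (T1 k :: ('k::field_char_0 jordan_double, _) module)"
  unfolding double_module_def T1_alt
  by (rule left_module_quotient[OF left_module_regular[OF ring_jordan_double] T_ideal(1)])

definition T_gen :: "nat \<Rightarrow> 'k::field_char_0 jordan_double set" where
  "T_gen k = T_ideal k +>\<^bsub>regular_module jordan_double\<^esub> residue_class 1"

lemma act_T_gen:
  "act (T1 k) p (T_gen k) = T_ideal k +>\<^bsub>regular_module jordan_double\<^esub> residue_class p"
proof -
  have "residue_class 1 \<in> carrier (regular_module jordan_double)"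
    using residue_class_closed by (simp add: regular_module_def)
  from act_quotient[OF left_module_regular[OF ring_jordan_double] T_ideal(1) this]
  show ?thesis by (simp add: T_gen_def T1_alt act_regular)
qed

lemma carrier_T1: "carrier (T1 k) = range (\<lambda>p :: 'k::field_char_0 free_alg. act (T1 k) p (T_gen k))"
proof -
  have "carrier (regular_module jordan_double) = range (residue_class :: 'k free_alg \<Rightarrow> _)"
    by (auto simp: regular_module_def residue_class_closed elim: carrier_jordan_doubleE)
  then show ?thesis
    unfolding T1_alt carrier_quotient[OF left_module_regular[OF ring_jordan_double] T_ideal(1)]
    by (auto simp: image_iff T1_alt[symmetric] act_T_gen)
qed

lemma T_gen_closed: "T_gen k \<in> carrier (T1 k :: ('k::field_char_0 jordan_double, _) module)"
proof -
  interpret double_module "T1 k :: ('k jordan_double, _) module" by (rule double_module_T1)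
  have "T_gen k = act (T1 k) (1 :: 'k free_alg) (T_gen k)" by (simp add: act_T_gen) (simp add: T_gen_def)
  then show ?thesis unfolding carrier_T1 by blast
qed

lemma act_T_gen_eq_0_iff:
  "act (T1 k) p (T_gen k) = \<zero>\<^bsub>T1 k\<^esub> \<longleftrightarrow> residue_class p \<in> (T_ideal k :: 'k::field_char_0 jordan_double set)"
proof -
  have "residue_class p \<in> carrier (regular_module jordan_double)"
    using residue_class_closed by (simp add: regular_module_def)
  from quotient_zero_iff[OF left_module_regular[OF ring_jordan_double] T_ideal(1) this]
  show ?thesis unfolding act_T_gen by (simp add: T1_alt)
qed

lemma of_nat_scalar: "of_nat n = (scalar (of_nat n) :: 'k::field free_alg)"
  by (induction n) (simp_all add: scalar_hom)

lemma T_generator_T1: "T_generator (T1 m :: ('k::field_char_0 jordan_double, _) module) (T_gen m) m"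
proof -
  interpret T: double_module "T1 m :: ('k jordan_double, _) module" by (rule double_module_T1)
  let ?z = "T_gen m :: 'k jordan_double set"
  note z = T_gen_closed[of m, where 'k = 'k]
  have rel: "act (T1 m) p ?z = \<zero>\<^bsub>T1 m\<^esub>" if "p \<in> T_relations m" for p
    unfolding act_T_gen_eq_0_iff by (rule T_ideal(2)[OF that])
  have eq: "act (T1 m) p ?z = act (T1 m) q ?z" if "p - q \<in> T_relations m" for p q
    using rel[OF that] T.act_add_left[OF z, of "p - q" q] z by simp
  show ?thesis
  proof
    show "act (T1 m) (gen G) ?z = ?z"
      using eq[of "gen G" 1] z by (simp add: T_relations_def)
    show "act (T1 m) (gen Xi) ?z = act (T1 m) (scalar (of_nat (m + 2))) ?z"
      by (rule eq) (simp only: T_relations_def of_nat_scalar insert_iff simp_thms)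
    show "act (T1 m) (gen X) (act (T1 m) (gen X) ?z) = \<zero>\<^bsub>T1 m\<^esub>"
      using rel[of "gen X ^ 2"] z by (simp add: T_relations_def power2_eq_square T.act_mult)
    show "act (T1 m) (gen Y ^ (m + 1)) (act (T1 m) (gen X) ?z) = \<zero>\<^bsub>T1 m\<^esub>"
      using rel[of "gen Y ^ (m + 1) * gen X"] T.act_mult[OF z] by (simp add: T_relations_def)
    show "act (T1 m) (gen U) ?z = \<zero>\<^bsub>T1 m\<^esub>" "act (T1 m) (gen V) ?z = \<zero>\<^bsub>T1 m\<^esub>"
      "act (T1 m) (gen Y ^ (m + 3)) ?z = \<zero>\<^bsub>T1 m\<^esub>"
      by (rule rel, simp add: T_relations_def)+
  qed (rule z)
qed

section \<open>Models as duals of T(m, 1)\<close>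

context
  fixes m :: nat and \<kappa> :: "'k::field_char_0"
begin

abbreviation "\<phi> \<equiv> \<lambda>s :: nat + nat \<Rightarrow> 'k. s (Inl (m + 2))"

interpretation N: double_module "model m \<kappa>" by (rule model.double_module_rep)

interpretation T: T_generator "T1 m :: ('k jordan_double, _) module" "T_gen m" m
  by (rule T_generator_T1)

abbreviation "N \<equiv> model m \<kappa>"
abbreviation "T \<equiv> T1 m :: ('k jordan_double, 'k jordan_double set) module"
abbreviation "z \<equiv> T_gen m :: 'k jordan_double set"

lemma act_model_uminus: "s \<in> carrier N \<Longrightarrow> act N (- p) s = (\<lambda>i. - act N p s i)"
  using model.act_rep_module[of s m \<kappa>] model.rep_uminus[of m \<kappa> p s]
  by (simp add: model.rep_module_def)

lemma act_model_add: "s \<in> carrier N \<Longrightarrow> act N (p + q) s = (\<lambda>i. act N p s i + act N q s i)"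
  by (simp add: N.act_add_left model_simps(2))

lemma model_zero: "s \<in> carrier N \<Longrightarrow> \<not> i \<le> m + 2 \<Longrightarrow> s (Inl i) = 0" "s \<in> carrier N \<Longrightarrow> \<not> j \<le> m \<Longrightarrow> s (Inr j) = 0"
  by (simp_all add: model_simps(1))

lemma act_model_gen_closed: "s \<in> carrier N \<Longrightarrow> model_gen m \<kappa> a s \<in> carrier N"
  using model_gen_closed[of s m \<kappa> a] by (simp add: model.rep_module_def)

lemma act_model_antipode:
  assumes s: "s \<in> carrier N"
  shows "act N (antipode_gen Y) s = (\<lambda>i. - model_gen m \<kappa> Ginv (model_gen m \<kappa> Y s) i)" (is ?r1)
    "act N (antipode_gen X) s = (\<lambda>i. - model_gen m \<kappa> Ginv (model_gen m \<kappa> X s) i)" (is ?r2)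
    "act N (antipode_gen U) s = (\<lambda>i. - model_gen m \<kappa> U s i)" (is ?r3)
    "act N (antipode_gen Xi) s = (\<lambda>i. - model_gen m \<kappa> Xi s i)" (is ?r4)
    "act N (antipode_gen G) s = model_gen m \<kappa> Ginv s" (is ?r5)
    "act N (antipode_gen V) s = (\<lambda>i. - model_gen m \<kappa> V s i - 1 / 2 * model_gen m \<kappa> Xi (model_gen m \<kappa> U s) i)" (is ?r6)
proof -
  note c = act_model_gen_closed[OF s]
  have V: "antipode_gen V = - gen V + - (scalar (1 / 2) * (gen Xi * gen U) :: 'k free_alg)"
    by (simp add: mult.assoc)
  show ?r1 ?r2
    by (simp_all only: antipode_gen.simps N.act_mult s act_model(1) act_model_uminus c)
  show ?r3 ?r4 ?r5
    by (simp_all only: antipode_gen.simps s act_model(1) act_model_uminus)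
  have "act N (antipode_gen V) s = (\<lambda>i. act N (- gen V) s i + act N (- (scalar (1 / 2) * (gen Xi * gen U))) s i)"
    unfolding V by (rule act_model_add[OF s])
  also have "\<dots> = (\<lambda>i. - model_gen m \<kappa> V s i - 1 / 2 * model_gen m \<kappa> Xi (model_gen m \<kappa> U s) i)"
    by (simp only: act_model_uminus s N.act_mult act_model c act_model_gen_closed[OF c] add_uminus_conv_diff)
  finally show ?r6 .
qed

lemma antipode_Y_power_model:
  assumes "s \<in> carrier N"
  shows "(\<forall>i<k. act N (antipode_gen Y ^ k) s (Inl i) = 0) \<and> (\<forall>j<k. act N (antipode_gen Y ^ k) s (Inr j) = 0)"
proof (induction k)
  case (Suc k)
  let ?t = "act N (antipode_gen Y ^ k) s"
  have t: "?t \<in> carrier N" by (rule N.act_closed[OF assms])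
  have "act N (antipode_gen Y ^ Suc k) s = (\<lambda>i. - model_gen m \<kappa> Ginv (model_gen m \<kappa> Y ?t) i)"
    by (simp only: power_Suc N.act_mult assms t act_model_antipode(1))
  moreover have "model_gen m \<kappa> Ginv (model_gen m \<kappa> Y t) (Inl i) = 0"
    "model_gen m \<kappa> Ginv (model_gen m \<kappa> Y t) (Inr i) = 0"
    if "\<forall>i<k. t (Inl i) = 0" "\<forall>i<k. t (Inr i) = 0" "i < Suc k" for t i
    using that by (cases i; cases "i - 1"; simp add: model_gen_def)+
  ultimately show ?case using Suc by simp
qed simp

lemma phi_Ginv: "s \<in> carrier N \<Longrightarrow> \<phi> (act N (gen Ginv) s) = \<phi> s"
  by (simp add: act_model model_gen_def)

text \<open>
  The functional \<open>\<phi>\<close> reads off the coefficient of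
  \<open>z\<^sub>m\<^sub>+\<^sub>2\<^sub>,\<^sub>m\<^sub>+\<^sub>2\<close>, the vector of lowest
  weight. The relations for \<open>g\<close>, \<open>\<xi>\<close>, \<open>u\<close> and
  \<open>v\<close> express its weight and the vanishing of the linear factors in the model at the
  index \<open>m + 2\<close>; those for powers of \<open>y\<close> hold because \<open>y'\<close>
  raises indices.
\<close>

lemma phi_relation:
  assumes p: "p \<in> T_relations m" and s: "s \<in> carrier N"
  shows "\<phi> (act N (antipode_free p) s) = 0"
proof -
  have pow: "antipode_free (gen a ^ k) = (antipode_gen a ^ k :: 'k free_alg)" for a k
    by (induction k) (simp_all only: power_0 power_Suc power_Suc2[symmetric] antipode_free_one
        antipode_free_mult antipode_free_gen power_commutes)
  have X0: "model_gen m \<kappa> X t = (\<lambda>i. 0)" if "\<And>j. j \<le> m \<Longrightarrow> t (Inr j) = 0" "t \<in> carrier N" for t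
    using that(1) model_zero(2)[OF that(2)]
    by (intro model_ext) (simp_all add: model_gen_def, metis)
  note c = act_model_gen_closed[OF s]
  consider "p = gen G - 1" | "p = gen Xi - of_nat (m + 2)" | "p = gen U" | "p = gen V"
    | "p = gen X ^ 2" | "p = gen Y ^ (m + 3)" | "p = gen Y ^ (m + 1) * gen X"
    using p by (auto simp: T_relations_def)
  then show ?thesis
  proof cases
    case 1
    have "antipode_free p = antipode_gen G + - (1 :: 'k free_alg)"
      unfolding 1 by (simp only: antipode_free_diff antipode_free_gen antipode_free_one add_uminus_conv_diff)
    then show ?thesis
      using s by (simp only: act_model_add act_model_uminus act_model_antipode N.act_one)
        (simp add: model_gen_def)
  next
    case 2
    have "antipode_free p = antipode_gen Xi + - (scalar (of_nat (m + 2)) :: 'k free_alg)"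
      unfolding 2 of_nat_scalar
      by (simp only: antipode_free_diff antipode_free_gen antipode_free_scalar add_uminus_conv_diff)
    then show ?thesis
      using s by (simp only: act_model_add act_model_uminus act_model_antipode act_model)
        (simp add: model_gen_def algebra_simps)
  next
    case 3
    then show ?thesis
      using s by (simp only: antipode_free_gen act_model_antipode) (simp add: model_gen_def)
  next
    case 4
    then show ?thesis
      using s model_zero(1)[OF s, of "m + 3"]
      by (simp only: antipode_free_gen act_model_antipode) (simp add: model_gen_def)
  next
    case 5
    let ?t = "act N (antipode_gen X) s"
    have t: "?t \<in> carrier N" by (rule N.act_closed[OF s])
    have "model_gen m \<kappa> X ?t = (\<lambda>i. 0)"
    proof (rule X0[OF _ t])
      show "?t (Inr j) = 0" for j
        by (simp only: act_model_antipode(2)[OF s]) (simp add: model_gen_def)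
    qed
    then have "act N (antipode_gen X) ?t = (\<lambda>i. - model_gen m \<kappa> Ginv (\<lambda>i. 0) i)"
      by (simp only: act_model_antipode(2)[OF t])
    then have "\<phi> (act N (antipode_gen X * antipode_gen X) s) = 0"
      by (simp only: N.act_mult[OF s]) (simp add: model_gen_def)
    then show ?thesis unfolding 5 pow unfolding power2_eq_square .
  next
    case 6
    have t: "act N (antipode_gen Y ^ (m + 3)) s \<in> carrier N" by (rule N.act_closed[OF s])
    show ?thesis
      using antipode_Y_power_model[OF s, of "m + 3"] by (simp only: 6 pow)
  next
    case 7
    let ?t = "act N (antipode_gen Y ^ (m + 1)) s"
    have t: "?t \<in> carrier N" by (rule N.act_closed[OF s])
    have "model_gen m \<kappa> X ?t = (\<lambda>i. 0)"
      using antipode_Y_power_model[OF s, of "m + 1"] by (intro X0[OF _ t]) simp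
    then have "act N (antipode_gen X) ?t = (\<lambda>i. - model_gen m \<kappa> Ginv (\<lambda>i. 0) i)"
      by (simp only: act_model_antipode(2)[OF t])
    then show ?thesis
      using s by (simp only: 7 antipode_free_mult pow antipode_free_gen N.act_mult)
        (simp add: model_gen_def)
  qed
qed

text \<open>
  The classes whose antipode is annihilated by \<open>\<phi>\<close> form a left ideal, as the
  antipode reverses products.
\<close>

lemma phi_T_ideal:
  assumes "residue_class p \<in> T_ideal m" and s: "s \<in> carrier N"
  shows "\<phi> (act N (antipode_free p) s) = 0"
proof -
  define K :: "'k jordan_double set" where
    "K = {residue_class p | p. \<forall>s\<in>carrier N. \<phi> (act N (antipode_free p) s) = 0}"
  have indep: "act N (antipode_free p) s = act N (antipode_free q) s" if "residue_class p = residue_class q" for p q s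
  proof (rule N.act_cong)
    show "cls (antipode_free p) = cls (antipode_free q)"
      using antipode_residue_class[of p] antipode_residue_class[of q] that by (simp add: cls_eq_iff)
  qed
  (* By indep, membership of a class in K does not depend on its representative. *)
  have "left_submodule jordan_double (regular_module jordan_double) K"
  proof (rule left_submoduleI[OF left_module_regular[OF ring_jordan_double]])
    show "K \<subseteq> carrier (regular_module jordan_double)"
      by (auto simp: K_def regular_module_def residue_class_closed)
    have "antipode_free 0 = (0 :: 'k free_alg)"
      using antipode_free_scalar[of "0 :: 'k"] by (simp add: scalar_hom)
    then have "\<forall>s\<in>carrier N. \<phi> (act N (antipode_free 0) s) = 0"
      by (simp add: model_simps(3))
    then show "\<zero>\<^bsub>regular_module jordan_double\<^esub> \<in> K"
      unfolding K_def regular_module_def by (auto simp: residue_class_hom)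
  next
    fix a b assume "a \<in> K" "b \<in> K"
    then obtain p q where "a = residue_class p" "b = residue_class q"
      and "\<forall>s\<in>carrier N. \<phi> (act N (antipode_free p) s) = 0"
      and "\<forall>s\<in>carrier N. \<phi> (act N (antipode_free q) s) = 0"
      by (auto simp: K_def)
    then show "a \<oplus>\<^bsub>regular_module jordan_double\<^esub> b \<in> K"
      unfolding K_def regular_module_def
      by (auto simp: residue_class_hom antipode_free_add act_model_add intro!: exI[of _ "p + q"])
  next
    fix r a :: "'k jordan_double" assume "r \<in> carrier jordan_double" "a \<in> K"
    then obtain p q where "r = residue_class p" "a = residue_class q"
      and "\<forall>s\<in>carrier N. \<phi> (act N (antipode_free q) s) = 0"
      by (auto simp: K_def elim: carrier_jordan_doubleE)
    then show "r \<odot>\<^bsub>regular_module jordan_double\<^esub> a \<in> K"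
      unfolding K_def regular_module_def
      by (auto simp: residue_class_hom antipode_free_mult N.act_mult intro!: exI[of _ "p * q"])
  qed
  moreover have "residue_class ` T_relations m \<subseteq> K"
    using phi_relation by (auto simp: K_def)
  ultimately have "T_ideal m \<subseteq> K"
    unfolding T_ideal_def by (rule generated_submodule_minimal)
  then obtain q where "residue_class p = residue_class q" "\<phi> (act N (antipode_free q) s) = 0"
    using assms by (auto simp: K_def)
  then show ?thesis using indep[of p q s] by simp
qed

text \<open>
  The functional \<open>to_dual s\<close> sends \<open>p z\<close> to \<open>\<phi> (S(p)
  g\<^sup>-\<^sup>1 s)\<close>, where \<open>S\<close> is the antipode. Without
  \<open>g\<^sup>-\<^sup>1\<close> the map would not be a homomorphism but would twist the action
  by \<open>S\<^sup>2\<close>; as \<open>S\<^sup>2(e) g\<^sup>-\<^sup>1 = g\<^sup>-\<^sup>1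
  e\<close>, the factor corrects this.
\<close>

definition to_dual :: "(nat + nat \<Rightarrow> 'k) \<Rightarrow> 'k jordan_double set \<Rightarrow> 'k" where
  "to_dual s = (\<lambda>t\<in>carrier T.
     \<phi> (act N (antipode_free (SOME p. t = act T p z)) (act N (gen Ginv) s)))"

lemma to_dual_act:
  assumes s: "s \<in> carrier N"
  shows "to_dual s (act T p z) = \<phi> (act N (antipode_free p) (act N (gen Ginv) s))"
proof -
  let ?q = "SOME q. act T p z = act T q z"
  have "act T p z = act T ?q z" by (rule someI[of _ p]) simp
  then have "act T (p - ?q) z = \<zero>\<^bsub>T\<^esub>"
    using T.act_add_left[OF T.z_closed, of p "- ?q"] T.act_uminus_left[OF T.z_closed, of ?q]
    by (simp add: T.M.r_neg)
  then have "\<phi> (act N (antipode_free (p - ?q)) (act N (gen Ginv) s)) = 0"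
    using s by (intro phi_T_ideal) (simp_all only: act_T_gen_eq_0_iff N.act_closed)
  moreover have "antipode_free p = antipode_free (p - ?q) + antipode_free ?q"
    by (simp add: antipode_free_diff)
  ultimately have "\<phi> (act N (antipode_free p) (act N (gen Ginv) s)) = \<phi> (act N (antipode_free ?q) (act N (gen Ginv) s))"
    using s by (simp only: act_model_add N.act_closed add_0)
  moreover have "act T p z \<in> carrier T" by simp
  ultimately show ?thesis unfolding to_dual_def by (simp only: restrict_apply if_True)
qed

lemma act_T_surj: "t \<in> carrier T \<Longrightarrow> \<exists>p. t = act T p z"
  using carrier_T1[of m, where 'k = 'k] by blast

lemma antipode_square_act:
  assumes "s \<in> carrier N"
  shows "act N (antipode_free (antipode_free e)) (act N (gen Ginv) s) = act N (gen Ginv) (act N e s)"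
proof -
  have "act N (antipode_free (antipode_free e) * gen Ginv) s = act N (gen Ginv * e) s"
    by (rule N.act_cong) (simp add: cls_hom antipode_square)
  then show ?thesis using assms by (simp only: N.act_mult)
qed

lemma to_dual_hom: "to_dual \<in> module_hom jordan_double N (dual_module T)"
proof (rule module_homI)
  fix s assume s: "s \<in> carrier N"
  have "to_dual s (a \<oplus>\<^bsub>T\<^esub> b) = to_dual s a + to_dual s b" if ab: "a \<in> carrier T" "b \<in> carrier T" for a b
  proof -
    obtain p q where "a = act T p z" "b = act T q z" using act_T_surj ab by blast
    then show ?thesis
      using s by (simp add: to_dual_act antipode_free_add act_model_add flip: T.act_add_left)
  qed
  moreover have "to_dual s (kscale T c a) = c * to_dual s a" if a: "a \<in> carrier T" for a c
  proof -
    obtain p where p: "a = act T p z" using act_T_surj a by blast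
    have "to_dual s (kscale T c a) = \<phi> (act N (scalar c * antipode_free p) (act N (gen Ginv) s))"
      using s by (simp add: p kscale_act to_dual_act antipode_free_mult antipode_free_scalar
          scalar_central flip: T.act_mult)
    also have "\<dots> = c * to_dual s a"
      using s by (simp add: p to_dual_act N.act_mult act_model(2))
    finally show ?thesis .
  qed
  ultimately show "to_dual s \<in> carrier (dual_module T)"
    by (simp add: dual_module_def) (simp add: to_dual_def)
next
  fix s t assume s: "s \<in> carrier N" and t: "t \<in> carrier N"
  have "to_dual (s \<oplus>\<^bsub>N\<^esub> t) a = to_dual s a + to_dual t a" if a: "a \<in> carrier T" for a
  proof -
    obtain p where "a = act T p z" using act_T_surj a by blast
    then show ?thesis
      using s t by (simp only: to_dual_act N.act_add N.act_closed N.M.a_closed) (simp only: model_simps(2))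
  qed
  then show "to_dual (s \<oplus>\<^bsub>N\<^esub> t) = to_dual s \<oplus>\<^bsub>dual_module T\<^esub> to_dual t"
    by (intro extensionalityI[of _ "carrier T"]) (simp_all add: dual_module_def, simp add: to_dual_def)
next
  fix r :: "'k jordan_double" and s assume r: "r \<in> carrier jordan_double" and s: "s \<in> carrier N"
  obtain e where e: "r = residue_class e" using r by (blast elim: carrier_jordan_doubleE)
  have "to_dual (act N e s) t = to_dual s (act T (antipode_free e) t)" if t: "t \<in> carrier T" for t
  proof -
    obtain p where p: "t = act T p z" using act_T_surj t by blast
    have "to_dual s (act T (antipode_free e) t) = to_dual s (act T (antipode_free e * p) z)"
      by (simp add: p T.act_mult)
    also have "\<dots> = \<phi> (act N (antipode_free p) (act N (antipode_free (antipode_free e)) (act N (gen Ginv) s)))"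
      using s by (simp only: to_dual_act antipode_free_mult N.act_mult N.act_closed)
    also have "\<dots> = to_dual (act N e s) t"
      using s by (simp only: antipode_square_act p to_dual_act N.act_closed)
    finally show ?thesis by simp
  qed
  then have "to_dual (act N e s) = r \<odot>\<^bsub>dual_module T\<^esub> to_dual s"
    by (intro ext)
      (simp add: dual_module_def e antipode_residue_class flip: act_def, simp add: to_dual_def)
  then show "to_dual (r \<odot>\<^bsub>N\<^esub> s) = r \<odot>\<^bsub>dual_module T\<^esub> to_dual s"
    by (simp add: e act_def)
qed

lemma Y_power_model:
  assumes s: "s \<in> carrier N"
  shows "act N (gen Y ^ i) s (Inl k) = (if i \<le> k \<and> k \<le> m + 2 then s (Inl (k - i)) else 0)" (is ?r1)
    "act N (gen Y ^ i) s (Inr j) = (if i \<le> j \<and> j \<le> m then s (Inr (j - i)) else 0)" (is ?r2)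
proof -
  have "act N (gen Y ^ i) s = case_sum (\<lambda>k. if i \<le> k \<and> k \<le> m + 2 then s (Inl (k - i)) else 0)
    (\<lambda>j. if i \<le> j \<and> j \<le> m then s (Inr (j - i)) else 0)"
  proof (induction i)
    case 0
    show ?case using model_zero[OF s] s by (auto simp: fun_eq_iff split: sum.splits)
  next
    case (Suc i)
    have step: "act N (gen Y ^ Suc i) s = model_gen m \<kappa> Y (act N (gen Y ^ i) s)"
      using s by (simp only: power_Suc N.act_mult N.act_closed act_model(1))
    show ?case
      unfolding step Suc by (auto simp: model_gen_def fun_eq_iff split: sum.splits)
  qed
  then show ?r1 ?r2
    by simp_all
qed

lemma antipode_Y_power: "antipode_free (gen Y ^ i) = antipode_gen Y ^ i"
  by (induction i)
    (simp_all only: power_0 power_Suc power_Suc2[symmetric] antipode_free_one antipode_free_mult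
      antipode_free_gen power_commutes)

lemma to_dual_p:
  assumes s: "s \<in> carrier N"
  shows "to_dual s (T.p i) = (if i \<le> m + 2 then s (Inl (m + 2 - i)) else 0)"
proof -
  have "to_dual s (T.p i) = \<phi> (act N (gen Y ^ i) s)"
    unfolding T.p_def antipode_Y_power[symmetric] to_dual_act[OF s] antipode_square_act[OF s]
    using s by (simp only: phi_Ginv N.act_closed)
  then show ?thesis by (simp add: Y_power_model[OF s])
qed

lemma to_dual_q:
  assumes s: "s \<in> carrier N"
  shows "to_dual s (T.q i) = (if i \<le> m then \<kappa> * s (Inr (m - i)) else 0)"
proof -
  have q: "T.q i = act T (antipode_free (gen X * gen Y ^ i)) z"
    by (simp only: T.q_def antipode_free_mult antipode_Y_power antipode_free_gen T.act_mult T.z_closed)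
  have "to_dual s (T.q i) = \<phi> (act N (gen X) (act N (gen Y ^ i) s))"
    unfolding q to_dual_act[OF s] antipode_square_act[OF s]
    using s by (simp only: phi_Ginv N.act_mult N.act_closed)
  then show ?thesis using s by (simp add: Y_power_model[OF s] act_model model_gen_def)
qed

lemma dual_eqI:
  assumes f: "f \<in> carrier (dual_module T)" and h: "h \<in> carrier (dual_module T)"
    and p: "\<And>i. f (T.p i) = h (T.p i)" and q: "\<And>i. f (T.q i) = h (T.q i)"
  shows "f = h"
proof -
  have "f t = h t" if "t \<in> T.W" for t
    using that
    by (induction rule: T.W.induct)
      (use f h p q in \<open>simp_all add: dual_module_def kscale_act T.W_closed\<close>)
  then have "f t = h t" if "t \<in> carrier T" for t
    using act_T_surj[OF that] T.W_act_z by blast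
  moreover have "f \<in> extensional (carrier T)" "h \<in> extensional (carrier T)"
    using f h by (simp_all add: dual_module_def)
  ultimately show ?thesis by (intro extensionalityI)
qed

text \<open>
  On the spanning vectors \<open>p i\<close> and \<open>q i\<close> a functional \<open>to_dual
  s\<close> takes as values the coordinates of \<open>s\<close>, those in \<open>L(m)\<close>
  multiplied by \<open>\<kappa>\<close>. For \<open>\<kappa> \<noteq> 0\<close> they can be
  prescribed.
\<close>

lemma to_dual_bij:
  assumes \<kappa>: "\<kappa> \<noteq> 0"
  shows "bij_betw to_dual (carrier N) (carrier (dual_module T))"
proof (rule bij_betwI')
  fix s t assume s: "s \<in> carrier N" and t: "t \<in> carrier N"
  show "to_dual s = to_dual t \<longleftrightarrow> s = t"
  proof
    assume eq: "to_dual s = to_dual t"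
    have "s (Inl k) = t (Inl k)" for k
    proof (cases "k \<le> m + 2")
      case True
      then show ?thesis using to_dual_p[OF s, of "m + 2 - k"] to_dual_p[OF t, of "m + 2 - k"] eq by simp
    qed (simp add: model_zero[OF s] model_zero[OF t])
    moreover have "s (Inr k) = t (Inr k)" for k
    proof (cases "k \<le> m")
      case True
      then show ?thesis using to_dual_q[OF s, of "m - k"] to_dual_q[OF t, of "m - k"] eq \<kappa> by simp
    qed (simp add: model_zero[OF s] model_zero[OF t])
    ultimately show "s = t" by (auto simp: fun_eq_iff split_sum_all)
  qed simp
next
  fix s assume "s \<in> carrier N"
  then show "to_dual s \<in> carrier (dual_module T)" by (rule module_homD(1)[OF to_dual_hom])
next
  fix f assume f: "f \<in> carrier (dual_module T)"
  define s where "s = case_sum (\<lambda>k. if k \<le> m + 2 then f (T.p (m + 2 - k)) else 0)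
     (\<lambda>j. if j \<le> m then inverse \<kappa> * f (T.q (m - j)) else 0)"
  have s: "s \<in> carrier N" by (simp add: s_def model_simps(1))
  have "\<zero>\<^bsub>T\<^esub> = kscale T 0 (T.p 0)" by (simp add: kscale_act T.act_scalar_simps)
  then have f0: "f \<zero>\<^bsub>T\<^esub> = 0" using f by (simp add: dual_module_def)
  have "f = to_dual s"
  proof (rule dual_eqI[OF f module_homD(1)[OF to_dual_hom s]])
    show "f (T.p i) = to_dual s (T.p i)" for i
      unfolding to_dual_p[OF s] using T.p_vanish[of i] f0 by (simp add: s_def)
    show "f (T.q i) = to_dual s (T.q i)" for i
      unfolding to_dual_q[OF s] using T.q_vanish[of i] f0 \<kappa> by (simp add: s_def)
  qed
  then show "\<exists>s\<in>carrier N. f = to_dual s" using s by blast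
qed

end

lemma model_isomorphic_dual_T1:
  assumes "\<kappa> \<noteq> 0"
  shows "isomorphic_modules jordan_double (model m \<kappa>) (dual_module (T1 m))"
  using to_dual_hom[of m \<kappa>] to_dual_bij[OF assms, of m]
  by (auto simp: isomorphic_modules_def module_iso_def)

section \<open>The space of extension classes\<close>

lemma ex_x_coefficient:
  fixes E :: "('k::field_char_0, 's) weight_extension"
  assumes E: "is_extension jordan_double (L (m + 2)) (L m) E"
  obtains \<kappa> where "equivalent_extensions jordan_double (L (m + 2)) (model_extension m \<kappa>) E"
    "x_coefficient (m + 2) E \<kappa>"
proof -
  obtain \<kappa> where \<kappa>: "equivalent_extensions jordan_double (L (m + 2)) (model_extension m \<kappa>) E"
    using extension_equivalent_model[OF E] by blast
  have "x_coefficient (m + 2) E \<kappa>"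
    by (rule x_coefficient_equivalent[OF _ _ \<kappa> x_coefficient_model])
      (simp_all add: is_extension_model E)
  with \<kappa> show ?thesis by (rule that)
qed

text \<open>
  Both extensions are equivalent to the model with their coefficient.
\<close>

lemma equivalent_iff_x_coefficient:
  fixes E :: "('k::field_char_0, 's) weight_extension"
    and F :: "('k, 't) weight_extension"
  assumes E: "is_extension jordan_double (L (m + 2)) (L m) E"
    and F: "is_extension jordan_double (L (m + 2)) (L m) F"
    and c: "x_coefficient (m + 2) E c"
  shows "equivalent_extensions jordan_double (L (m + 2)) E F \<longleftrightarrow> x_coefficient (m + 2) F c"
proof
  assume "equivalent_extensions jordan_double (L (m + 2)) E F"
  then show "x_coefficient (m + 2) F c"
    by (rule x_coefficient_equivalent[OF _ _ _ c, rotated 2]) (simp_all add: E F)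
next
  assume d: "x_coefficient (m + 2) F c"
  obtain \<kappa> where \<kappa>: "equivalent_extensions jordan_double (L (m + 2)) (model_extension m \<kappa>) E"
    "x_coefficient (m + 2) E \<kappa>"
    by (rule ex_x_coefficient[OF E])
  obtain \<kappa>' where \<kappa>': "equivalent_extensions jordan_double (L (m + 2)) (model_extension m \<kappa>') F"
    "x_coefficient (m + 2) F \<kappa>'"
    by (rule ex_x_coefficient[OF F])
  have "\<kappa> = c" "\<kappa>' = c"
    using x_coefficient_unique[of "m + 2" E \<kappa> c] x_coefficient_unique[of "m + 2" F \<kappa>' c]
      E F \<kappa>(2) \<kappa>'(2) c d by simp_all
  with \<kappa>(1) \<kappa>'(1) show "equivalent_extensions jordan_double (L (m + 2)) E F"
    using equivalent_extensions_trans[OF equivalent_extensions_sym[OF is_extension_model]] by blast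
qed

text \<open>
  The coefficient identifies the space of extension classes with the field: it is additive for
  Baer sums, multiplicative for pushouts along scalars, and takes every value, on the models.
\<close>

definition ext_class ::
    "nat \<Rightarrow> 'k::field_char_0 \<Rightarrow>
      ('k, (nat \<Rightarrow> 'k) \<times> (nat \<Rightarrow> 'k)) weight_extension set" where
  "ext_class m c =
     {E. is_extension jordan_double (L (m + 2)) (L m) E \<and> x_coefficient (m + 2) E c}"

lemma extension_class_eq:
  fixes E :: "('k::field_char_0, 's) weight_extension"
  assumes "is_extension jordan_double (L (m + 2)) (L m) E" "x_coefficient (m + 2) E c"
  shows "extension_class jordan_double (L (m + 2)) (L m) E = ext_class m c"
  using equivalent_iff_x_coefficient[OF assms(1) _ assms(2)]
  by (auto simp: extension_class_def ext_class_def)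

lemma ext_class_nonempty: "ext_class m c \<noteq> {}"
proof -
  obtain E :: "('a, (nat \<Rightarrow> 'a) \<times> (nat \<Rightarrow> 'a)) weight_extension"
    where "is_extension jordan_double (L (m + 2)) (L m) E"
      "equivalent_extensions jordan_double (L (m + 2)) (model_extension m c) E"
    using extension_on_product[OF is_extension_model[of m c]] by blast
  then have "E \<in> ext_class m c"
    using equivalent_iff_x_coefficient[OF is_extension_model _ x_coefficient_model, of m E c]
    by (simp add: ext_class_def)
  then show ?thesis by blast
qed

lemma ext_class_inj:
  assumes "ext_class m c = ext_class m d"
  shows "c = d"
proof -
  obtain E where E: "E \<in> ext_class m c" "E \<in> ext_class m d"
    using ext_class_nonempty[of m c] assms by blast
  then show ?thesis
    using x_coefficient_unique[of "m + 2" E c d] by (simp add: ext_class_def)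
qed

lemma Ext1_simps:
  fixes a c d :: "'k::field_char_0"
  shows
  "carrier (Ext1 (L (m + 2)) (L m)) = range (ext_class m :: 'k \<Rightarrow> _)"
  "\<zero>\<^bsub>Ext1 (L (m + 2)) (L m)\<^esub> = ext_class m (0 :: 'k)"
  "ext_class m c \<oplus>\<^bsub>Ext1 (L (m + 2)) (L m)\<^esub> ext_class m d = ext_class m (c + d)"
  "a \<odot>\<^bsub>Ext1 (L (m + 2)) (L m)\<^esub> ext_class m c = ext_class m (a * c)"
proof -
  show "carrier (Ext1 (L (m + 2)) (L m)) = range (ext_class m :: 'k \<Rightarrow> _)"
  proof (intro equalityI subsetI)
    fix P assume "P \<in> carrier (Ext1 (L (m + 2)) (L m :: ('k jordan_double, _) module))"
    then obtain E :: "('k, (nat \<Rightarrow> 'k) \<times> (nat \<Rightarrow> 'k)) weight_extension"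
      where E: "is_extension jordan_double (L (m + 2)) (L m) E" "P = extension_class jordan_double (L (m + 2)) (L m) E"
      by (auto simp: Ext1_def)
    moreover obtain c where "x_coefficient (m + 2) E c" by (rule ex_x_coefficient[OF E(1)])
    ultimately show "P \<in> range (ext_class m)" using extension_class_eq by blast
  next
    fix P assume "P \<in> range (ext_class m :: 'k \<Rightarrow> _)"
    then obtain c where "P = ext_class m c" by blast
    moreover obtain E where "E \<in> ext_class m c" using ext_class_nonempty by blast
    ultimately have "is_extension jordan_double (L (m + 2)) (L m) E" "P = extension_class jordan_double (L (m + 2)) (L m) E"
      using extension_class_eq by (auto simp: ext_class_def)
    then show "P \<in> carrier (Ext1 (L (m + 2)) (L m))" by (auto simp: Ext1_def)
  qed
  show "\<zero>\<^bsub>Ext1 (L (m + 2)) (L m)\<^esub> = ext_class m (0 :: 'k)"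
    using extension_class_eq[OF is_extension_split[OF left_module_L left_module_L]]
      x_coefficient_split[of "m + 2"] by (simp add: Ext1_def)
  have sum: "extension_class jordan_double (L (m + 2)) (L m) (baer_sum (L (m + 2)) E F) = ext_class m (c + d)"
    if "E \<in> ext_class m c" "F \<in> ext_class m d" for E F
    using that is_extension_baer_sum(1)[of jordan_double "L (m + 2)" "L m" E F] x_coefficient_baer_sum[of "m + 2" E F c d]
    by (intro extension_class_eq) (simp_all add: ext_class_def)
  show "ext_class m c \<oplus>\<^bsub>Ext1 (L (m + 2)) (L m)\<^esub> ext_class m d = ext_class m (c + d)"
  proof -
    have "ext_class m c \<oplus>\<^bsub>Ext1 (L (m + 2)) (L m)\<^esub> ext_class m d = (\<Union>E\<in>ext_class m c. \<Union>F\<in>ext_class m d. ext_class m (c + d))"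
      by (simp add: Ext1_def sum)
    then show ?thesis using ext_class_nonempty[of m c] ext_class_nonempty[of m d] by simp
  qed
  have push: "extension_class jordan_double (L (m + 2)) (L m) (pushout_extension (L (m + 2)) (kscale (L (m + 2)) a) E) = ext_class m (a * c)"
    if "E \<in> ext_class m c" for E
    using that is_extension_pushout(1)[OF _ kscale_L_hom, of "m + 2" "L m" E a] x_coefficient_pushout[of "m + 2" E c a]
    by (intro extension_class_eq) (simp_all add: ext_class_def)
  show "a \<odot>\<^bsub>Ext1 (L (m + 2)) (L m)\<^esub> ext_class m c = ext_class m (a * c)"
  proof -
    have "a \<odot>\<^bsub>Ext1 (L (m + 2)) (L m)\<^esub> ext_class m c = (\<Union>E\<in>ext_class m c. ext_class m (a * c))"
      by (simp add: Ext1_def push)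
    then show ?thesis using ext_class_nonempty[of m c] by simp
  qed
qed

lemma vectorspace_Ext1:
  "vectorspace class_ring (Ext1 (L (m + 2)) (L m :: ('k::field_char_0 jordan_double, _) module))"
proof (rule vs_criteria)
  show "field (class_ring :: 'k ring)" by (rule class_field)
  show "\<forall>v\<in>carrier (Ext1 (L (m + 2)) (L m :: ('k jordan_double, _) module)). \<exists>w\<in>carrier (Ext1 (L (m + 2)) (L m)). v \<oplus>\<^bsub>Ext1 (L (m + 2)) (L m)\<^esub> w = \<zero>\<^bsub>Ext1 (L (m + 2)) (L m)\<^esub>"
  proof
    fix v assume "v \<in> carrier (Ext1 (L (m + 2)) (L m :: ('k jordan_double, _) module))"
    then obtain c where "v = ext_class m c" by (auto simp: Ext1_simps(1))
    then show "\<exists>w\<in>carrier (Ext1 (L (m + 2)) (L m)). v \<oplus>\<^bsub>Ext1 (L (m + 2)) (L m)\<^esub> w = \<zero>\<^bsub>Ext1 (L (m + 2)) (L m)\<^esub>"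
      by (intro bexI[of _ "ext_class m (- c)"]) (simp_all add: Ext1_simps)
  qed
qed (auto simp: Ext1_simps algebra_simps)

lemma dim_Ext1:
  "vectorspace.fin_dim class_ring (Ext1 (L (m + 2)) (L m :: ('k::field_char_0 jordan_double, _) module))"
  "vectorspace.dim class_ring (Ext1 (L (m + 2)) (L m :: ('k jordan_double, _) module)) = 1"
proof -
  let ?Ext = "Ext1 (L (m + 2)) (L m :: ('k jordan_double, _) module)"
  interpret V: vectorspace class_ring ?Ext by (rule vectorspace_Ext1)
  let ?v = "ext_class m (1 :: 'k)"
  have v: "?v \<in> carrier ?Ext" by (simp add: Ext1_simps)
  have gen: "V.span {?v} = carrier ?Ext"
  proof (intro equalityI subsetI)
    fix P assume "P \<in> carrier ?Ext"
    then obtain c where "P = c \<odot>\<^bsub>?Ext\<^esub> ?v" by (auto simp: Ext1_simps)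
    moreover have "V.lincomb (\<lambda>_. c) {?v} = c \<odot>\<^bsub>?Ext\<^esub> ?v"
      using v by (simp add: V.lincomb_def Ext1_simps)
    ultimately show "P \<in> V.span {?v}" by (auto simp: V.span_def intro!: exI[of _ "\<lambda>_. c"] exI[of _ "{?v}"])
  qed (use v V.span_is_subset2[of "{?v}"] in blast)
  then show "vectorspace.fin_dim class_ring ?Ext" using v by (auto simp: V.fin_dim_def intro!: exI[of _ "{?v}"])
  have "?v \<noteq> \<zero>\<^bsub>?Ext\<^esub>" using ext_class_inj[of m 1 0] by (auto simp: Ext1_simps)
  then show "vectorspace.dim class_ring ?Ext = 1" using gen v by (intro V.dim1I)
qed

lemma extension_module_cases:
  fixes S :: "('k::field_char_0 jordan_double, 's) module"
  assumes "extension_module jordan_double (L (m + 2)) (L m) S"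
  shows "isomorphic_modules jordan_double S (direct_sum (L (m + 2)) (L m)) \<or>
    isomorphic_modules jordan_double S (dual_module (T1 m))"
proof -
  obtain E :: "('k, 's) weight_extension" where E: "is_extension jordan_double (L (m + 2)) (L m) E" "middle E = S"
    using assms by (auto simp: extension_module_def)
  have iso: "isomorphic_modules jordan_double (middle F) (middle F')"
    if "equivalent_extensions jordan_double (L (m + 2)) F F'" for F :: "('k, 't) weight_extension"
      and F' :: "('k, 'u) weight_extension"
    using that by (auto simp: equivalent_extensions_def isomorphic_modules_def)
  obtain \<kappa> where \<kappa>: "equivalent_extensions jordan_double (L (m + 2)) (model_extension m \<kappa>) E"
    and c: "x_coefficient (m + 2) E \<kappa>"
    by (rule ex_x_coefficient[OF E(1)])
  show ?thesis
  proof (cases "\<kappa> = 0")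
    case True
    have "equivalent_extensions jordan_double (L (m + 2)) E (split_extension (L (m + 2)) (L m))"
      using equivalent_iff_x_coefficient[OF E(1) is_extension_split[OF left_module_L left_module_L] c]
        x_coefficient_split[of "m + 2"] True by simp
    from iso[OF this] show ?thesis using E(2) by (simp add: split_extension_def)
  next
    case False
    have "isomorphic_modules jordan_double S (model m \<kappa>)"
      using iso[OF equivalent_extensions_sym[OF is_extension_model \<kappa>]] E(2)
      by (simp add: model_extension_def)
    then show ?thesis
      using isomorphic_modules_trans model_isomorphic_dual_T1[OF False] by blast
  qed
qed

theorem proposition6p4:
  fixes n :: nat
  assumes "2 \<le> n"
  shows
    "(\<forall>S :: ('k::{alg_closed_field, field_char_0} jordan_double, 's) module.
        extension_module jordan_double (L n) (L (n - 2)) S \<longrightarrow>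
          isomorphic_modules jordan_double S (direct_sum (L n) (L (n - 2))) \<or>
          isomorphic_modules jordan_double S (dual_module (T1 (n - 2)))) \<and>
     vectorspace class_ring (Ext1 (L n :: ('k jordan_double, nat \<Rightarrow> 'k) module) (L (n - 2))) \<and>
     vectorspace.fin_dim class_ring (Ext1 (L n :: ('k jordan_double, nat \<Rightarrow> 'k) module) (L (n - 2))) \<and>
     vectorspace.dim class_ring (Ext1 (L n :: ('k jordan_double, nat \<Rightarrow> 'k) module) (L (n - 2))) = 1"
proof -
  obtain m where "n = m + 2" using assms by (metis le_add_diff_inverse2)
  then have "n = m + 2" "n - 2 = m" by simp_all
  then show ?thesis
    using extension_module_cases vectorspace_Ext1 dim_Ext1 by (simp only:) blast
qed

end
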